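(* Let $\Omega\subset\mathbb{R}^N$ ($N\ge 2$) be a bounded domain with smooth boundary, let $p,q,s\in C(\overline\Omega)$ satisfy $$1<p(x),\,q(x)<N<s(x)\quad\text{and}\quad s'(x)q(x)=\frac{s(x)q(x)}{s(x)-1}<p^*(x)\qquad\text{for all }x\in\overline\Omega,$$ and let $V\in L^{s(x)}(\Omega)$ with $V>0$. Let $\alpha>0$, and let $\widetilde{M_\alpha}$, $\widetilde{\Lambda_\alpha}$ and $\lambda_*$ (which depends on $\alpha$) be as defined in the context. Then: (1) If $0<\lambda<\lambda_*$, then $\lambda\notin\widetilde{\Lambda_\alpha}$. (2) If $q^-<p^-$, then for any $\alpha>0$ there exists $\lambda_\alpha>0$ such that every $\lambda\in(0,\lambda_\alpha)$ is an eigenvalue of the problem $-\Delta_{p(x)}u=\lambda V(x)|u|^{q(x)-2}u$ in $\Omega$, $u=0$ on $\partial\Omega$, with an eigenfunction in $\widetilde{M_\alpha}$. Moreover $\lambda_*=0$.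
   Context: For $h\in C(\overline\Omega)$ put $h^-=\min_{\overline\Omega}h$, $h^+=\max_{\overline\Omega}h$. $p^*(x)=\frac{Np(x)}{N-p(x)}$ when $p(x)<N$. $L^{s(x)}(\Omega)$ is the variable exponent Lebesgue space (Luxemburg norm $\|\cdot\|_{s(x)}$). $X=W_0^{1,p(x)}(\Omega)$ is the closure of $C_0^\infty(\Omega)$ in the variable exponent Sobolev space $W^{1,p(x)}(\Omega)$, with norm $\|u\|=\|\nabla u\|_{p(x)}$. $\Delta_{p(x)}u=\mathrm{div}(|\nabla u|^{p(x)-2}\nabla u)$. A pair $(\lambda,u)\in\mathbb{R}\times X$ with $u\ne0$ is an eigenpair ($\lambda$ an eigenvalue, $u$ an associated eigenfunction) if $$\int_\Omega|\nabla u|^{p(x)-2}\nabla u\cdot\nabla v\,dx=\lambda\int_\Omega V(x)|u|^{q(x)-2}uv\,dx\qquad\forall v\in X.$$ For $u\in X$: $G(u)=\int_\Omega\frac{1}{p(x)}|\nabla u|^{p(x)}dx$, $\psi(u)=\int_\Omega|\nabla u|^{p(x)}dx$, $\phi(u)=\int_\Omega V(x)|u|^{q(x)}dx$. For $\alpha>0$: $\widetilde{M_\alpha}=\{u\in X: G(u)\le\alpha\}$, $\widetilde{\Lambda_\alpha}=\{\lambda\in\mathbb{R}:\exists u\in\widetilde{M_\alpha}\text{ such that }(\lambda,u)\text{ is an eigenpair}\}$, and $\lambda_*=\inf_{u\in\widetilde{M_\alpha}\setminus\{0\}}\frac{\psi(u)}{\phi(u)}$. *)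

theory Defs
  imports "HOL-Analysis.Analysis"
begin

text \<open>
  Throughout, \<open>Om\<close> is the domain, and functions on \<open>Om\<close> are represented by total functions whose
  values outside \<open>Om\<close> play no role: all integrals and null sets refer to \<open>lebesgue_on Om\<close>.
  Elements of the function spaces are representatives, not equivalence classes; accordingly
  \<open>u = 0\<close> always means \<open>u x = 0\<close> for almost every \<open>x\<close> in \<open>Om\<close>.
\<close>


section \<open>Smooth functions, smooth boundaries, test functions\<close>

text \<open>\<open>Ck k S f\<close> is meant for open \<open>S\<close>. Continuity of \<open>f\<close> in the successor case follows
  from differentiability.\<close>

primrec Ck :: "nat \<Rightarrow> 'a::euclidean_space set \<Rightarrow> ('a \<Rightarrow> real) \<Rightarrow> bool" where
  "Ck 0 S f \<longleftrightarrow> continuous_on S f"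
| "Ck (Suc k) S f \<longleftrightarrow>
     (\<forall>x\<in>S. f differentiable (at x)) \<and>
     (\<forall>i\<in>Basis. Ck k S (\<lambda>x. frechet_derivative f (at x) i))"

definition smooth_fun :: "('a::euclidean_space \<Rightarrow> real) \<Rightarrow> bool" where
  "smooth_fun f \<longleftrightarrow> (\<forall>k. Ck k UNIV f)"

text \<open>Near each of its boundary points, the domain is the strict epigraph, in some unit direction
  \<open>e\<close>, of a smooth function of the remaining coordinates. The latter are given by the orthogonal
  projection along \<open>e\<close>, so a function \<open>\<gamma>\<close> on the whole space serves as a function of
  \<open>N - 1\<close> variables.\<close>

definition smooth_boundary :: "'a::euclidean_space set \<Rightarrow> bool" where
  "smooth_boundary Om \<longleftrightarrow>
     (\<forall>x0\<in>frontier Om. \<exists>r>0. \<exists>e \<gamma>. norm e = 1 \<and> smooth_fun \<gamma> \<and>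
        Om \<inter> ball x0 r = {x \<in> ball x0 r. \<gamma> (x - (x \<bullet> e) *\<^sub>R e) < x \<bullet> e})"

definition bounded_smooth_domain :: "'a::euclidean_space set \<Rightarrow> bool" where
  "bounded_smooth_domain Om \<longleftrightarrow>
     open Om \<and> connected Om \<and> Om \<noteq> {} \<and> bounded Om \<and> smooth_boundary Om"

definition test_fun :: "'a::euclidean_space set \<Rightarrow> ('a \<Rightarrow> real) \<Rightarrow> bool" where
  "test_fun Om f \<longleftrightarrow>
     smooth_fun f \<and> compact (closure {x. f x \<noteq> 0}) \<and> closure {x. f x \<noteq> 0} \<subseteq> Om"


section \<open>Variable exponent Lebesgue spaces\<close>

definition modular ::
  "'a::euclidean_space set \<Rightarrow> ('a \<Rightarrow> real) \<Rightarrow> ('a \<Rightarrow> 'b::real_normed_vector) \<Rightarrow> ennreal" where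
  "modular Om r f = (\<integral>\<^sup>+ x. ennreal (norm (f x) powr r x) \<partial>(lebesgue_on Om))"

definition Lvar ::
  "'a::euclidean_space set \<Rightarrow> ('a \<Rightarrow> real) \<Rightarrow> ('a \<Rightarrow> 'b::real_normed_vector) set" where
  "Lvar Om r = {f \<in> borel_measurable (lebesgue_on Om). modular Om r f < \<infinity>}"

definition luxemburg_norm ::
  "'a::euclidean_space set \<Rightarrow> ('a \<Rightarrow> real) \<Rightarrow> ('a \<Rightarrow> 'b::real_normed_vector) \<Rightarrow> real" where
  "luxemburg_norm Om r f = Inf {\<mu>. 0 < \<mu> \<and> modular Om r (\<lambda>x. f x /\<^sub>R \<mu>) \<le> 1}"


section \<open>Weak gradients and variable exponent Sobolev spaces\<close>

definition locally_integrable ::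
  "'a::euclidean_space set \<Rightarrow> ('a \<Rightarrow> 'b::euclidean_space) \<Rightarrow> bool" where
  "locally_integrable Om f \<longleftrightarrow> (\<forall>K. compact K \<and> K \<subseteq> Om \<longrightarrow> integrable (lebesgue_on K) f)"

definition is_weak_gradient ::
  "'a::euclidean_space set \<Rightarrow> ('a \<Rightarrow> real) \<Rightarrow> ('a \<Rightarrow> 'a) \<Rightarrow> bool" where
  "is_weak_gradient Om u g \<longleftrightarrow>
     locally_integrable Om u \<and> locally_integrable Om g \<and>
     (\<forall>f. test_fun Om f \<longrightarrow> (\<forall>i\<in>Basis.
        (LINT x|lebesgue_on Om. u x * frechet_derivative f (at x) i) =
        - (LINT x|lebesgue_on Om. (g x \<bullet> i) * f x)))"

text \<open>Weak gradients are unique up to null sets of \<open>Om\<close>, and everything below depends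
  on \<open>wgrad Om u\<close> only up to such sets.\<close>

definition wgrad :: "'a::euclidean_space set \<Rightarrow> ('a \<Rightarrow> real) \<Rightarrow> 'a \<Rightarrow> 'a" where
  "wgrad Om u = (SOME g. is_weak_gradient Om u g)"

definition W1 :: "'a::euclidean_space set \<Rightarrow> ('a \<Rightarrow> real) \<Rightarrow> ('a \<Rightarrow> real) set" where
  "W1 Om p = {u \<in> Lvar Om p. \<exists>g. is_weak_gradient Om u g \<and> g \<in> Lvar Om p}"

definition W1_norm :: "'a::euclidean_space set \<Rightarrow> ('a \<Rightarrow> real) \<Rightarrow> ('a \<Rightarrow> real) \<Rightarrow> real" where
  "W1_norm Om p u = luxemburg_norm Om p u + luxemburg_norm Om p (wgrad Om u)"

text \<open>The space \<open>X\<close>: the closure of the test functions in \<open>W1 Om p\<close>.\<close>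

definition W10 :: "'a::euclidean_space set \<Rightarrow> ('a \<Rightarrow> real) \<Rightarrow> ('a \<Rightarrow> real) set" where
  "W10 Om p = {u \<in> W1 Om p. \<forall>\<epsilon>>0. \<exists>f. test_fun Om f \<and> W1_norm Om p (\<lambda>x. u x - f x) < \<epsilon>}"

definition ae_zero :: "'a::euclidean_space set \<Rightarrow> ('a \<Rightarrow> real) \<Rightarrow> bool" where
  "ae_zero Om u \<longleftrightarrow> (AE x in lebesgue_on Om. u x = 0)"


section \<open>Exponents\<close>

text \<open>For continuous \<open>h\<close> and bounded nonempty \<open>Om\<close> the infimum is the minimum of \<open>h\<close> over the
  closure (\<open>Min\<close> is only available for finite sets).\<close>

definition h_minus :: "'a::euclidean_space set \<Rightarrow> ('a \<Rightarrow> real) \<Rightarrow> real" where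
  "h_minus Om h = (INF x\<in>closure Om. h x)"

definition p_star :: "('a::euclidean_space \<Rightarrow> real) \<Rightarrow> 'a \<Rightarrow> real" where
  "p_star p x = real DIM('a) * p x / (real DIM('a) - p x)"


section \<open>The eigenvalue problem\<close>

text \<open>Where \<open>wgrad Om u x = 0\<close>, resp. \<open>u x = 0\<close>, the integrands vanish, also for exponents
  below 2, since \<open>0 powr a = 0\<close>.\<close>

definition eigenpair ::
  "'a::euclidean_space set \<Rightarrow> ('a \<Rightarrow> real) \<Rightarrow> ('a \<Rightarrow> real) \<Rightarrow> ('a \<Rightarrow> real) \<Rightarrow>
   real \<Rightarrow> ('a \<Rightarrow> real) \<Rightarrow> bool" where
  "eigenpair Om p q V lam u \<longleftrightarrow>
     u \<in> W10 Om p \<and> \<not> ae_zero Om u \<and>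
     (\<forall>v \<in> W10 Om p.
        (LINT x|lebesgue_on Om.
           norm (wgrad Om u x) powr (p x - 2) * (wgrad Om u x \<bullet> wgrad Om v x)) =
        lam * (LINT x|lebesgue_on Om. V x * \<bar>u x\<bar> powr (q x - 2) * u x * v x))"

definition G_fun :: "'a::euclidean_space set \<Rightarrow> ('a \<Rightarrow> real) \<Rightarrow> ('a \<Rightarrow> real) \<Rightarrow> real" where
  "G_fun Om p u = (LINT x|lebesgue_on Om. 1 / p x * norm (wgrad Om u x) powr p x)"

definition psi_fun :: "'a::euclidean_space set \<Rightarrow> ('a \<Rightarrow> real) \<Rightarrow> ('a \<Rightarrow> real) \<Rightarrow> real" where
  "psi_fun Om p u = (LINT x|lebesgue_on Om. norm (wgrad Om u x) powr p x)"

definition phi_fun ::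
  "'a::euclidean_space set \<Rightarrow> ('a \<Rightarrow> real) \<Rightarrow> ('a \<Rightarrow> real) \<Rightarrow> ('a \<Rightarrow> real) \<Rightarrow> real" where
  "phi_fun Om q V u = (LINT x|lebesgue_on Om. V x * \<bar>u x\<bar> powr q x)"

definition M_set :: "'a::euclidean_space set \<Rightarrow> ('a \<Rightarrow> real) \<Rightarrow> real \<Rightarrow> ('a \<Rightarrow> real) set" where
  "M_set Om p \<alpha> = {u \<in> W10 Om p. G_fun Om p u \<le> \<alpha>}"

definition Lambda_set ::
  "'a::euclidean_space set \<Rightarrow> ('a \<Rightarrow> real) \<Rightarrow> ('a \<Rightarrow> real) \<Rightarrow> ('a \<Rightarrow> real) \<Rightarrow> real \<Rightarrow> real set" where
  "Lambda_set Om p q V \<alpha> = {lam. \<exists>u \<in> M_set Om p \<alpha>. eigenpair Om p q V lam u}"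

definition lambda_star ::
  "'a::euclidean_space set \<Rightarrow> ('a \<Rightarrow> real) \<Rightarrow> ('a \<Rightarrow> real) \<Rightarrow> ('a \<Rightarrow> real) \<Rightarrow> real \<Rightarrow> real" where
  "lambda_star Om p q V \<alpha> =
     (INF u \<in> {u \<in> M_set Om p \<alpha>. \<not> ae_zero Om u}. psi_fun Om p u / phi_fun Om q V u)"

end

theory Submission
  imports Defs "HOL-Complex_Analysis.Great_Picard"
begin

text \<open>
  Part (1) is the equation tested with \<open>v = u\<close>. For part (2), minimise
  \<open>J u = G u - lam * F u\<close>, where \<open>F u\<close> is the integral of \<open>V / q * \<bar>u\<bar> powr q\<close>, over the test
  functions with \<open>G \<le> \<alpha>\<close>. Since \<open>F\<close> is bounded there, \<open>J > 0\<close> where \<open>G = \<alpha>\<close> if \<open>lam\<close> is small;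
  a bump function supported where \<open>q\<close> is below the minimum of \<open>p\<close>, multiplied by a small number, shows
  that the infimum is negative, and also that the infimum \<open>lambda_star\<close> is zero. Hence a minimiser lies
  in the interior of the constraint and solves the Euler-Lagrange equation.

  The minimiser is obtained without reflexivity: \<open>F\<close> is continuous along bounded sequences that
  converge almost everywhere, and uniform convexity of \<open>G\<close> turns a minimising sequence into one with
  strongly convergent gradients. The Sobolev and Rellich theorems come from averaging
  \<open>f (x + T *\<^sub>R z) - f x\<close> over \<open>z\<close> in a ball that does not contain the origin.
\<close>

section \<open>Inequalities for powers\<close>

text \<open>Because the exponents vary with the point, modulars are neither homogeneous nor
  invariant under translation. Every estimate is therefore made for modulars, with constants
  depending only on bounds of the exponents; the Luxemburg norm enters only where \<open>W10\<close>
  is identified with limits of test functions. Averaging over \<open>x + t *\<^sub>R z\<close> keeps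
  \<open>x\<close> fixed, so Jensen's inequality can be used with the exponent frozen up to an error
  \<eta>. The strict inequality \<open>r x < p_star p x\<close> pays for \<eta> and leaves the
  weight \<open>t powr (\<delta> - 1)\<close>, which is integrable at 0. As \<open>z\<close> stays
  away from 0, all segments leave the bounded domain, and \<open>f x\<close> is recovered from the
  gradient alone. The weight \<open>V\<close> is handled by Young's inequality:
  \<open>V * \<bar>u\<bar> powr q\<close> is at most a small multiple of the power with exponent
  \<open>s * q / (s - 1)\<close> plus a fixed integrable function. A bound in that subcritical
  exponent thus acts as equi-integrability. The threshold for \<open>lam\<close> is
  \<open>\<alpha> / (C + 1)\<close>, where \<open>C\<close> bounds \<open>F\<close> on the
  constraint set.\<close>

lemma norm_add_powr_le:
  fixes a b :: "'b::real_normed_vector"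
  assumes "0 \<le> r" "r \<le> R"
  shows "norm (a + b) powr r \<le> 2 powr R * (norm a powr r + norm b powr r)"
proof -
  have "norm (a + b) powr r \<le> (2 * max (norm a) (norm b)) powr r"
    using assms norm_triangle_ineq[of a b] by (intro powr_mono2) auto
  also have "\<dots> = 2 powr r * (max (norm a) (norm b)) powr r"
    by (simp add: powr_mult max_def)
  also have "\<dots> \<le> 2 powr R * (norm a powr r + norm b powr r)"
    using assms by (intro mult_mono powr_mono) (auto simp: max_def)
  finally show ?thesis .
qed

lemma norm_diff_powr_le:
  fixes a b :: "'b::real_normed_vector"
  assumes "0 \<le> r" "r \<le> R"
  shows "norm (a - b) powr r \<le> 2 powr R * (norm a powr r + norm b powr r)"
  using norm_add_powr_le[OF assms, of a "- b"] by simp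

text \<open>The case \<open>u = 0\<close> is included because the mean value theorem asks for
  derivatives only inside the interval.\<close>

lemma powr_mvt:
  fixes u v r :: real
  assumes "0 \<le> u" "u < v" "1 \<le> r"
  obtains z where "u < z" "z < v" "v powr r - u powr r = (v - u) * (r * z powr (r - 1))"
proof -
  have cont: "continuous_on {u..v} (\<lambda>t. t powr r)"
    using assms by (intro continuous_on_powr' continuous_intros) auto
  have der: "((\<lambda>t. t powr r) has_derivative (\<lambda>h. h * (r * t powr (r - 1)))) (at t)" if "u < t" for t :: real
  proof -
    have "((\<lambda>t. t powr r) has_real_derivative r * t powr (r - 1)) (at t)"
      using that assms by (auto intro!: derivative_eq_intros simp: powr_diff)
    then show ?thesis by (simp add: has_field_derivative_def mult_commute_abs)
  qed
  show ?thesis using mvt[OF assms(2) cont der] that by auto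
qed

text \<open>By the mean value theorem the slopes over the two halves are values of the strictly
  increasing derivative at points on either side of the midpoint.\<close>

lemma midpoint_powr_less_aux:
  fixes x y r :: real
  assumes "1 < r" "0 \<le> x" "x < y"
  shows "((x + y) / 2) powr r < (x powr r + y powr r) / 2"
proof -
  define m where "m = (x + y) / 2"
  have m: "x < m" "m < y" using assms by (auto simp: m_def)
  obtain z where z: "x < z" "z < m" "m powr r - x powr r = (m - x) * (r * z powr (r - 1))"
    using powr_mvt[OF _ m(1)] assms by (metis less_imp_le)
  obtain z' where z': "m < z'" "z' < y" "y powr r - m powr r = (y - m) * (r * z' powr (r - 1))"
    using powr_mvt[OF _ m(2)] assms m by (metis less_imp_le order_trans)
  have "z powr (r - 1) < z' powr (r - 1)"
    using z z' assms by (intro powr_less_mono2) auto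
  then have "r * z powr (r - 1) < r * z' powr (r - 1)" using assms by simp
  moreover have "m - x = y - m" "0 < m - x" using m by (auto simp: m_def field_simps)
  ultimately have "m powr r - x powr r < y powr r - m powr r"
    unfolding z(3) z'(3) by (metis mult_strict_left_mono)
  then show ?thesis by (simp add: m_def)
qed

lemma midpoint_powr_less:
  fixes x y r :: real
  assumes "1 < r" "0 \<le> x" "0 \<le> y" "x \<noteq> y"
  shows "((x + y) / 2) powr r < (x powr r + y powr r) / 2"
  using midpoint_powr_less_aux[of r x y] midpoint_powr_less_aux[of r y x] assms
  by (cases "x < y") (auto simp: add.commute)

text \<open>There are two sources of strictness: for equal norms the parallelogram identity, for
  different norms the strict convexity of the real power.\<close>

lemma norm_midpoint_powr_less:
  fixes a b :: "'b::real_inner"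
  assumes "1 < r" "a \<noteq> b"
  shows "norm ((1/2) *\<^sub>R (a + b)) powr r < (norm a powr r + norm b powr r) / 2"
proof (cases "norm a = norm b")
  case True
  have "(norm (a + b))\<^sup>2 + (norm (a - b))\<^sup>2 = 2 * (norm a)\<^sup>2 + 2 * (norm b)\<^sup>2"
    by (simp add: power2_norm_eq_inner inner_simps inner_commute)
  then have "(norm (a + b))\<^sup>2 = (2 * norm a)\<^sup>2 - (norm (a - b))\<^sup>2"
    using True by (simp add: power_mult_distrib)
  moreover have "(norm (a - b))\<^sup>2 > 0" using assms by simp
  ultimately have "(norm (a + b))\<^sup>2 < (2 * norm a)\<^sup>2" by linarith
  then have "norm (a + b) < 2 * norm a"
    by (meson norm_ge_zero mult_nonneg_nonneg power2_less_imp_less zero_le_numeral)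
  then have "norm ((1/2) *\<^sub>R (a + b)) powr r < norm a powr r"
    using assms by (intro powr_less_mono2) auto
  then show ?thesis using True by simp
next
  case False
  have "norm ((1/2) *\<^sub>R (a + b)) powr r \<le> ((norm a + norm b) / 2) powr r"
    using assms norm_triangle_ineq[of a b] by (intro powr_mono2) auto
  also have "\<dots> < (norm a powr r + norm b powr r) / 2"
    using False assms by (intro midpoint_powr_less) auto
  finally show ?thesis .
qed

lemma norm_midpoint_powr_le:
  fixes a b :: "'b::real_inner"
  assumes "1 < r"
  shows "norm ((1/2) *\<^sub>R (a + b)) powr r \<le> (norm a powr r + norm b powr r) / 2"
proof (cases "a = b")
  case True
  then have "(1/2) *\<^sub>R (a + b) = a" by (simp flip: scaleR_2)
  with True show ?thesis by simp
qed (use norm_midpoint_powr_less[OF assms, of a b] in simp)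

text \<open>By homogeneity it is enough to consider \<open>max (norm a) (norm b) = 1\<close>, where the
  deficit in the convexity inequality is bounded below by compactness.\<close>

lemma uniform_convexity_powr:
  fixes l u \<eta> :: real
  assumes "1 < l" "l \<le> u" "0 < \<eta>"
  shows "\<exists>K\<ge>0. \<forall>(a::'b::euclidean_space) b r. l \<le> r \<longrightarrow> r \<le> u \<longrightarrow>
    norm (a - b) powr r \<le> \<eta> * (norm a powr r + norm b powr r)
      + K * ((norm a powr r + norm b powr r) / 2 - norm ((1/2) *\<^sub>R (a + b)) powr r)"
proof -
  define D where "D = (\<lambda>(a::'b, b::'b, r::real).
    (norm a powr r + norm b powr r) / 2 - norm ((1/2) *\<^sub>R (a + b)) powr r)"
  define E where "E = (\<lambda>(a::'b, b::'b, r::real).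
    norm (a - b) powr r - \<eta> * (norm a powr r + norm b powr r))"
  define T where "T = cball (0::'b) 1 \<times> cball (0::'b) 1 \<times> {l..u}"
  define S1 where "S1 = {z\<in>T. max (norm (fst z)) (norm (fst (snd z))) = 1}"
  \<comment> \<open>\<open>S\<close> collects the normalised triples for which the term with \<eta>
    alone does not suffice. It does suffice when \<open>a = b\<close>, so the deficit
    \<open>D\<close> is positive on \<open>S\<close>.\<close>
  define S where "S = {z\<in>S1. 0 \<le> E z}"
  have T: "compact T" unfolding T_def by (intro compact_Times) auto
  have rT: "1 < snd (snd z)" if "z \<in> T" for z using that assms by (auto simp: T_def)
  have contD: "continuous_on T D" unfolding D_def case_prod_beta
    by (intro continuous_intros continuous_on_powr') (use rT in force)+
  have contE: "continuous_on T E" unfolding E_def case_prod_beta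
    by (intro continuous_intros continuous_on_powr') (use rT in force)+
  have S1: "closed S1" unfolding S1_def
    by (intro continuous_closed_preimage_constant continuous_intros compact_imp_closed T)
  have "closed S" unfolding S_def
  proof (rule continuous_on_closed_Collect_le[OF _ _ S1])
    show "continuous_on S1 E" using contE by (rule continuous_on_subset) (auto simp: S1_def)
  qed auto
  from compact_Int_closed[OF T this] have S: "compact S"
    by (metis (no_types, lifting) Int_absorb1 S1_def S_def mem_Collect_eq subsetI)
  have Dpos: "0 < D z" if "z \<in> S" for z
  proof -
    obtain a b r where z: "z = (a, b, r)" by (cases z)
    have r: "1 < r" using rT[of z] that by (auto simp: S_def S1_def z)
    have "a \<noteq> b"
    proof
      assume "a = b"
      then have "norm b = 1" "0 \<le> - (2 * \<eta>)"
        using that r by (auto simp: S_def S1_def E_def z)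
      then show False using assms by simp
    qed
    then show ?thesis using norm_midpoint_powr_less[OF r] by (simp add: D_def z)
  qed
  obtain d where d: "0 < d" "\<And>z. z \<in> S \<Longrightarrow> d \<le> D z"
  proof (cases "S = {}")
    case True then show ?thesis using that[of 1] by auto
  next
    case False
    have "continuous_on S D" using contD by (rule continuous_on_subset) (auto simp: S_def S1_def)
    from continuous_attains_inf[OF S False this] Dpos show ?thesis using that by metis
  qed
  \<comment> \<open>For normalised vectors the left-hand side is at most
    \<open>2 powr u * 2\<close>, while \<open>D\<close> is at least \<open>d\<close> on
    \<open>S\<close>.\<close>
  define K where "K = 2 powr u * 2 / d"
  have K: "0 \<le> K" using d by (simp add: K_def)
  have norm1: "norm (a - b) powr r \<le> \<eta> * (norm a powr r + norm b powr r)
      + K * ((norm a powr r + norm b powr r) / 2 - norm ((1/2) *\<^sub>R (a + b)) powr r)"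
    if "max (norm a) (norm b) = 1" "l \<le> r" "r \<le> u" for a b :: 'b and r
  proof (cases "(a, b, r) \<in> S")
    case True
    have ab: "norm a \<le> 1" "norm b \<le> 1" using that(1) by (auto simp: max_def split: if_splits)
    have "norm a powr r + norm b powr r \<le> 2"
      using that assms ab powr_le1[of r "norm a"] powr_le1[of r "norm b"] by simp
    then have "2 powr u * (norm a powr r + norm b powr r) \<le> 2 powr u * 2"
      by (rule mult_left_mono) simp
    then have "norm (a - b) powr r \<le> 2 powr u * 2"
      using norm_diff_powr_le[of r u a b] that assms by linarith
    also have "\<dots> = K * d" using d by (simp add: K_def)
    also have "\<dots> \<le> K * D (a, b, r)" using d(2)[OF True] K by (rule mult_left_mono)
    finally show ?thesis using assms by (simp add: D_def add_increasing)
  next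
    case False
    have ab: "norm a \<le> 1" "norm b \<le> 1" using that(1) by (auto simp: max_def split: if_splits)
    have "E (a, b, r) < 0" using False that ab by (auto simp: S_def S1_def T_def)
    moreover have "0 \<le> K * ((norm a powr r + norm b powr r) / 2 - norm ((1/2) *\<^sub>R (a + b)) powr r)"
      using K norm_midpoint_powr_le[of r a b] that assms by (intro mult_nonneg_nonneg) auto
    ultimately show ?thesis by (simp add: E_def)
  qed
  have "norm (a - b) powr r \<le> \<eta> * (norm a powr r + norm b powr r)
      + K * ((norm a powr r + norm b powr r) / 2 - norm ((1/2) *\<^sub>R (a + b)) powr r)"
    if r: "l \<le> r" "r \<le> u" for a b :: 'b and r
  proof (cases "a = 0 \<and> b = 0")
    case False
    define t where "t = max (norm a) (norm b)"
    have t: "0 < t" using False by (auto simp: t_def max_def)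
    define a' b' where "a' = a /\<^sub>R t" and "b' = b /\<^sub>R t"
    have eq: "a = t *\<^sub>R a'" "b = t *\<^sub>R b'" using t by (auto simp: a'_def b'_def)
    have "max (norm a') (norm b') = max (norm a) (norm b) / t"
      using t by (simp add: a'_def b'_def max_def field_simps)
    then have "max (norm a') (norm b') = 1" using t by (simp add: t_def)
    from norm1[OF this r] have le: "t powr r * norm (a' - b') powr r \<le> t powr r * (\<eta> * (norm a' powr r + norm b' powr r)
      + K * ((norm a' powr r + norm b' powr r) / 2 - norm ((1/2) *\<^sub>R (a' + b')) powr r))"
      by (intro mult_left_mono) auto
    have "norm (t *\<^sub>R v) powr r = t powr r * norm v powr r" for v :: 'b
      using t by (simp add: powr_mult)
    moreover have "a - b = t *\<^sub>R (a' - b')" "(1/2) *\<^sub>R (a + b) = t *\<^sub>R ((1/2) *\<^sub>R (a' + b'))"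
      unfolding eq by (auto simp: algebra_simps)
    ultimately have "norm (a - b) powr r = t powr r * norm (a' - b') powr r"
      "norm ((1/2) *\<^sub>R (a + b)) powr r = t powr r * norm ((1/2) *\<^sub>R (a' + b')) powr r"
      "norm a powr r = t powr r * norm a' powr r" "norm b powr r = t powr r * norm b' powr r"
      by (metis eq)+
    then show ?thesis using le by (simp add: algebra_simps add_divide_distrib)
  qed (use assms r in auto)
  with K show ?thesis by blast
qed

text \<open>Young's inequality with constants independent of \<open>r\<close>. Comparing
  \<open>b\<close> with \<open>\<epsilon> * a\<close> replaces conjugate exponents: in each case the
  smaller quantity is replaced by the larger one.\<close>

lemma powr_mult_young:
  fixes a b r R \<epsilon> :: real
  assumes "0 \<le> a" "0 \<le> b" "1 \<le> r" "r \<le> R" "0 < \<epsilon>" "\<epsilon> \<le> 1"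
  shows "a powr (r - 1) * b \<le> \<epsilon> * a powr r + (1 / \<epsilon>) powr R * b powr r"
proof (cases "b \<le> \<epsilon> * a")
  case True
  have "a powr (r - 1) * b \<le> a powr (r - 1) * (\<epsilon> * a)"
    using True by (intro mult_left_mono) auto
  also have "\<dots> = \<epsilon> * a powr r" using assms by (cases "a = 0") (auto simp: powr_diff)
  finally show ?thesis by (simp add: add_increasing2)
next
  case False
  then have b: "0 < b" "a \<le> b / \<epsilon>"
    using assms mult_nonneg_nonneg[of \<epsilon> a] by (linarith, simp add: field_simps)
  have "a powr (r - 1) * b \<le> (b / \<epsilon>) powr (r - 1) * b"
    using assms b by (intro mult_right_mono powr_mono2) auto
  also have "\<dots> = (1 / \<epsilon>) powr (r - 1) * b powr r"
    using assms b by (simp add: powr_divide powr_diff field_simps)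
  also have "\<dots> \<le> (1 / \<epsilon>) powr R * b powr r"
    using assms by (intro mult_right_mono powr_mono) auto
  finally show ?thesis using assms by (simp add: add_increasing)
qed

text \<open>The threshold \<open>v = \<delta> * w powr (q / (s - 1))\<close> is chosen so that below
  it the product has the exponent \<open>q / (s - 1) + q\<close>, which is q times the conjugate
  exponent of s; above it \<open>w powr q\<close> is controlled by a power of
  \<open>v\<close>.\<close>

lemma weight_powr_young:
  fixes v w \<delta> s S q :: real
  assumes "0 \<le> v" "0 \<le> w" "1 < s" "s \<le> S" "0 < q" "0 < \<delta>" "\<delta> \<le> 1"
  shows "v * w powr q \<le> \<delta> * w powr (s * q / (s - 1)) + (1 / \<delta>) powr S * v powr s"
proof (cases "v \<le> \<delta> * w powr (q / (s - 1))")
  case True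
  have "v * w powr q \<le> (\<delta> * w powr (q / (s - 1))) * w powr q"
    using True by (intro mult_right_mono) auto
  also have "\<dots> = \<delta> * w powr (q / (s - 1) + q)" by (simp add: powr_add)
  also have "q / (s - 1) + q = s * q / (s - 1)" using assms by (simp add: field_simps)
  finally show ?thesis by (simp add: add_increasing2)
next
  case False
  have "0 \<le> \<delta> * w powr (q / (s - 1))" using assms by simp
  with False have v: "0 < v" by linarith
  have "w powr (q / (s - 1)) \<le> v / \<delta>" using False assms by (simp add: field_simps)
  then have "(w powr (q / (s - 1))) powr (s - 1) \<le> (v / \<delta>) powr (s - 1)"
    using assms by (intro powr_mono2) auto
  then have "w powr q \<le> (v / \<delta>) powr (s - 1)" using assms by (simp add: powr_powr)
  then have "v * w powr q \<le> v * (v / \<delta>) powr (s - 1)" using v by simp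
  also have "\<dots> = (1 / \<delta>) powr (s - 1) * v powr s"
    using v assms by (simp add: powr_divide powr_diff field_simps)
  also have "\<dots> \<le> (1 / \<delta>) powr S * v powr s"
    using assms by (intro mult_right_mono powr_mono) auto
  finally show ?thesis using assms by (simp add: add_increasing)
qed

lemma powr_diff_le:
  fixes x y m r :: real
  assumes "0 \<le> x" "0 \<le> y" "x \<le> m" "y \<le> m" "1 \<le> r"
  shows "\<bar>x powr r - y powr r\<bar> \<le> r * m powr (r - 1) * \<bar>x - y\<bar>"
proof -
  have *: "v powr r - u powr r \<le> r * m powr (r - 1) * (v - u)" if uv: "0 \<le> u" "u < v" "v \<le> m" for u v :: real
  proof -
    obtain z where z: "u < z" "z < v" "v powr r - u powr r = (v - u) * (r * z powr (r - 1))"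
      using powr_mvt[OF uv(1,2) assms(5)] by blast
    have "z powr (r - 1) \<le> m powr (r - 1)" using z that assms by (intro powr_mono2) auto
    then have "r * z powr (r - 1) \<le> r * m powr (r - 1)" using assms by (simp add: mult_left_mono)
    then have "(v - u) * (r * z powr (r - 1)) \<le> (v - u) * (r * m powr (r - 1))" using uv by (simp only: mult_left_mono diff_ge_0_iff_ge less_imp_le)
    then show ?thesis using z(3) by (simp add: mult.commute)
  qed
  have mono: "u powr r \<le> v powr r" if "0 \<le> u" "u \<le> v" for u v
    using that assms by (intro powr_mono2) auto
  show ?thesis
  proof (cases x y rule: linorder_cases)
    case less then show ?thesis using *[of x y] assms mono[of x y] by simp
  next
    case greater then show ?thesis using *[of y x] assms mono[of y x] by simp
  qed auto
qed

text \<open>A bound of the difference quotients that does not depend on \<open>t\<close>; it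
  supplies the majorant when the functionals are differentiated under the integral.\<close>

lemma norm_powr_quotient_bound:
  fixes a b :: "'b::real_normed_vector"
  assumes "1 \<le> r" "0 < t" "t \<le> 1"
  shows "\<bar>(norm (a + t *\<^sub>R b) powr r - norm a powr r) / t\<bar> \<le> r * (norm a + norm b) powr (r - 1) * norm b"
proof -
  have "norm (a + t *\<^sub>R b) \<le> norm a + norm b"
    using norm_triangle_ineq[of a "t *\<^sub>R b"] assms mult_left_le_one_le[of "norm b" t] by simp
  then have "\<bar>norm (a + t *\<^sub>R b) powr r - norm a powr r\<bar>
     \<le> r * (norm a + norm b) powr (r - 1) * \<bar>norm (a + t *\<^sub>R b) - norm a\<bar>"
    using assms by (intro powr_diff_le) auto
  also have "\<dots> \<le> r * (norm a + norm b) powr (r - 1) * (t * norm b)"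
    using assms norm_triangle_ineq3[of "a + t *\<^sub>R b" a] by (intro mult_left_mono) auto
  finally show ?thesis using assms by (simp add: field_simps)
qed

text \<open>For \<open>a \<noteq> 0\<close> the power is a smooth function of the squared norm,
  which is a polynomial in \<open>t\<close>. For \<open>a = 0\<close> the quotient has size
  \<open>\<bar>t\<bar> powr (r - 1)\<close> up to a factor and tends to 0, in agreement with the
  convention for \<open>0 powr (r - 2)\<close>.\<close>

lemma norm_powr_directional_derivative:
  fixes a b :: "'b::real_inner"
  assumes "1 < r"
  shows "((\<lambda>t. norm (a + t *\<^sub>R b) powr r) has_real_derivative r * (norm a powr (r - 2) * (a \<bullet> b))) (at 0)"
proof (cases "a = 0")
  case True
  have "((\<lambda>t. norm b powr r * (\<bar>t\<bar> powr (r - 1))) \<longlongrightarrow> norm b powr r * \<bar>0\<bar> powr (r - 1)) (at (0::real))"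
    using assms by (intro tendsto_intros tendsto_powr') auto
  then have lim: "((\<lambda>t. norm b powr r * (\<bar>t\<bar> powr (r - 1))) \<longlongrightarrow> 0) (at (0::real))" using assms by simp
  have "((\<lambda>t. (norm (t *\<^sub>R b) powr r) / t) \<longlongrightarrow> 0) (at (0::real))"
  proof (rule Lim_null_comparison[OF _ lim], intro always_eventually allI)
    fix t :: real
    show "norm (norm (t *\<^sub>R b) powr r / t) \<le> norm b powr r * \<bar>t\<bar> powr (r - 1)"
      by (cases "t = 0") (auto simp: powr_mult powr_diff field_simps)
  qed
  then show ?thesis using True by (simp add: has_field_derivative_iff)
next
  case False
  have 1: "((\<lambda>t. (norm (a + t *\<^sub>R b))\<^sup>2) has_real_derivative 2 * (a \<bullet> b)) (at 0)"
    unfolding power2_norm_eq_inner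
    by (auto intro!: derivative_eq_intros simp: inner_commute has_field_derivative_def)
  have 2: "norm (a + t *\<^sub>R b) powr r = ((norm (a + t *\<^sub>R b))\<^sup>2) powr (r / 2)" for t
  proof (cases "a + t *\<^sub>R b = 0")
    case False
    then have "((norm (a + t *\<^sub>R b))\<^sup>2) powr (r / 2) = (norm (a + t *\<^sub>R b) powr 2) powr (r / 2)"
      by (subst powr_numeral) auto
    also have "\<dots> = norm (a + t *\<^sub>R b) powr r" by (subst powr_powr) simp
    finally show ?thesis ..
  qed (use assms in simp)
  have "((\<lambda>t. ((norm (a + t *\<^sub>R b))\<^sup>2) powr (r / 2)) has_real_derivative
      (r / 2) * ((norm a)\<^sup>2) powr (r / 2 - 1) * (2 * (a \<bullet> b))) (at 0)"
    using DERIV_fun_powr[OF 1, of "r / 2"] False by simp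
  moreover have "((norm a)\<^sup>2) powr (r / 2 - 1) = norm a powr (r - 2)"
  proof -
    have "((norm a)\<^sup>2) powr (r / 2 - 1) = (norm a powr 2) powr (r / 2 - 1)"
      using False by (subst powr_numeral) auto
    also have "\<dots> = norm a powr (2 * (r / 2 - 1))" by (rule powr_powr)
    also have "2 * (r / 2 - 1) = r - 2" by simp
    finally show ?thesis .
  qed
  ultimately show ?thesis unfolding 2 by (simp add: mult_ac)
qed

section \<open>Vitali convergence and completeness for modulars\<close>

text \<open>Equi-integrability in the form in which Young's inequality delivers it: for each
  \<open>d\<close> there is a majorant \<open>W\<close>, which may depend on \<open>d\<close>, up to
  remainders whose integrals are eventually at most \<open>d\<close>.\<close>

lemma vitali_convergence:
  fixes X :: "nat \<Rightarrow> 'a \<Rightarrow> real"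
  assumes X [measurable]: "\<And>n. X n \<in> borel_measurable M"
    and nn: "\<And>n. AE x in M. 0 \<le> X n x"
    and lim: "AE x in M. (\<lambda>n. X n x) \<longlonglongrightarrow> 0"
    and dom: "\<And>d. 0 < d \<Longrightarrow> \<exists>W Y. integrable M W \<and> (\<forall>n. integrable M (Y n)) \<and>
       (\<forall>n. AE x in M. X n x \<le> W x + Y n x \<and> 0 \<le> Y n x) \<and>
       (\<forall>\<^sub>F n in sequentially. (LINT x|M. Y n x) \<le> d)"
  shows "\<And>n. integrable M (X n)" "(\<lambda>n. LINT x|M. X n x) \<longlonglongrightarrow> 0"
proof -
  show int: "integrable M (X n)" for n
  proof -
    from dom[of 1] obtain W Y where WY: "integrable M W" "integrable M (Y n)"
      "AE x in M. X n x \<le> W x + Y n x \<and> 0 \<le> Y n x" by (meson zero_less_one)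
    show ?thesis
    proof (rule Bochner_Integration.integrable_bound[of M "\<lambda>x. W x + Y n x"])
      show "AE x in M. norm (X n x) \<le> norm (W x + Y n x)"
        using WY(3) nn[of n] by eventually_elim auto
    qed (use WY in auto)
  qed
  show "(\<lambda>n. LINT x|M. X n x) \<longlonglongrightarrow> 0"
  proof (rule LIMSEQ_I)
    fix e :: real assume e: "0 < e"
    from dom[of "e/2"] e obtain W Y where W: "integrable M W" and Y: "\<And>n. integrable M (Y n)"
      and le: "\<And>n. AE x in M. X n x \<le> W x + Y n x \<and> 0 \<le> Y n x"
      and ev: "\<forall>\<^sub>F n in sequentially. (LINT x|M. Y n x) \<le> e/2" by auto
    \<comment> \<open>Truncation at the majorant: dominated convergence applies to \<open>Z\<close>,
      and \<open>X n \<le> Z n + Y n\<close> holds in either case of the minimum.\<close>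
    define Z where "Z n x = min (X n x) \<bar>W x\<bar>" for n x
    have [measurable]: "W \<in> borel_measurable M" using W by auto
    have Zm: "Z n \<in> borel_measurable M" for n unfolding Z_def by measurable
    have Zb: "AE x in M. norm (Z n x) \<le> \<bar>W x\<bar>" for n
      using nn[of n] by eventually_elim (auto simp: Z_def)
    have Zlim: "AE x in M. (\<lambda>n. Z n x) \<longlonglongrightarrow> 0"
    proof -
      have "AE x in M. \<forall>n. 0 \<le> X n x" using nn by (simp add: AE_all_countable)
      then show ?thesis using lim
      proof eventually_elim
        case (elim x)
        show ?case
          by (rule tendsto_sandwich[OF _ _ tendsto_const elim(2)])
             (use elim in \<open>auto simp: Z_def\<close>)
      qed
    qed
    have Zint: "integrable M (Z n)" for n
      using integrable_dominated_convergence2[OF _ Zm _ Zlim Zb] W by auto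
    have "(\<lambda>n. LINT x|M. Z n x) \<longlonglongrightarrow> (LINT x|M. 0)"
      by (rule integral_dominated_convergence[OF _ Zm _ Zlim Zb]) (use W in auto)
    then have "\<forall>\<^sub>F n in sequentially. (LINT x|M. Z n x) < e/2"
      using e by (intro order_tendstoD(2)) auto
    with ev have "\<forall>\<^sub>F n in sequentially. norm ((LINT x|M. X n x) - 0) < e"
    proof eventually_elim
      case (elim n)
      have "(LINT x|M. X n x) \<le> (LINT x|M. Z n x + Y n x)"
      proof (rule integral_mono_AE[OF int])
        show "integrable M (\<lambda>x. Z n x + Y n x)" using Zint Y by simp
        show "AE x in M. X n x \<le> Z n x + Y n x" using le[of n] by eventually_elim (auto simp: Z_def)
      qed
      also have "\<dots> = (LINT x|M. Z n x) + (LINT x|M. Y n x)"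
        using Zint Y by simp
      finally have "(LINT x|M. X n x) < e" using elim by linarith
      moreover have "0 \<le> (LINT x|M. X n x)" using nn[of n] by (intro integral_nonneg_AE)
      ultimately show ?case by simp
    qed
    then show "\<exists>no. \<forall>n\<ge>no. norm ((LINT x|M. X n x) - 0) < e"
      by (simp add: eventually_sequentially)
  qed
qed

lemma integrable_fatou:
  fixes X :: "nat \<Rightarrow> 'a \<Rightarrow> real"
  assumes X: "\<And>n. integrable M (X n)" and nn: "\<And>n. AE x in M. 0 \<le> X n x"
    and lim: "AE x in M. (\<lambda>n. X n x) \<longlonglongrightarrow> Z x" and Z [measurable]: "Z \<in> borel_measurable M"
    and bd: "\<forall>\<^sub>F n in sequentially. (LINT x|M. X n x) \<le> C"
  shows "integrable M Z" "(LINT x|M. Z x) \<le> C"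
proof -
  have [measurable]: "X n \<in> borel_measurable M" for n using X by auto
  have all: "AE x in M. \<forall>n. 0 \<le> X n x" using nn by (simp add: AE_all_countable)
  then have Zn: "AE x in M. 0 \<le> Z x" using lim
    by eventually_elim (auto intro: LIMSEQ_le_const)
  have C: "0 \<le> C"
  proof -
    obtain n where "(LINT x|M. X n x) \<le> C" using bd by (auto simp: eventually_sequentially)
    moreover have "0 \<le> (LINT x|M. X n x)" using nn[of n] by (intro integral_nonneg_AE)
    ultimately show ?thesis by simp
  qed
  have "(\<integral>\<^sup>+ x. ennreal (Z x) \<partial>M) = (\<integral>\<^sup>+ x. liminf (\<lambda>n. ennreal (X n x)) \<partial>M)"
    using lim by (intro nn_integral_cong_AE) (auto elim!: eventually_mono
      intro!: lim_imp_Liminf[symmetric] tendsto_ennrealI)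
  also have "\<dots> \<le> liminf (\<lambda>n. \<integral>\<^sup>+ x. ennreal (X n x) \<partial>M)"
    by (intro nn_integral_liminf) measurable
  also have "\<dots> \<le> liminf (\<lambda>n. ennreal C)"
    using bd by (intro Liminf_mono) (auto elim!: eventually_mono simp: nn_integral_eq_integral[OF X nn] intro: ennreal_leI)
  finally have le: "(\<integral>\<^sup>+ x. ennreal (Z x) \<partial>M) \<le> ennreal C" by (simp add: Liminf_const)
  have "integrable M Z \<and> (LINT x|M. Z x) \<le> C"
    using nn_integral_eq_integral[of M Z]
  proof -
    have i: "integrable M Z"
      using le Zn by (intro integrableI_bounded) 
        (auto simp: le_less_trans cong: nn_integral_cong_AE intro!: le_less_trans[OF _ ennreal_less_top[of C]] elim: order_trans[rotated] nn_integral_mono_AE[THEN order_trans, rotated])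
    then show ?thesis using nn_integral_eq_integral[OF i Zn] le C by (simp add: ennreal_le_iff)
  qed
  then show "integrable M Z" "(LINT x|M. Z x) \<le> C" by auto
qed

text \<open>Completeness with respect to the modular. Young's inequality against the constant 1
  makes the sequence Cauchy in L1, which gives an almost everywhere limit along a subsequence;
  Fatou's lemma then carries the modular Cauchy estimate over to this limit.\<close>

lemma L1_cauchy_modular:
  fixes f :: "nat \<Rightarrow> 'a \<Rightarrow> 'b::euclidean_space"
  assumes "finite_measure M"
    and f [measurable]: "\<And>n. f n \<in> borel_measurable M"
    and r [measurable]: "r \<in> borel_measurable M" and r1: "AE x in M. 1 < r x \<and> r x \<le> R"
    and int: "\<And>n m. integrable M (\<lambda>x. norm (f n x - f m x) powr r x)"
    and f0: "integrable M (\<lambda>x. norm (f 0 x) powr r x)"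
    and C: "\<And>e. 0 < e \<Longrightarrow> \<exists>N. \<forall>n\<ge>N. \<forall>m\<ge>N. (LINT x|M. norm (f n x - f m x) powr r x) \<le> e"
  shows "\<exists>g. g \<in> borel_measurable M \<and> (\<exists>k. strict_mono k \<and> (AE x in M. (\<lambda>n. f (k n) x) \<longlonglongrightarrow> g x))
     \<and> (\<forall>n. integrable M (\<lambda>x. norm (f n x - g x) powr r x))
     \<and> (\<lambda>n. LINT x|M. norm (f n x - g x) powr r x) \<longlonglongrightarrow> 0"
proof -
  interpret finite_measure M by fact
  have le1: "norm (v::'b) \<le> 1 + norm v powr r" if "1 < r" for v r
    using powr_mono[of 1 r "norm v"] that by (cases "norm v \<le> 1") (auto simp: add_increasing add_increasing2)
  have intd: "integrable M (\<lambda>x. f n x - f m x)" for n m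
    by (rule Bochner_Integration.integrable_bound[of M "\<lambda>x. 1 + norm (f n x - f m x) powr r x"])
       (use int r1 le1 in \<open>auto elim!: eventually_mono\<close>)
  have young: "norm v \<le> d + (1 / d) powr R * norm v powr r" if "0 < d" "d \<le> 1" "1 < r" "r \<le> R" for v :: 'b and r d
  proof -
    have "1 powr (r - 1) * norm v \<le> d * 1 powr r + (1 / d) powr R * norm v powr r"
      using that by (intro powr_mult_young) auto
    then show ?thesis by simp
  qed
  \<comment> \<open>The differences are integrable by \<open>intd\<close>, so the L1 theorem on
    subsequences is applied to \<open>f n - f 0\<close>; the term \<open>f 0\<close> is added back
    pointwise.\<close>
  define s where "s n x = f n x - f 0 x" for n x
  have cs: "\<exists>N. \<forall>i\<ge>N. \<forall>j\<ge>N. (LINT x|M. norm (s i x - s j x)) < e" if e: "0 < e" for e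
  proof -
    \<comment> \<open>The constant term of Young's inequality then integrates to at most
      \<open>e / 2\<close>; the summand 1 covers a space of measure zero.\<close>
    define d where "d = min 1 (e / (2 * (measure M (space M) + 1)))"
    have mn: "0 \<le> measure M (space M)" by simp
    from mn have "0 < measure M (space M) + 1" by linarith
    then have "0 < e / (2 * (measure M (space M) + 1))"
      using e by (intro divide_pos_pos mult_pos_pos) auto
    then have d: "0 < d" "d \<le> 1" by (auto simp: d_def)
    have "d * (measure M (space M) + 1) \<le> e / (2 * (measure M (space M) + 1)) * (measure M (space M) + 1)"
      using \<open>0 < measure M (space M) + 1\<close> by (intro mult_right_mono) (auto simp: d_def)
    also have "\<dots> = e / 2" using \<open>0 < measure M (space M) + 1\<close> by (simp add: field_simps)
    finally have d3: "d * measure M (space M) \<le> e / 2" using d by (simp add: algebra_simps)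
    define K where "K = (1 / d) powr R"
    have K: "0 < K" using d by (simp add: K_def)
    obtain N where N: "\<And>n m. n \<ge> N \<Longrightarrow> m \<ge> N \<Longrightarrow> (LINT x|M. norm (f n x - f m x) powr r x) \<le> e / (4 * K)"
      using C[of "e / (4 * K)"] e K by auto
    have "(LINT x|M. norm (s i x - s j x)) < e" if "i \<ge> N" "j \<ge> N" for i j
    proof -
      have "(LINT x|M. norm (s i x - s j x)) \<le> (LINT x|M. d + K * norm (f i x - f j x) powr r x)"
      proof (rule integral_mono_AE)
        show "integrable M (\<lambda>x. norm (s i x - s j x))" using intd[of i j] by (auto simp: s_def)
        show "integrable M (\<lambda>x. d + K * norm (f i x - f j x) powr r x)" using int by auto
        show "AE x in M. norm (s i x - s j x) \<le> d + K * norm (f i x - f j x) powr r x"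
          using r1 unfolding K_def s_def by eventually_elim (use young[of d] d in auto)
      qed
      also have "\<dots> = d * measure M (space M) + K * (LINT x|M. norm (f i x - f j x) powr r x)"
        using int by (simp add: mult.commute)
      also have "\<dots> \<le> e / 2 + K * (e / (4 * K))"
        using N[OF that] d3 K by (intro add_mono mult_left_mono) auto
      also have "\<dots> < e" using e K by simp
      finally show ?thesis .
    qed
    then show ?thesis by blast
  qed
  have "\<And>n. integrable M (s n)" unfolding s_def by (rule intd)
  then obtain k where k: "strict_mono k" "AE x in M. Cauchy (\<lambda>i. s (k i) x)"
    using cauchy_L1_AE_cauchy_subseq[of M s] cs by blast
  define g where "g x = lim (\<lambda>i. f (k i) x)" for x
  have gm [measurable]: "g \<in> borel_measurable M" unfolding g_def by measurable
  have lim: "AE x in M. (\<lambda>i. f (k i) x) \<longlonglongrightarrow> g x" using k(2)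
  proof eventually_elim
    case (elim x)
    then have "convergent (\<lambda>i. s (k i) x)" by (simp add: Cauchy_convergent_iff)
    then have "convergent (\<lambda>i. s (k i) x + f 0 x)" by (intro convergent_add convergent_const)
    then show ?case unfolding g_def s_def by (simp add: convergent_LIMSEQ_iff)
  qed
  have lim2: "AE x in M. (\<lambda>i. norm (f n x - f (k i) x) powr r x) \<longlonglongrightarrow> norm (f n x - g x) powr r x" for n
    using lim r1 by eventually_elim (auto intro!: tendsto_intros tendsto_powr')
  \<comment> \<open>Here \<open>n\<close> is fixed and Fatou's lemma is applied in the second index
    along \<open>k\<close>.\<close>
  have fat: "integrable M (\<lambda>x. norm (f n x - g x) powr r x) \<and> (LINT x|M. norm (f n x - g x) powr r x) \<le> e"
    if "\<And>m. m \<ge> N \<Longrightarrow> (LINT x|M. norm (f n x - f m x) powr r x) \<le> e" for n e N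
  proof -
    have "\<forall>\<^sub>F i in sequentially. (LINT x|M. norm (f n x - f (k i) x) powr r x) \<le> e"
      unfolding eventually_sequentially using that seq_suble[OF k(1)] by (meson order_trans)
    then show ?thesis
      using integrable_fatou[of M "\<lambda>i x. norm (f n x - f (k i) x) powr r x", OF int _ lim2] by simp
  qed
  have conv: "\<exists>N. \<forall>n\<ge>N. integrable M (\<lambda>x. norm (f n x - g x) powr r x) \<and> (LINT x|M. norm (f n x - g x) powr r x) \<le> e"
    if "0 < e" for e using C[OF that] fat by meson
  have intg: "integrable M (\<lambda>x. norm (f n x - g x) powr r x)" for n
  proof -
    obtain N where N: "integrable M (\<lambda>x. norm (f N x - g x) powr r x)" using conv[of 1] by auto
    show ?thesis
    proof (rule Bochner_Integration.integrable_bound)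
      show "integrable M (\<lambda>x. 2 powr R * (norm (f n x - f N x) powr r x + norm (f N x - g x) powr r x))"
        using N int by auto
      show "AE x in M. norm (norm (f n x - g x) powr r x) \<le> norm (2 powr R * (norm (f n x - f N x) powr r x + norm (f N x - g x) powr r x))"
        using r1
      proof eventually_elim
        case (elim x)
        then show ?case using norm_add_powr_le[of "r x" R "f n x - f N x" "f N x - g x"] by simp
      qed
    qed measurable
  qed
  have "(\<lambda>n. LINT x|M. norm (f n x - g x) powr r x) \<longlonglongrightarrow> 0"
  proof (rule LIMSEQ_I)
    fix e :: real assume "0 < e"
    then obtain N where "\<forall>n\<ge>N. (LINT x|M. norm (f n x - g x) powr r x) \<le> e / 2" using conv[of "e/2"] by auto
    then show "\<exists>no. \<forall>n\<ge>no. norm ((LINT x|M. norm (f n x - g x) powr r x) - 0) < e"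
      using \<open>0 < e\<close> by (intro exI[of _ N]) (fastforce simp: abs_of_nonneg)
  qed
  with gm k(1) lim intg show ?thesis by blast
qed

section \<open>Smooth functions and test functions\<close>

text \<open>The product rule leaves one factor undifferentiated, so the induction for products needs
  each factor also with one derivative less.\<close>

lemma Ck_SucD: "Ck (Suc k) UNIV f \<Longrightarrow> Ck k UNIV f"
proof (induction k arbitrary: f)
  case 0
  then show ?case
    by (auto intro!: continuous_at_imp_continuous_on differentiable_imp_continuous_within)
next
  case (Suc k)
  then show ?case by (metis Ck.simps(2))
qed

lemma Ck_const: "Ck k UNIV (\<lambda>x. c)"
  by (induction k arbitrary: c) auto

lemma Ck_add: "Ck k UNIV f \<Longrightarrow> Ck k UNIV g \<Longrightarrow> Ck k UNIV (\<lambda>x. f x + g x)"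
proof (induction k arbitrary: f g)
  case (Suc k)
  then have "frechet_derivative (\<lambda>x. f x + g x) (at x) =
      (\<lambda>h. frechet_derivative f (at x) h + frechet_derivative g (at x) h)" for x
    by (intro frechet_derivative_at[symmetric] derivative_intros)
      (auto simp: frechet_derivative_works)
  with Suc show ?case by auto
qed (auto intro: continuous_intros)

lemma Ck_mult: "Ck k UNIV f \<Longrightarrow> Ck k UNIV g \<Longrightarrow> Ck k UNIV (\<lambda>x. f x * g x)"
proof (induction k arbitrary: f g)
  case (Suc k)
  have "frechet_derivative (\<lambda>x. f x * g x) (at x) =
      (\<lambda>h. f x * frechet_derivative g (at x) h + frechet_derivative f (at x) h * g x)" for x
    using Suc.prems by (intro frechet_derivative_at[symmetric] derivative_intros)
      (auto simp: frechet_derivative_works)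
  moreover have "Ck k UNIV f" "Ck k UNIV g" using Suc.prems by (blast intro: Ck_SucD)+
  ultimately show ?case using Suc by (auto intro!: Ck_add)
qed (auto intro: continuous_intros)

lemma Ck_prod: "finite I \<Longrightarrow> (\<And>i. i \<in> I \<Longrightarrow> Ck k UNIV (f i)) \<Longrightarrow> Ck k UNIV (\<lambda>x. \<Prod>i\<in>I. f i x)"
  by (induction I rule: finite_induct) (auto intro: Ck_const Ck_mult)

text \<open>The family is closed under differentiation up to linear combinations.\<close>

definition flat_exp :: "nat \<Rightarrow> real \<Rightarrow> real" where
  "flat_exp j t = (if 0 < t then exp (- (1 / t)) / t ^ j else 0)"

text \<open>The term of degree \<open>j + 2\<close> in the series of \<open>exp (1 / t)\<close>
  already gives this. Quadratic decay is what makes the difference quotient at 0 vanish.\<close>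

lemma flat_exp_le_square: "\<bar>flat_exp j t\<bar> \<le> fact (j + 2) * t\<^sup>2"
proof (cases "0 < t")
  case True
  define m where "m = j + 2"
  have "(1 / t) ^ m /\<^sub>R fact m \<le> exp (1 / t)"
    unfolding exp_def using summable_exp_generic[of "1 / t"] True
      sum_le_suminf[of "\<lambda>n. (1 / t) ^ n /\<^sub>R fact n" "{m}"] by simp
  then have "1 \<le> fact m * t ^ m * exp (1 / t)"
    using True by (simp add: field_simps)
  then have "exp (- (1 / t)) \<le> fact m * t ^ m"
    by (simp add: exp_minus field_simps)
  then have "exp (- (1 / t)) / t ^ j \<le> fact m * t ^ m / t ^ j"
    using True by (intro divide_right_mono) auto
  also have "\<dots> = fact (j + 2) * t\<^sup>2" using True by (simp add: m_def power_add power2_eq_square)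
  finally show ?thesis using True by (simp add: flat_exp_def)
qed (simp add: flat_exp_def)

lemma flat_exp_deriv:
  "(flat_exp j has_real_derivative flat_exp (j + 2) t - real j * flat_exp (Suc j) t) (at t)"
proof (cases t "0::real" rule: linorder_cases)
  case less
  have "((\<lambda>_. 0) has_real_derivative 0) (at t)" by simp
  then have "(flat_exp j has_real_derivative 0) (at t)"
    by (rule has_field_derivative_transform_within_open[of _ _ _ "{..<0}"])
      (use less in \<open>auto simp: flat_exp_def\<close>)
  then show ?thesis using less by (simp add: flat_exp_def)
next
  case greater
  have "((\<lambda>t. exp (- (1 / t)) / t ^ j) has_real_derivative flat_exp (j + 2) t - real j * flat_exp (Suc j) t) (at t)"
  proof -
    have "((\<lambda>t. exp (- (1 / t))) has_real_derivative exp (- (1 / t)) / t\<^sup>2) (at t)"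
      using greater by (auto intro!: derivative_eq_intros simp: field_simps power2_eq_square)
    from DERIV_divide[OF this DERIV_pow[of j t]] greater
    have "((\<lambda>t. exp (- (1 / t)) / t ^ j) has_real_derivative
        (exp (- (1 / t)) / t\<^sup>2 * t ^ j - exp (- (1 / t)) * (real j * t ^ (j - Suc 0))) / (t ^ j * t ^ j)) (at t)"
      by simp
    moreover have "(exp (- (1 / t)) / t\<^sup>2 * t ^ j - exp (- (1 / t)) * (real j * t ^ (j - Suc 0))) / (t ^ j * t ^ j)
        = flat_exp (j + 2) t - real j * flat_exp (Suc j) t"
      using greater by (cases j) (simp_all add: flat_exp_def field_simps power2_eq_square)
    ultimately show ?thesis by simp
  qed
  then show ?thesis
    by (rule has_field_derivative_transform_within_open[of _ _ _ "{0<..}"])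
      (use greater in \<open>auto simp: flat_exp_def\<close>)
next
  case equal
  have "((\<lambda>h. flat_exp j h / h) \<longlongrightarrow> 0) (at 0)"
  proof (rule Lim_null_comparison)
    show "\<forall>\<^sub>F h in at 0. norm (flat_exp j h / h) \<le> fact (j + 2) * \<bar>h\<bar>"
    proof (intro always_eventually allI)
      fix h show "norm (flat_exp j h / h) \<le> fact (j + 2) * \<bar>h\<bar>"
        using flat_exp_le_square[of j h]
        by (cases "h = 0") (auto simp: abs_divide divide_le_eq power2_eq_square abs_mult[symmetric] mult.assoc)
    qed
    show "((\<lambda>h. fact (j + 2) * \<bar>h\<bar>) \<longlongrightarrow> 0) (at (0::real))"
      by (intro tendsto_eq_intros) auto
  qed
  then show ?thesis using equal by (simp add: has_field_derivative_iff flat_exp_def)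
qed

lemma Ck_flat_exp: "Ck k UNIV (\<lambda>x. flat_exp j (x \<bullet> e + d))"
proof (induction k arbitrary: j)
  case 0
  have "continuous_on UNIV (flat_exp j)"
    using flat_exp_deriv by (intro continuous_at_imp_continuous_on) (blast intro: DERIV_isCont)
  from continuous_on_compose2[OF this, of UNIV "\<lambda>x. x \<bullet> e + d"] show ?case
    by (simp add: continuous_on_add continuous_on_inner)
next
  case (Suc k)
  have der: "((\<lambda>x. flat_exp j (x \<bullet> e + d)) has_derivative
     (\<lambda>h. (h \<bullet> e) * (flat_exp (j + 2) (x \<bullet> e + d) + - real j * flat_exp (Suc j) (x \<bullet> e + d)))) (at x)" for x
  proof -
    have "((\<lambda>x. x \<bullet> e + d) has_derivative (\<lambda>h. h \<bullet> e)) (at x)"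
      by (auto intro!: derivative_eq_intros)
    from has_derivative_compose[OF this flat_exp_deriv[unfolded has_field_derivative_def]]
    show ?thesis by (simp add: mult.commute)
  qed
  then have "frechet_derivative (\<lambda>x. flat_exp j (x \<bullet> e + d)) (at x) =
     (\<lambda>h. (h \<bullet> e) * (flat_exp (j + 2) (x \<bullet> e + d) + - real j * flat_exp (Suc j) (x \<bullet> e + d)))" for x
    by (intro frechet_derivative_at[symmetric])
  with der Suc show ?case unfolding Ck.simps
    by (auto intro!: Ck_mult Ck_add Ck_const simp only: differentiable_def)
qed

section \<open>Bump functions on boxes\<close>

text \<open>The factor \<open>Suc n\<close> steepens the flanks: each factor tends to 1 inside the
  box, so the bumps tend to the indicator of the open box while their support stays fixed.\<close>

definition box_bump :: "nat \<Rightarrow> 'a::euclidean_space \<Rightarrow> 'a \<Rightarrow> 'a \<Rightarrow> real" where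
  "box_bump n a c x = (\<Prod>e\<in>Basis. flat_exp 0 (real (Suc n) * (x \<bullet> e - a \<bullet> e)) * flat_exp 0 (real (Suc n) * (c \<bullet> e - x \<bullet> e)))"

lemma smooth_box_bump: "smooth_fun (box_bump n a c)"
proof -
  have "Ck k UNIV (\<lambda>x. flat_exp 0 (real (Suc n) * (x \<bullet> e - a \<bullet> e)) * flat_exp 0 (real (Suc n) * (c \<bullet> e - x \<bullet> e)))"
    for k and e :: 'a
    using Ck_mult[OF Ck_flat_exp[of k 0 "real (Suc n) *\<^sub>R e" "- (real (Suc n) * (a \<bullet> e))"]
        Ck_flat_exp[of k 0 "- (real (Suc n) *\<^sub>R e)" "real (Suc n) * (c \<bullet> e)"]]
    by (simp add: algebra_simps)
  then show ?thesis unfolding smooth_fun_def box_bump_def[abs_def] by (intro allI Ck_prod) auto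
qed

lemma flat_exp_0: "0 \<le> flat_exp 0 t" "flat_exp 0 t \<le> 1" "0 < flat_exp 0 t \<longleftrightarrow> 0 < t"
  by (auto simp: flat_exp_def)

lemma box_bump_bounds: "0 \<le> box_bump n a c x" "box_bump n a c x \<le> 1"
  unfolding box_bump_def by (auto intro!: prod_nonneg prod_le_1 mult_le_one simp: flat_exp_0)

lemma box_bump_pos: "x \<in> box a c \<Longrightarrow> 0 < box_bump n a c x"
  unfolding box_bump_def by (intro prod_pos mult_pos_pos) (auto simp: flat_exp_0 mem_box)

lemma box_bump_zero: "x \<notin> box a c \<Longrightarrow> box_bump n a c x = 0"
proof -
  assume "x \<notin> box a c"
  then obtain e where "e \<in> Basis" "x \<bullet> e \<le> a \<bullet> e \<or> c \<bullet> e \<le> x \<bullet> e" by (auto simp: mem_box not_less)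
  then have "flat_exp 0 (real (Suc n) * (x \<bullet> e - a \<bullet> e)) * flat_exp 0 (real (Suc n) * (c \<bullet> e - x \<bullet> e)) = 0"
    by (auto simp: flat_exp_def zero_less_mult_iff)
  with \<open>e \<in> Basis\<close> show ?thesis unfolding box_bump_def by (meson finite_Basis prod_zero)
qed

lemma box_bump_lim: "(\<lambda>n. box_bump n a c x) \<longlonglongrightarrow> indicator (box a c) x"
proof (cases "x \<in> box a c")
  case True
  have lim: "(\<lambda>n. flat_exp 0 (real (Suc n) * t)) \<longlonglongrightarrow> 1" if "0 < t" for t
  proof -
    have "(\<lambda>n. exp (- (inverse (real (Suc n)) * (1 / t)))) \<longlonglongrightarrow> exp (- (0 * (1 / t)))"
      by (intro tendsto_intros LIMSEQ_inverse_real_of_nat)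
    moreover have "flat_exp 0 (real (Suc n) * t) = exp (- (inverse (real (Suc n)) * (1 / t)))" for n
      using that by (simp add: flat_exp_def inverse_eq_divide zero_less_mult_iff)
    ultimately show ?thesis by simp
  qed
  have "(\<lambda>n. box_bump n a c x) \<longlonglongrightarrow> (\<Prod>e\<in>(Basis::'a set). 1 * 1)"
    unfolding box_bump_def using True by (intro tendsto_intros lim) (auto simp: mem_box)
  with True show ?thesis by simp
qed (simp add: box_bump_zero)

lemma test_fun_box_bump: "cbox a c \<subseteq> Om \<Longrightarrow> test_fun Om (box_bump n a c)"
proof -
  assume "cbox a c \<subseteq> Om"
  moreover have "closure {x. box_bump n a c x \<noteq> 0} \<subseteq> cbox a c"
    using box_bump_zero[of _ a c n] box_subset_cbox[of a c] by (intro closure_minimal) auto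
  moreover from this have "compact (closure {x. box_bump n a c x \<noteq> 0})"
    by (meson bounded_cbox bounded_subset closed_closure compact_eq_bounded_closed)
  ultimately show ?thesis unfolding test_fun_def using smooth_box_bump by auto
qed

section \<open>Calculus of test functions\<close>

text \<open>A representative given by an explicit formula at every point, in contrast to
  \<open>wgrad\<close>, which is a choice among functions that agree almost everywhere.\<close>

definition grad :: "('a::euclidean_space \<Rightarrow> real) \<Rightarrow> 'a \<Rightarrow> 'a" where
  "grad f x = (\<Sum>i\<in>Basis. frechet_derivative f (at x) i *\<^sub>R i)"

lemma grad_inner_Basis: "i \<in> Basis \<Longrightarrow> grad f x \<bullet> i = frechet_derivative f (at x) i"
  by (simp add: grad_def)

lemma smooth_fun_has_derivative:
  assumes "smooth_fun f" shows "(f has_derivative (\<lambda>h. grad f x \<bullet> h)) (at x)"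
proof -
  from assms have "f differentiable (at x)" unfolding smooth_fun_def by (metis Ck.simps(2) UNIV_I)
  then have d: "(f has_derivative frechet_derivative f (at x)) (at x)" by (simp add: frechet_derivative_works)
  then interpret bounded_linear "frechet_derivative f (at x)" by (rule has_derivative_bounded_linear)
  have "frechet_derivative f (at x) h = grad f x \<bullet> h" for h
  proof -
    have "frechet_derivative f (at x) h = frechet_derivative f (at x) (\<Sum>i\<in>Basis. (h \<bullet> i) *\<^sub>R i)"
      by (simp add: euclidean_representation)
    also have "\<dots> = (\<Sum>i\<in>Basis. (h \<bullet> i) * frechet_derivative f (at x) i)" by (simp add: sum scaleR)
    also have "\<dots> = grad f x \<bullet> h"
      unfolding grad_def inner_sum_left inner_scaleR_left by (intro sum.cong) (simp_all add: inner_commute)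
    finally show ?thesis .
  qed
  then show ?thesis using d by presburger
qed

lemma grad_eqI:
  assumes "(f has_derivative (\<lambda>h. g \<bullet> h)) (at x)" shows "grad f x = g"
  by (rule euclidean_eqI) (simp add: grad_inner_Basis frechet_derivative_at[OF assms, symmetric])

lemma smooth_fun_continuous: "smooth_fun f \<Longrightarrow> continuous_on UNIV f"
  unfolding smooth_fun_def by (metis Ck.simps(1))

lemma smooth_fun_continuous_grad: "smooth_fun f \<Longrightarrow> continuous_on UNIV (grad f)"
proof -
  assume "smooth_fun f"
  then have "Ck (Suc 0) UNIV f" unfolding smooth_fun_def by blast
  then show ?thesis unfolding grad_def[abs_def] by (auto intro!: continuous_intros)
qed

lemma test_fun_zero: "test_fun Om (\<lambda>x. 0)"
  by (auto simp: test_fun_def smooth_fun_def intro: Ck_const)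

lemma test_fun_add: "test_fun Om f \<Longrightarrow> test_fun Om g \<Longrightarrow> test_fun Om (\<lambda>x. f x + g x)"
proof -
  assume a: "test_fun Om f" "test_fun Om g"
  have "closure {x. f x + g x \<noteq> 0} \<subseteq> closure {x. f x \<noteq> 0} \<union> closure {x. g x \<noteq> 0}"
    unfolding closure_Un[symmetric] by (intro closure_mono) auto
  moreover have "compact (closure {x. f x \<noteq> 0} \<union> closure {x. g x \<noteq> 0})"
    using a by (auto simp: test_fun_def)
  moreover from calculation have "compact (closure {x. f x + g x \<noteq> 0})"
    by (meson bounded_subset closed_closure compact_eq_bounded_closed)
  moreover have "smooth_fun (\<lambda>x. f x + g x)"
    using a by (simp add: smooth_fun_def test_fun_def Ck_add)
  ultimately show ?thesis using a unfolding test_fun_def by blast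
qed

lemma test_fun_mult: "smooth_fun f \<Longrightarrow> test_fun Om g \<Longrightarrow> test_fun Om (\<lambda>x. f x * g x)"
proof -
  assume a: "smooth_fun f" "test_fun Om g"
  have sub: "closure {x. f x * g x \<noteq> 0} \<subseteq> closure {x. g x \<noteq> 0}" by (intro closure_mono) auto
  moreover from this have "compact (closure {x. f x * g x \<noteq> 0})"
    using a(2) unfolding test_fun_def by (meson bounded_subset closed_closure compact_eq_bounded_closed)
  moreover have "smooth_fun (\<lambda>x. f x * g x)"
    using a by (simp add: smooth_fun_def test_fun_def Ck_mult)
  ultimately show ?thesis using a unfolding test_fun_def by blast
qed

lemma test_fun_scale: "test_fun Om f \<Longrightarrow> test_fun Om (\<lambda>x. c * f x)"
  by (rule test_fun_mult) (auto simp: smooth_fun_def intro: Ck_const)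

lemma test_fun_smooth: "test_fun Om f \<Longrightarrow> smooth_fun f"
  by (simp add: test_fun_def)

lemma grad_add: "smooth_fun f \<Longrightarrow> smooth_fun g \<Longrightarrow> grad (\<lambda>x. f x + g x) x = grad f x + grad g x"
  by (rule grad_eqI) (auto intro!: derivative_eq_intros smooth_fun_has_derivative simp: inner_add_left)

lemma grad_scale: "smooth_fun f \<Longrightarrow> grad (\<lambda>x. c * f x) x = c *\<^sub>R grad f x"
  by (rule grad_eqI) (auto intro!: derivative_eq_intros smooth_fun_has_derivative)

lemma grad_mult: "smooth_fun f \<Longrightarrow> smooth_fun g \<Longrightarrow> grad (\<lambda>x. f x * g x) x = f x *\<^sub>R grad g x + g x *\<^sub>R grad f x"
  by (rule grad_eqI) (auto intro!: derivative_eq_intros smooth_fun_has_derivative simp: inner_add_left algebra_simps)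

lemma test_fun_support:
  assumes "test_fun Om f"
  obtains K where "compact K" "K \<subseteq> Om" "\<And>x. x \<notin> K \<Longrightarrow> f x = 0" "\<And>x. x \<notin> K \<Longrightarrow> grad f x = 0"
proof
  let ?K = "closure {x. f x \<noteq> 0}"
  show "compact ?K" "?K \<subseteq> Om" using assms by (auto simp: test_fun_def)
  show z: "f x = 0" if "x \<notin> ?K" for x using that closure_subset[of "{x. f x \<noteq> 0}"] by auto
  show "grad f x = 0" if "x \<notin> ?K" for x
  proof (rule grad_eqI)
    have "((\<lambda>x. 0) has_derivative (\<lambda>h. 0 \<bullet> h)) (at x)" by simp
    then show "(f has_derivative (\<lambda>h. 0 \<bullet> h)) (at x)"
    proof (rule has_derivative_transform_within_open)
      show "open (- ?K)" "x \<in> - ?K" using that by auto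
      show "0 = f y" if "y \<in> - ?K" for y using z[of y] that by simp
    qed
  qed
qed

lemma test_fun_outside: "test_fun Om f \<Longrightarrow> x \<notin> Om \<Longrightarrow> f x = 0" "test_fun Om f \<Longrightarrow> x \<notin> Om \<Longrightarrow> grad f x = 0"
  by (metis subsetD test_fun_support)+

lemma test_fun_bounded:
  assumes "test_fun Om f"
  obtains B where "0 < B" "\<And>x. \<bar>f x\<bar> \<le> B" "\<And>x. norm (grad f x) \<le> B"
proof -
  obtain K where K: "compact K" "\<And>x. x \<notin> K \<Longrightarrow> f x = 0" "\<And>x. x \<notin> K \<Longrightarrow> grad f x = 0"
    using test_fun_support[OF assms] by metis
  note s = test_fun_smooth[OF assms]
  have "compact (f ` K)" "compact (grad f ` K)"
    using K(1) smooth_fun_continuous[OF s] smooth_fun_continuous_grad[OF s]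
    by (meson compact_continuous_image continuous_on_subset subset_UNIV)+
  then obtain B1 B2 where B: "0 < B1" "0 < B2" "\<forall>y\<in>f ` K. norm y \<le> B1" "\<forall>y\<in>grad f ` K. norm y \<le> B2"
    by (meson bounded_pos compact_imp_bounded)
  show thesis
  proof (rule that[of "max B1 B2"])
    show "\<bar>f x\<bar> \<le> max B1 B2" for x using B K(2)[of x] by (cases "x \<in> K") fastforce+
    show "norm (grad f x) \<le> max B1 B2" for x using B K(3)[of x] by (cases "x \<in> K") fastforce+
  qed (use B in simp)
qed

lemma test_fun_borel:
  assumes "test_fun Om f"
  shows "f \<in> borel_measurable borel" "grad f \<in> borel_measurable borel"
  using smooth_fun_continuous[OF test_fun_smooth[OF assms]] smooth_fun_continuous_grad[OF test_fun_smooth[OF assms]]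
  by (auto intro: borel_measurable_continuous_onI)

section \<open>Integrals over the domain and translations\<close>

lemma borel_measurable_lebesgue_on_borel: "f \<in> borel_measurable borel \<Longrightarrow> f \<in> borel_measurable (lebesgue_on S)"
  by (intro measurable_restrict_space1 measurable_completion) simp

text \<open>Fubini's theorem and translation invariance are used over \<open>lborel\<close>;
  functions that vanish outside the domain can be moved there.\<close>

lemma nn_integral_lebesgue_on_eq_lborel:
  assumes "open Om" "F \<in> borel_measurable borel" "\<And>x. x \<notin> Om \<Longrightarrow> F x = 0"
  shows "(\<integral>\<^sup>+ x. F x \<partial>lebesgue_on Om) = (\<integral>\<^sup>+ x. F x \<partial>lborel)"
proof -
  have "(\<integral>\<^sup>+ x. F x \<partial>lebesgue_on Om) = (\<integral>\<^sup>+ x. F x * indicator Om x \<partial>lborel)"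
    using assms by (subst nn_integral_restrict_space) (auto simp: nn_integral_completion)
  also have "\<dots> = (\<integral>\<^sup>+ x. F x \<partial>lborel)"
    using assms(3) by (intro nn_integral_cong) (auto simp: indicator_def)
  finally show ?thesis .
qed

lemma integral_lebesgue_on_eq_lborel:
  fixes F :: "'a::euclidean_space \<Rightarrow> real"
  assumes "open Om" "F \<in> borel_measurable borel" "\<And>x. x \<notin> Om \<Longrightarrow> F x = 0"
  shows "(LINT x|lebesgue_on Om. F x) = (LINT x|lborel. F x)"
proof -
  have eq: "(\<lambda>x. indicator Om x *\<^sub>R F x) = F" using assms(3) by (auto simp: indicator_def fun_eq_iff)
  have "(LINT x|lebesgue_on Om. F x) = (LINT x|lebesgue. indicator Om x *\<^sub>R F x)"
    using assms by (subst integral_restrict_space) auto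
  then show ?thesis unfolding eq using assms by (simp add: integral_completion)
qed

lemma integrable_lebesgue_on_bounded:
  fixes F :: "'a::euclidean_space \<Rightarrow> 'b::euclidean_space"
  assumes "F \<in> borel_measurable (lebesgue_on S)" "\<And>x. norm (F x) \<le> B" "S \<in> lmeasurable"
  shows "integrable (lebesgue_on S) F"
proof -
  interpret finite_measure "lebesgue_on S" using assms by (intro finite_measure_lebesgue_on)
  show ?thesis using assms by (intro integrable_const_bound[where B=B]) auto
qed

lemma nn_integral_lborel_translate:
  assumes [measurable]: "F \<in> borel_measurable borel"
  shows "(\<integral>\<^sup>+ x. F (x + v) \<partial>lborel) = (\<integral>\<^sup>+ x. F x \<partial>(lborel :: 'a::euclidean_space measure))"
proof -
  have "(\<integral>\<^sup>+ x. F x \<partial>(lborel :: 'a measure)) = (\<integral>\<^sup>+ x. F x \<partial>(distr lborel borel ((+) v)))"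
    by (simp add: lborel_distr_plus)
  also have "\<dots> = (\<integral>\<^sup>+ x. F (x + v) \<partial>lborel)" by (subst nn_integral_distr) (auto simp: add.commute)
  finally show ?thesis ..
qed

lemma integral_lborel_translate:
  fixes F :: "'a::euclidean_space \<Rightarrow> real"
  assumes [measurable]: "F \<in> borel_measurable borel"
  shows "(LINT x|lborel. F (x + v)) = (LINT x|lborel. F x)"
proof -
  have "(LINT x|lborel. F x) = (LINT x|distr lborel borel ((+) v). F x)"
    by (simp add: lborel_distr_plus)
  also have "\<dots> = (LINT x|lborel. F (x + v))" by (subst integral_distr) (auto simp: add.commute)
  finally show ?thesis ..
qed

lemma test_fun_ftc:
  assumes f: "smooth_fun f" and T: "0 \<le> T"
  shows "ennreal \<bar>f (x + T *\<^sub>R z) - f x\<bar> \<le>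
    (\<integral>\<^sup>+ t. ennreal (norm (grad f (x + t *\<^sub>R z)) * norm z) * indicator {0..T} t \<partial>lborel)"
proof -
  define D where "D t = grad f (x + t *\<^sub>R z) \<bullet> z" for t
  have contg: "continuous_on UNIV (\<lambda>t. grad f (x + t *\<^sub>R z))"
    by (rule continuous_on_compose2[OF smooth_fun_continuous_grad[OF f]]) (intro continuous_intros, simp)
  then have cont: "continuous_on {0..T} D" unfolding D_def
    by (intro continuous_intros) (auto intro: continuous_on_subset)
  have der: "((\<lambda>t. f (x + t *\<^sub>R z)) has_vector_derivative D t) (at t within {0..T})" for t
  proof -
    have "((\<lambda>t. x + t *\<^sub>R z) has_derivative (\<lambda>h. h *\<^sub>R z)) (at t within {0..T})"
      by (auto intro!: derivative_eq_intros)
    from has_derivative_compose[OF this smooth_fun_has_derivative[OF f]]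
    show ?thesis by (simp add: has_vector_derivative_def D_def)
  qed
  have "(LINT t|lborel. indicator {0..T} t *\<^sub>R D t) = f (x + T *\<^sub>R z) - f (x + 0 *\<^sub>R z)"
    using integral_FTC_atLeastAtMost[OF T der cont] by simp
  moreover have int: "integrable lborel (\<lambda>t. indicator {0..T} t *\<^sub>R D t)"
    using borel_integrable_compact[OF compact_Icc cont] by simp
  ultimately have "ennreal \<bar>f (x + T *\<^sub>R z) - f x\<bar> = ennreal (norm (LINT t|lborel. indicator {0..T} t *\<^sub>R D t))" by simp
  also have "\<dots> \<le> (\<integral>\<^sup>+ t. ennreal (norm (indicator {0..T} t *\<^sub>R D t)) \<partial>lborel)"
    by (rule integral_norm_bound_ennreal[OF int])
  also have "\<dots> \<le> (\<integral>\<^sup>+ t. ennreal (norm (grad f (x + t *\<^sub>R z)) * norm z) * indicator {0..T} t \<partial>lborel)"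
    by (intro nn_integral_mono) (auto simp: indicator_def D_def Cauchy_Schwarz_ineq2 intro!: ennreal_leI)
  finally show ?thesis .
qed

text \<open>After the fundamental theorem along the segment and Fubini, translation invariance in
  \<open>x\<close> makes the inner integral independent of the position on the segment.\<close>

lemma nn_integral_shift_le:
  assumes f: "test_fun Om f"
  shows "(\<integral>\<^sup>+ x. ennreal \<bar>f (x + h) - f x\<bar> \<partial>lborel) \<le> ennreal (norm h) * (\<integral>\<^sup>+ x. ennreal (norm (grad f x)) \<partial>lborel)"
proof -
  have [measurable]: "f \<in> borel_measurable borel" "grad f \<in> borel_measurable borel" using test_fun_borel[OF f] by auto
  have "(\<integral>\<^sup>+ x. ennreal \<bar>f (x + h) - f x\<bar> \<partial>lborel) \<le>
    (\<integral>\<^sup>+ x. (\<integral>\<^sup>+ t. ennreal (norm (grad f (x + t *\<^sub>R h)) * norm h) * indicator {0..1} t \<partial>lborel) \<partial>lborel)"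
    using test_fun_ftc[OF test_fun_smooth[OF f], of 1 _ h] by (intro nn_integral_mono) simp
  also have "\<dots> = (\<integral>\<^sup>+ t. (\<integral>\<^sup>+ x. ennreal (norm (grad f (x + t *\<^sub>R h)) * norm h) * indicator {0..1::real} t \<partial>lborel) \<partial>lborel)"
    by (rule lborel_pair.Fubini'[symmetric]) measurable
  also have "\<dots> = (\<integral>\<^sup>+ t. (ennreal (norm h) * (\<integral>\<^sup>+ x. ennreal (norm (grad f x)) \<partial>lborel)) * indicator {0..1::real} t \<partial>lborel)"
  proof (intro nn_integral_cong)
    fix t :: real
    have "(\<integral>\<^sup>+ x. ennreal (norm (grad f (x + t *\<^sub>R h)) * norm h) * indicator {0..1} t \<partial>lborel) =
      (\<integral>\<^sup>+ x. ennreal (norm (grad f (x + t *\<^sub>R h))) * (ennreal (norm h) * indicator {0..1} t) \<partial>lborel)"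
      by (simp add: ennreal_mult mult.assoc)
    also have "\<dots> = (\<integral>\<^sup>+ x. ennreal (norm (grad f (x + t *\<^sub>R h))) \<partial>lborel) * (ennreal (norm h) * indicator {0..1} t)"
      by (rule nn_integral_multc) measurable
    also have "(\<integral>\<^sup>+ x. ennreal (norm (grad f (x + t *\<^sub>R h))) \<partial>lborel) = (\<integral>\<^sup>+ x. ennreal (norm (grad f x)) \<partial>lborel)"
      by (rule nn_integral_lborel_translate) measurable
    finally show "(\<integral>\<^sup>+ x. ennreal (norm (grad f (x + t *\<^sub>R h)) * norm h) * indicator {0..1} t \<partial>lborel) = 
      (ennreal (norm h) * (\<integral>\<^sup>+ x. ennreal (norm (grad f x)) \<partial>lborel)) * indicator {0..1::real} t" by (simp add: mult_ac)
  qed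
  also have "\<dots> = ennreal (norm h) * (\<integral>\<^sup>+ x. ennreal (norm (grad f x)) \<partial>lborel)"
    by (subst nn_integral_cmult_indicator) auto
  finally show ?thesis .
qed

section \<open>Weak gradients\<close>

text \<open>The integral of \<open>f (x + t *\<^sub>R e)\<close> does not depend on
  \<open>t\<close>, so all difference quotients integrate to 0. They are bounded by the Lipschitz
  constant and vanish outside a fixed ball, which permits passing to the derivative.\<close>

lemma integral_grad_zero:
  fixes f :: "'a::euclidean_space \<Rightarrow> real"
  assumes f: "test_fun Om f"
  shows "(LINT x|lborel. grad f x \<bullet> e) = 0"
proof -
  have [measurable]: "f \<in> borel_measurable borel" "grad f \<in> borel_measurable borel" using test_fun_borel[OF f] by auto
  obtain K where K: "compact K" "\<And>x. x \<notin> K \<Longrightarrow> f x = 0" "\<And>x. x \<notin> K \<Longrightarrow> grad f x = 0"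
    using test_fun_support[OF f] by metis
  obtain B where B: "0 < B" "\<And>x. norm (grad f x) \<le> B" using test_fun_bounded[OF f] by metis
  obtain R where R: "0 < R" "\<And>x. x \<in> K \<Longrightarrow> norm x \<le> R" using K(1) by (meson bounded_pos compact_imp_bounded)
  define t where "t n = inverse (real (Suc n))" for n
  have t: "0 < t n" "t n \<le> 1" for n by (auto simp: t_def inverse_le_1_iff)
  have tl: "t \<longlonglongrightarrow> 0" unfolding t_def by (rule LIMSEQ_inverse_real_of_nat)
  define q where "q n x = (f (x + t n *\<^sub>R e) - f x) / t n" for n x
  have [measurable]: "q n \<in> borel_measurable lborel" for n unfolding q_def by measurable
  have lip: "\<bar>f (x + h) - f x\<bar> \<le> B * norm h" for x h
  proof -
    have "onorm (\<lambda>h. grad f y \<bullet> h) \<le> B" for y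
      by (rule onorm_le) (metis B(2) Cauchy_Schwarz_ineq2 mult_right_mono norm_ge_zero order_trans real_norm_def)
    then show ?thesis
      using differentiable_bound[of UNIV f "\<lambda>x h. grad f x \<bullet> h" B "x + h" x]
        smooth_fun_has_derivative[OF test_fun_smooth[OF f]] by simp
  qed
  have qb: "norm (q n x) \<le> B * norm e * indicator (cball 0 (R + norm e)) x" for n x
  proof (cases "x \<in> cball 0 (R + norm e)")
    case True
    have "\<bar>f (x + t n *\<^sub>R e) - f x\<bar> \<le> B * (t n * norm e)" using lip[of x "t n *\<^sub>R e"] t[of n] by simp
    with True show ?thesis using t[of n] by (simp add: q_def field_simps)
  next
    case False
    have "t n * norm e \<le> norm e" using t[of n] by (simp add: mult_left_le_one_le)
    then have "norm x \<le> norm (x + t n *\<^sub>R e) + norm e"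
      using norm_triangle_ineq4[of "x + t n *\<^sub>R e" "t n *\<^sub>R e"] t[of n] by simp
    with False have "x \<notin> K" "x + t n *\<^sub>R e \<notin> K" using R(2)[of x] R(2)[of "x + t n *\<^sub>R e"]
      by (auto simp: not_le) (use norm_ge_zero[of e] in linarith)
    then show ?thesis using K(2) False by (simp add: q_def)
  qed
  have intq: "(LINT x|lborel. q n x) = 0" for n
  proof -
    have i: "integrable lborel f"
    proof -
      obtain B' where B': "\<And>x. \<bar>f x\<bar> \<le> B'" using test_fun_bounded[OF f] by metis
      show ?thesis
      proof (rule Bochner_Integration.integrable_bound)
      show "integrable lborel (\<lambda>x. B' * indicator (cball (0::'a) R) x)"
        using emeasure_bounded_finite[OF bounded_cball, of "0::'a" R]
        by (intro integrable_mult_right integrable_real_indicator) auto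
      show "AE x in lborel. norm (f x) \<le> norm (B' * indicator (cball 0 R) x)"
      proof (intro AE_I2)
        fix x show "norm (f x) \<le> norm (B' * indicator (cball 0 R) x)"
          using B'[of x] K(2)[of x] R(2)[of x] by (cases "x \<in> K") auto
      qed
      qed measurable
    qed
    have i2: "integrable lborel (\<lambda>x. f (x + v))" for v
    proof -
      have "(\<integral>\<^sup>+ x. ennreal (norm (f (x + v))) \<partial>lborel) = (\<integral>\<^sup>+ x. ennreal (norm (f x)) \<partial>lborel)"
        by (rule nn_integral_lborel_translate) measurable
      then show ?thesis using i unfolding integrable_iff_bounded by simp
    qed
    have "(LINT x|lborel. q n x) = ((LINT x|lborel. f (x + t n *\<^sub>R e)) - (LINT x|lborel. f x)) / t n"
      unfolding q_def using i i2 by simp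
    also have "(LINT x|lborel. f (x + t n *\<^sub>R e)) = (LINT x|lborel. f x)"
      by (rule integral_lborel_translate) measurable
    finally show ?thesis by simp
  qed
  have "(\<lambda>n. LINT x|lborel. q n x) \<longlonglongrightarrow> (LINT x|lborel. grad f x \<bullet> e)"
  proof (rule integral_dominated_convergence)
    show "integrable lborel (\<lambda>x. B * norm e * indicator (cball (0::'a) (R + norm e)) x)"
      using emeasure_bounded_finite[OF bounded_cball, of "0::'a" "R + norm e"]
      by (intro integrable_mult_right integrable_real_indicator) auto
    show "AE x in lborel. (\<lambda>n. q n x) \<longlonglongrightarrow> grad f x \<bullet> e"
    proof (intro AE_I2)
      fix x
      have "((\<lambda>s. x + s *\<^sub>R e) has_derivative (\<lambda>h. h *\<^sub>R e)) (at (0::real))"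
        by (auto intro!: derivative_eq_intros)
      from has_derivative_compose[OF this smooth_fun_has_derivative[OF test_fun_smooth[OF f]]]
      have "((\<lambda>s. f (x + s *\<^sub>R e)) has_real_derivative (grad f x \<bullet> e)) (at 0)"
        by (simp add: has_field_derivative_def mult_commute_abs)
      then have "((\<lambda>s. (f (x + s *\<^sub>R e) - f x) / s) \<longlongrightarrow> grad f x \<bullet> e) (at 0)"
        by (simp add: has_field_derivative_iff)
      moreover have "filterlim t (at 0) sequentially"
        unfolding filterlim_at using tl t by (auto simp: less_imp_neq[symmetric] intro!: always_eventually)
      ultimately show "(\<lambda>n. q n x) \<longlonglongrightarrow> grad f x \<bullet> e"
        unfolding q_def by (rule filterlim_compose)
    qed
    show "AE x in lborel. norm (q n x) \<le> B * norm e * indicator (cball 0 (R + norm e)) x" for n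
      using qb by simp
  qed measurable
  then show ?thesis unfolding intq by (simp add: LIMSEQ_const_iff)
qed

text \<open>Integration by parts: the product with a second test function is again a test function,
  and its gradient integrates to 0.\<close>

lemma test_fun_weak_gradient:
  fixes f :: "'a::euclidean_space \<Rightarrow> real"
  assumes "open Om" and f: "test_fun Om f"
  shows "is_weak_gradient Om f (grad f)"
  unfolding is_weak_gradient_def
proof (intro conjI allI impI ballI)
  obtain B where B: "\<And>x. \<bar>f x\<bar> \<le> B" "\<And>x. norm (grad f x) \<le> B" using test_fun_bounded[OF f] by metis
  show "locally_integrable Om f" "locally_integrable Om (grad f)" unfolding locally_integrable_def
    using B test_fun_borel[OF f] by (auto intro!: integrable_lebesgue_on_bounded[of _ _ B]
      borel_measurable_lebesgue_on_borel lmeasurable_compact)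
next
  fix \<phi> :: "'a \<Rightarrow> real" and i :: 'a assume \<phi>: "test_fun Om \<phi>" and i: "i \<in> Basis"
  note [measurable] = test_fun_borel[OF f] test_fun_borel[OF \<phi>]
  have int: "integrable lborel F" if F: "F \<in> borel_measurable borel" "\<And>x. norm (F x) \<le> B" "compact K" "\<And>x. x \<notin> K \<Longrightarrow> F x = 0" for F :: "'a \<Rightarrow> real" and B K
  proof (rule Bochner_Integration.integrable_bound)
    show "integrable lborel (\<lambda>x. B * indicator K x)"
      using emeasure_bounded_finite[OF compact_imp_bounded[OF F(3)]] borel_compact[OF F(3)]
      by (intro integrable_mult_right integrable_real_indicator) auto
    show "AE x in lborel. norm (F x) \<le> norm (B * indicator K x)"
    proof (intro AE_I2)
      fix x show "norm (F x) \<le> norm (B * indicator K x)"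
        using F(2)[of x] F(4)[of x] by (cases "x \<in> K") auto
    qed
  qed (use F in simp)
  obtain B where B: "0 < B" "\<And>x. \<bar>f x\<bar> \<le> B" "\<And>x. norm (grad f x) \<le> B" using test_fun_bounded[OF f] by metis
  obtain C where C: "0 < C" "\<And>x. \<bar>\<phi> x\<bar> \<le> C" "\<And>x. norm (grad \<phi> x) \<le> C" using test_fun_bounded[OF \<phi>] by metis
  obtain K where K: "compact K" "K \<subseteq> Om" "\<And>x. x \<notin> K \<Longrightarrow> \<phi> x = 0" "\<And>x. x \<notin> K \<Longrightarrow> grad \<phi> x = 0"
    using test_fun_support[OF \<phi>] by metis
  have Bi: "\<bar>grad f x \<bullet> i\<bar> \<le> B" "\<bar>grad \<phi> x \<bullet> i\<bar> \<le> C" for x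
    using order_trans[OF Basis_le_norm[OF i] B(3)] order_trans[OF Basis_le_norm[OF i] C(3)] by auto
  have i1: "integrable lborel (\<lambda>x. f x * (grad \<phi> x \<bullet> i))"
  proof (rule int[of _ "B * C" K])
    show "norm (f x * (grad \<phi> x \<bullet> i)) \<le> B * C" for x
      unfolding norm_mult real_norm_def abs_mult using B(1) C(1) by (intro mult_mono Bi B(2) C(2)) auto
  qed (use K in \<open>simp_all, measurable\<close>)
  have i2: "integrable lborel (\<lambda>x. (grad f x \<bullet> i) * \<phi> x)"
  proof (rule int[of _ "B * C" K])
    show "norm ((grad f x \<bullet> i) * \<phi> x) \<le> B * C" for x
      unfolding norm_mult real_norm_def abs_mult using B(1) C(1) by (intro mult_mono Bi B(2) C(2)) auto
  qed (use K in \<open>simp_all, measurable\<close>)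
  have "0 = (LINT x|lborel. grad (\<lambda>x. f x * \<phi> x) x \<bullet> i)"
    using integral_grad_zero[OF test_fun_mult[OF test_fun_smooth[OF f] \<phi>]] by simp
  also have "\<dots> = (LINT x|lborel. f x * (grad \<phi> x \<bullet> i) + (grad f x \<bullet> i) * \<phi> x)"
    using grad_mult[OF test_fun_smooth[OF f] test_fun_smooth[OF \<phi>]] by (simp add: inner_add_left mult.commute)
  also have "\<dots> = (LINT x|lborel. f x * (grad \<phi> x \<bullet> i)) + (LINT x|lborel. (grad f x \<bullet> i) * \<phi> x)"
    using i1 i2 by simp
  also have "(LINT x|lborel. f x * (grad \<phi> x \<bullet> i)) = (LINT x|lebesgue_on Om. f x * (grad \<phi> x \<bullet> i))"
    using assms(1) test_fun_outside[OF f] by (subst integral_lebesgue_on_eq_lborel) auto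
  also have "(LINT x|lborel. (grad f x \<bullet> i) * \<phi> x) = (LINT x|lebesgue_on Om. (grad f x \<bullet> i) * \<phi> x)"
    using assms(1) test_fun_outside[OF f] by (subst integral_lebesgue_on_eq_lborel) auto
  finally show "(LINT x|lebesgue_on Om. f x * frechet_derivative \<phi> (at x) i) = - (LINT x|lebesgue_on Om. grad f x \<bullet> i * \<phi> x)"
    by (simp add: grad_inner_Basis[OF i])
qed

section \<open>Fundamental lemma and uniqueness of weak gradients\<close>

text \<open>Lebesgue differentiation along shrinking cubes: at almost every point the value is a
  limit of averages, and these are all 0. Countably many closed boxes cover the open set.\<close>

lemma AE_zero_of_box_integrals:
  fixes h :: "'a::euclidean_space \<Rightarrow> real"
  assumes "open Om" and h: "locally_integrable Om h"
    and z: "\<And>a c. cbox a c \<subseteq> Om \<Longrightarrow> (LINT x|lebesgue_on (cbox a c). h x) = 0"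
  shows "AE x in lebesgue_on Om. h x = 0"
proof -
  have cell: "AE x in lebesgue. x \<in> cbox a c \<longrightarrow> h x = 0" if ac: "cbox a c \<subseteq> Om" for a c
  proof -
    \<comment> \<open>The differentiation theorem asks for integrability on every box, also on those
      that leave \<open>Om\<close>, hence the cut-off.\<close>
    define F where "F x = (if x \<in> cbox a c then h x else 0)" for x
    have intQ: "(h has_integral (LINT x|lebesgue_on (cbox u v). h x)) (cbox u v)" if "cbox u v \<subseteq> Om" for u v
      using h that by (intro has_integral_integral_lebesgue_on) (auto simp: locally_integrable_def)
    have Fint: "F integrable_on cbox u v" for u v
    proof -
      have "(\<lambda>x. if x \<in> cbox a c then h x else 0) integrable_on UNIV"
        using intQ[OF ac] by (subst integrable_restrict_UNIV) (blast intro: has_integral_integrable)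
      then show ?thesis unfolding F_def by (rule integrable_on_subcbox) simp
    qed
    obtain N where N: "negligible N" "\<And>x e. x \<notin> N \<Longrightarrow> 0 < e \<Longrightarrow>
        \<exists>d>0. \<forall>r. 0 < r \<and> r < d \<longrightarrow> norm (integral (cbox x (x + r *\<^sub>R One)) F /\<^sub>R r ^ DIM('a) - F x) < e"
      using integrable_ccontinuous_explicit[OF Fint] by blast
    have zero: "h x = 0" if x: "x \<in> box a c" "x \<notin> N" for x
    proof (rule ccontr)
      assume "h x \<noteq> 0"
      then obtain d where d: "d > 0" "\<And>r. 0 < r \<Longrightarrow> r < d \<Longrightarrow>
          norm (integral (cbox x (x + r *\<^sub>R One)) F /\<^sub>R r ^ DIM('a) - F x) < \<bar>h x\<bar>"
        using N(2)[OF x(2), of "\<bar>h x\<bar>"] by auto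
      obtain \<rho> where \<rho>: "0 < \<rho>" "ball x \<rho> \<subseteq> box a c" using x(1) open_box openE by blast
      \<comment> \<open>The norm is bounded by the sum of the \<open>DIM('a)\<close> coordinates, so
        a cube of this side stays within distance \<open>\<rho> / 2\<close> of its corner
        \<open>x\<close>.\<close>
      define r where "r = min (d / 2) (\<rho> / (2 * real DIM('a)))"
      have r: "0 < r" "r < d" using d \<rho> by (auto simp: r_def)
      have "cbox x (x + r *\<^sub>R One) \<subseteq> ball x \<rho>"
      proof
        fix y assume y: "y \<in> cbox x (x + r *\<^sub>R One)"
        have "norm (y - x) \<le> (\<Sum>i\<in>Basis. \<bar>(y - x) \<bullet> i\<bar>)" by (rule norm_le_l1)
        also have "\<dots> \<le> (\<Sum>i\<in>(Basis::'a set). r)"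
          using y by (intro sum_mono) (auto simp: mem_box inner_diff_left inner_add_left abs_le_iff)
        also have "\<dots> \<le> \<rho> / 2" using DIM_positive[where 'a='a] by (auto simp: r_def min_def field_simps)
        also have "\<dots> < \<rho>" using \<rho> by simp
        finally show "y \<in> ball x \<rho>" by (simp add: dist_norm norm_minus_commute)
      qed
      then have sub: "cbox x (x + r *\<^sub>R One) \<subseteq> cbox a c" using \<rho>(2) box_subset_cbox by blast
      have "integral (cbox x (x + r *\<^sub>R One)) F = integral (cbox x (x + r *\<^sub>R One)) h"
        using sub by (intro Henstock_Kurzweil_Integration.integral_cong) (auto simp: F_def)
      also have "\<dots> = 0"
        using intQ[of x "x + r *\<^sub>R One"] z[of x "x + r *\<^sub>R One"] sub ac by (metis integral_unique order_trans)
      finally have "\<bar>F x\<bar> < \<bar>h x\<bar>" using d(2)[OF r] by simp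
      then show False using x subsetD[OF box_subset_cbox x(1)] by (simp add: F_def)
    qed
    have "negligible (N \<union> (cbox a c - box a c))"
      using N(1) negligible_frontier_interval by (rule negligible_Un)
    then have "N \<union> (cbox a c - box a c) \<in> null_sets lebesgue" by (simp add: negligible_iff_null_sets)
    then show ?thesis
      by (rule AE_I') (use zero in auto)
  qed
  obtain D where D: "countable D" "\<And>X. X \<in> D \<Longrightarrow> X \<subseteq> Om \<and> (\<exists>a b. X = cbox a b)" "\<Union>D = Om"
    using open_countable_Union_open_cbox[OF \<open>open Om\<close>] by (metis Pow_iff subsetD)
  have "AE x in lebesgue. \<forall>X\<in>D. x \<in> X \<longrightarrow> h x = 0"
    using D(2) cell by (subst AE_ball_countable[OF D(1)]) metis
  then have "AE x in lebesgue. x \<in> Om \<longrightarrow> h x = 0"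
    by eventually_elim (use D(3) in auto)
  then show ?thesis using \<open>open Om\<close> by (subst AE_restrict_space_iff) auto
qed

text \<open>Bumps that converge boundedly to the indicator of a box turn the hypothesis on test
  functions into one on box integrals.\<close>

lemma fundamental_lemma:
  fixes h :: "'a::euclidean_space \<Rightarrow> real"
  assumes "open Om" and h: "locally_integrable Om h"
    and z: "\<And>\<phi>. test_fun Om \<phi> \<Longrightarrow> (LINT x|lebesgue_on Om. h x * \<phi> x) = 0"
  shows "AE x in lebesgue_on Om. h x = 0"
proof (rule AE_zero_of_box_integrals[OF assms(1,2)])
  fix a c :: 'a assume ac: "cbox a c \<subseteq> Om"
  have i: "integrable (lebesgue_on (cbox a c)) h" using h ac by (auto simp: locally_integrable_def)
  then have ind: "integrable lebesgue (\<lambda>x. indicator (cbox a c) x *\<^sub>R h x)"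
    by (subst (asm) integrable_restrict_space) auto
  then have i2: "integrable (lebesgue_on Om) (\<lambda>x. indicator (cbox a c) x *\<^sub>R h x)"
  proof -
    have "(\<lambda>x. indicator Om x *\<^sub>R indicator (cbox a c) x *\<^sub>R h x) = (\<lambda>x. indicator (cbox a c) x *\<^sub>R h x)"
      using ac by (auto simp: indicator_def fun_eq_iff)
    then show ?thesis using ind assms(1) by (subst integrable_restrict_space) auto
  qed
  define H where "H x = indicator (cbox a c) x *\<^sub>R h x" for x
  have iH: "integrable (lebesgue_on Om) H" using i2 by (simp add: H_def[abs_def])
  have [measurable]: "H \<in> borel_measurable (lebesgue_on Om)" using iH by simp
  have [measurable]: "box_bump n a c \<in> borel_measurable (lebesgue_on Om)" for n
    using test_fun_borel[OF test_fun_box_bump[OF ac]] by (intro borel_measurable_lebesgue_on_borel)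
  have eq: "h x * box_bump n a c x = H x * box_bump n a c x" for n x
    using box_bump_zero[of x a c n] box_subset_cbox[of a c] by (auto simp: H_def indicator_def)
  have "(\<lambda>n. LINT x|lebesgue_on Om. H x * box_bump n a c x) \<longlonglongrightarrow> (LINT x|lebesgue_on Om. H x * indicator (box a c) x)"
  proof (rule integral_dominated_convergence)
    show "integrable (lebesgue_on Om) (\<lambda>x. norm (H x))" using iH by simp
    show "AE x in lebesgue_on Om. (\<lambda>n. H x * box_bump n a c x) \<longlonglongrightarrow> H x * indicator (box a c) x"
      by (intro AE_I2 tendsto_intros box_bump_lim)
    show "AE x in lebesgue_on Om. norm (H x * box_bump n a c x) \<le> norm (H x)" for n
      using box_bump_bounds[of n a c] by (intro AE_I2) (auto simp: abs_mult mult_left_le)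
    have "indicator (box a c) \<in> borel_measurable (lebesgue_on Om)"
      by (rule borel_measurable_lebesgue_on_borel) auto
    then show "(\<lambda>x. H x * indicator (box a c) x) \<in> borel_measurable (lebesgue_on Om)" by measurable
  qed measurable
  then have "(LINT x|lebesgue_on Om. H x * indicator (box a c) x) = 0"
    using z[OF test_fun_box_bump[OF ac]] by (simp add: eq LIMSEQ_const_iff)
  moreover have "(LINT x|lebesgue_on Om. H x * indicator (box a c) x) = (LINT x|lebesgue. indicator Om x * (H x * indicator (box a c) x))"
    using assms(1) by (subst integral_restrict_space) auto
  moreover have "\<dots> = (LINT x|lebesgue. indicator (cbox a c) x *\<^sub>R h x)"
  proof (rule integral_cong_AE)
    have "box a c \<in> sets lebesgue" "Om \<in> sets lebesgue" using assms(1) by auto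
    then show "(\<lambda>x. indicator Om x * (H x * indicator (box a c) x)) \<in> borel_measurable lebesgue"
      using ind by (intro borel_measurable_times borel_measurable_indicator) (auto simp: H_def)
    show "(\<lambda>x. indicator (cbox a c) x *\<^sub>R h x) \<in> borel_measurable lebesgue" using ind by auto
    have "cbox a c - box a c \<in> null_sets lebesgue"
      using negligible_frontier_interval by (simp add: negligible_iff_null_sets)
    then show "AE x in lebesgue. indicator Om x * (H x * indicator (box a c) x) = indicator (cbox a c) x *\<^sub>R h x"
      by (rule AE_I') (use ac box_subset_cbox[of a c] in \<open>auto simp: H_def indicator_def\<close>)
  qed
  moreover have "\<dots> = (LINT x|lebesgue_on (cbox a c). h x)"
    by (subst integral_restrict_space) auto
  ultimately show "(LINT x|lebesgue_on (cbox a c). h x) = 0" by simp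
qed

lemma integrable_lebesgue_on_mult_test:
  fixes u :: "'a::euclidean_space \<Rightarrow> real"
  assumes "open Om" and u: "locally_integrable Om u"
    and F: "F \<in> borel_measurable borel" "\<And>x. \<bar>F x\<bar> \<le> B" "compact K" "K \<subseteq> Om" "\<And>x. x \<notin> K \<Longrightarrow> F x = 0"
  shows "integrable (lebesgue_on Om) (\<lambda>x. u x * F x)"
proof -
  have K: "K \<in> sets lebesgue" using F(3) by (simp add: borel_compact)
  have "integrable (lebesgue_on K) u" using u F by (auto simp: locally_integrable_def)
  then have iu: "integrable lebesgue (\<lambda>x. indicator K x *\<^sub>R u x)"
    using K by (subst (asm) integrable_restrict_space) auto
  have Fm: "F \<in> borel_measurable lebesgue" using F(1) by (intro measurable_completion) simp
  define U where "U x = indicator K x *\<^sub>R u x" for x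
  have U: "integrable lebesgue U" using iu by (simp add: U_def[abs_def])
  have "integrable lebesgue (\<lambda>x. indicator Om x *\<^sub>R (U x * F x))"
  proof (rule Bochner_Integration.integrable_bound)
    show "integrable lebesgue (\<lambda>x. B * U x)" using U by (rule integrable_mult_right)
    have [measurable]: "U \<in> borel_measurable lebesgue" "Om \<in> sets lebesgue" using U assms(1) by auto
    note Fm [measurable]
    show "(\<lambda>x. indicator Om x *\<^sub>R (U x * F x)) \<in> borel_measurable lebesgue" by measurable
    show "AE x in lebesgue. norm (indicator Om x *\<^sub>R (U x * F x)) \<le> norm (B * U x)"
    proof (intro AE_I2)
      fix x
      have "\<bar>U x * F x\<bar> \<le> \<bar>U x\<bar> * \<bar>B\<bar>"
        unfolding abs_mult using F(2)[of x] by (intro mult_left_mono) auto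
      then show "norm (indicator Om x *\<^sub>R (U x * F x)) \<le> norm (B * U x)"
        by (auto simp: indicator_def abs_mult mult.commute)
    qed
  qed
  moreover have "U x * F x = u x * F x" for x using F(5) by (auto simp: indicator_def U_def)
  ultimately show ?thesis using assms(1) by (subst integrable_restrict_space) auto
qed

lemma weak_gradient_unique:
  fixes u :: "'a::euclidean_space \<Rightarrow> real"
  assumes "open Om" "is_weak_gradient Om u g1" "is_weak_gradient Om u g2"
  shows "AE x in lebesgue_on Om. g1 x = g2 x"
proof -
  have "AE x in lebesgue_on Om. (g1 x - g2 x) \<bullet> i = 0" if i: "i \<in> Basis" for i
  proof (rule fundamental_lemma[OF \<open>open Om\<close>])
    have li: "locally_integrable Om (\<lambda>x. g1 x \<bullet> i)" "locally_integrable Om (\<lambda>x. g2 x \<bullet> i)"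
      using assms(2,3) by (auto simp: is_weak_gradient_def locally_integrable_def)
    then show "locally_integrable Om (\<lambda>x. (g1 x - g2 x) \<bullet> i)"
      by (auto simp: locally_integrable_def inner_diff_left)
    fix \<phi> assume \<phi>: "test_fun Om \<phi>"
    obtain B where B: "\<And>x. \<bar>\<phi> x\<bar> \<le> B" using test_fun_bounded[OF \<phi>] by metis
    obtain K where K: "compact K" "K \<subseteq> Om" "\<And>x. x \<notin> K \<Longrightarrow> \<phi> x = 0" using test_fun_support[OF \<phi>] by metis
    note int = integrable_lebesgue_on_mult_test[OF \<open>open Om\<close> _ test_fun_borel(1)[OF \<phi>] B K]
    have "(LINT x|lebesgue_on Om. (g1 x - g2 x) \<bullet> i * \<phi> x) =
        (LINT x|lebesgue_on Om. g1 x \<bullet> i * \<phi> x) - (LINT x|lebesgue_on Om. g2 x \<bullet> i * \<phi> x)"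
      using int[OF li(1)] int[OF li(2)] by (simp add: inner_diff_left left_diff_distrib)
    also have "\<dots> = 0"
    proof -
      have "(LINT x|lebesgue_on Om. u x * frechet_derivative \<phi> (at x) i) = - (LINT x|lebesgue_on Om. g1 x \<bullet> i * \<phi> x)"
        "(LINT x|lebesgue_on Om. u x * frechet_derivative \<phi> (at x) i) = - (LINT x|lebesgue_on Om. g2 x \<bullet> i * \<phi> x)"
        using assms(2,3) \<phi> i unfolding is_weak_gradient_def by blast+
      then show ?thesis by linarith
    qed
    finally show "(LINT x|lebesgue_on Om. (g1 x - g2 x) \<bullet> i * \<phi> x) = 0" .
  qed
  then have "AE x in lebesgue_on Om. \<forall>i\<in>Basis. (g1 x - g2 x) \<bullet> i = 0" by (subst AE_finite_all) auto
  then show ?thesis by eventually_elim (metis eq_iff_diff_eq_0 euclidean_all_zero_iff)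
qed

lemma weak_gradient_diff_test:
  fixes u :: "'a::euclidean_space \<Rightarrow> real"
  assumes "open Om" "is_weak_gradient Om u g" and f: "test_fun Om f"
  shows "is_weak_gradient Om (\<lambda>x. u x - f x) (\<lambda>x. g x - grad f x)"
  unfolding is_weak_gradient_def
proof (intro conjI allI impI ballI)
  have wf: "is_weak_gradient Om f (grad f)" using test_fun_weak_gradient assms by blast
  show li: "locally_integrable Om (\<lambda>x. u x - f x)" "locally_integrable Om (\<lambda>x. g x - grad f x)"
    using assms(2) wf by (auto simp: is_weak_gradient_def locally_integrable_def)
  fix \<phi> :: "'a \<Rightarrow> real" and i :: 'a assume \<phi>: "test_fun Om \<phi>" and i: "i \<in> Basis"
  obtain B where B: "\<And>x. \<bar>\<phi> x\<bar> \<le> B" "\<And>x. norm (grad \<phi> x) \<le> B" using test_fun_bounded[OF \<phi>] by metis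
  then have B': "\<bar>grad \<phi> x \<bullet> i\<bar> \<le> B" for x using i by (meson Basis_le_norm order_trans)
  obtain K where K: "compact K" "K \<subseteq> Om" "\<And>x. x \<notin> K \<Longrightarrow> \<phi> x = 0" "\<And>x. x \<notin> K \<Longrightarrow> grad \<phi> x \<bullet> i = 0"
    using test_fun_support[OF \<phi>] by (metis inner_zero_left)
  have m: "(\<lambda>x. grad \<phi> x \<bullet> i) \<in> borel_measurable borel"
    using test_fun_borel(2)[OF \<phi>] by measurable
  note int1 = integrable_lebesgue_on_mult_test[OF \<open>open Om\<close> _ m B' K(1,2,4)]
  note int2 = integrable_lebesgue_on_mult_test[OF \<open>open Om\<close> _ test_fun_borel(1)[OF \<phi>] B(1) K(1-3)]
  have lis: "locally_integrable Om u" "locally_integrable Om f"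
      "locally_integrable Om (\<lambda>x. g x \<bullet> i)" "locally_integrable Om (\<lambda>x. grad f x \<bullet> i)"
    using assms(2) wf by (auto simp: is_weak_gradient_def locally_integrable_def)
  have "(LINT x|lebesgue_on Om. u x * (grad \<phi> x \<bullet> i)) = - (LINT x|lebesgue_on Om. g x \<bullet> i * \<phi> x)"
      "(LINT x|lebesgue_on Om. f x * (grad \<phi> x \<bullet> i)) = - (LINT x|lebesgue_on Om. grad f x \<bullet> i * \<phi> x)"
    using assms(2) wf \<phi> i by (auto simp: is_weak_gradient_def grad_inner_Basis)
  then show "(LINT x|lebesgue_on Om. (u x - f x) * frechet_derivative \<phi> (at x) i) = - (LINT x|lebesgue_on Om. (g x - grad f x) \<bullet> i * \<phi> x)"
    using int1[OF lis(1)] int1[OF lis(2)] int2[OF lis(3)] int2[OF lis(4)]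
    by (simp add: grad_inner_Basis[OF i, symmetric] left_diff_distrib inner_diff_left)
qed

section \<open>The subcritical Sobolev inequality\<close>

text \<open>The uniform probability measure on a ball of radius 1/2 about a unit vector. Its points
  have norm between 1/2 and 3/2: the lower bound drives \<open>x + T *\<^sub>R z\<close> out of a
  bounded set for large \<open>T\<close>, the upper one keeps \<open>x + t *\<^sub>R z\<close> close
  to \<open>x\<close> for small \<open>t\<close>.\<close>

definition avg_measure :: "'a::euclidean_space measure" where
  "avg_measure = uniform_measure lborel (ball (SOME i. i \<in> Basis) (1/2))"

lemma some_Basis: "(SOME i. i \<in> Basis) \<in> (Basis :: 'a::euclidean_space set)"
  using SOME_Basis by blast

lemma avg_ball: "0 < emeasure lborel (ball (SOME i. i \<in> Basis) (1/2) :: 'a::euclidean_space set)"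
  "emeasure lborel (ball (SOME i. i \<in> Basis) (1/2) :: 'a::euclidean_space set) < \<infinity>"
proof -
  let ?C = "ball (SOME i. i \<in> Basis) (1/2) :: 'a set"
  show "emeasure lborel ?C < \<infinity>" by (rule emeasure_bounded_finite) simp
  then have "emeasure lborel ?C = ennreal (measure lborel ?C)"
    by (intro emeasure_eq_ennreal_measure) auto
  then show "0 < emeasure lborel ?C" using content_ball_pos[of "1/2" "SOME i. i \<in> (Basis :: 'a set)"] by simp
qed

lemma sets_avg [measurable_cong]: "sets avg_measure = sets borel"
  by (simp add: avg_measure_def)

lemma emeasure_avg: "emeasure avg_measure (space (avg_measure :: 'a::euclidean_space measure)) = 1"
  unfolding avg_measure_def using avg_ball[where 'a='a] by simp

lemma sigma_finite_avg: "sigma_finite_measure (avg_measure :: 'a::euclidean_space measure)"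
proof -
  interpret finite_measure "avg_measure :: 'a measure" by standard (simp add: emeasure_avg)
  show ?thesis by (rule sigma_finite_measure_axioms)
qed

lemma AE_avg: "AE z in (avg_measure :: 'a::euclidean_space measure). 1/2 \<le> norm z \<and> norm z \<le> 3/2"
proof -
  define e :: 'a where "e = (SOME i. i \<in> Basis)"
  have e: "norm e = 1" using some_Basis[where 'a='a] by (simp add: e_def)
  have "1/2 \<le> norm z \<and> norm z \<le> 3/2" if "z \<in> ball e (1/2)" for z
    using that e norm_triangle_ineq2[of e z] norm_triangle_ineq2[of z e] by (auto simp: dist_norm norm_minus_commute)
  then show ?thesis unfolding avg_measure_def e_def[symmetric]
    using avg_ball[where 'a='a] by (subst AE_uniform_measure) (auto simp: e_def[symmetric])
qed

text \<open>The substitution \<open>y = x + t *\<^sub>R z\<close> produces the Jacobian, and the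
  indicator of the ball is dropped. The bound is uniform in \<open>x\<close>.\<close>

lemma avg_le:
  obtains b :: real where "1 \<le> b" "\<And>F x t. F \<in> borel_measurable borel \<Longrightarrow> 0 < t \<Longrightarrow>
    (\<integral>\<^sup>+ z. F (x + t *\<^sub>R z) \<partial>(avg_measure :: 'a::euclidean_space measure)) \<le> ennreal (b * (1 / t) ^ DIM('a)) * (\<integral>\<^sup>+ y. F y \<partial>lborel)"
proof -
  define C :: "'a set" where "C = ball (SOME i. i \<in> Basis) (1/2)"
  define m where "m = measure lborel C"
  have C: "0 < emeasure lborel C" "emeasure lborel C < \<infinity>" unfolding C_def by (rule avg_ball)+
  have m: "emeasure lborel C = ennreal m" using C by (simp add: m_def emeasure_eq_ennreal_measure less_top)
  have m0: "0 < m" using C m by (metis ennreal_eq_0_iff linorder_not_less order_less_irrefl)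
  have [measurable]: "C \<in> sets borel" by (simp add: C_def)
  have main: "(\<integral>\<^sup>+ z. F (x + t *\<^sub>R z) \<partial>(avg_measure :: 'a measure)) \<le> ennreal ((1 / m) * (1 / t) ^ DIM('a)) * (\<integral>\<^sup>+ y. F y \<partial>lborel)"
    if F [measurable]: "F \<in> borel_measurable borel" and t: "0 < t" for F x t
  proof -
    have "(\<integral>\<^sup>+ y. F y \<partial>lborel) = (\<integral>\<^sup>+ y. F y \<partial>(density (distr lborel borel (\<lambda>z. x + t *\<^sub>R z)) (\<lambda>_. \<bar>t\<bar> ^ DIM('a))))"
      using lborel_affine[of t x] t by simp
    also have "\<dots> = ennreal (t ^ DIM('a)) * (\<integral>\<^sup>+ z. F (x + t *\<^sub>R z) \<partial>lborel)"
      using t by (simp add: nn_integral_density nn_integral_distr nn_integral_cmult)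
    finally have 1: "(\<integral>\<^sup>+ y. F y \<partial>lborel) = ennreal (t ^ DIM('a)) * (\<integral>\<^sup>+ z. F (x + t *\<^sub>R z) \<partial>lborel)" .
    have "(\<integral>\<^sup>+ z. F (x + t *\<^sub>R z) \<partial>(avg_measure :: 'a measure)) = (\<integral>\<^sup>+ z. F (x + t *\<^sub>R z) * indicator C z \<partial>lborel) / ennreal m"
      unfolding avg_measure_def C_def[symmetric] by (subst nn_integral_uniform_measure) (auto simp: m)
    also have "\<dots> \<le> (\<integral>\<^sup>+ z. F (x + t *\<^sub>R z) \<partial>lborel) / ennreal m"
      by (intro divide_right_mono_ennreal nn_integral_mono) (auto simp: indicator_def)
    also have "\<dots> = ennreal ((1 / m) * (1 / t) ^ DIM('a)) * (\<integral>\<^sup>+ y. F y \<partial>lborel)"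
    proof -
      have "ennreal ((1 / m) * (1 / t) ^ DIM('a)) * (ennreal (t ^ DIM('a)) * I) = I / ennreal m" for I
      proof -
        have "ennreal ((1 / m) * (1 / t) ^ DIM('a)) * ennreal (t ^ DIM('a)) = ennreal (1 / m)"
          using t m0 by (simp add: ennreal_mult[symmetric] power_one_over)
        then show ?thesis using m0 
          by (metis (no_types, lifting) divide_ennreal_def ennreal_1 inverse_ennreal inverse_eq_divide mult.assoc mult.commute)
      qed
      then show ?thesis unfolding 1 by simp
    qed
    finally show ?thesis .
  qed
  show thesis
  proof (rule that[of "max 1 (1 / m)"])
    fix F :: "'a \<Rightarrow> ennreal" and x :: 'a and t :: real
    assume F: "F \<in> borel_measurable borel" and t: "0 < t"
    have "(1 / m) * (1 / t) ^ DIM('a) \<le> max 1 (1 / m) * (1 / t) ^ DIM('a)"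
      using t by (intro mult_right_mono zero_le_power) auto
    then show "(\<integral>\<^sup>+ z. F (x + t *\<^sub>R z) \<partial>(avg_measure :: 'a measure)) \<le> ennreal (max 1 (1 / m) * (1 / t) ^ DIM('a)) * (\<integral>\<^sup>+ y. F y \<partial>lborel)"
      by (rule order_trans[OF main[OF F t] mult_right_mono[OF ennreal_leI]]) simp
  qed simp
qed

text \<open>Jensen's inequality for the concave root on a space of finite mass, up to the factor
  \<open>W + 1\<close>. The linear bound \<open>y \<le> c + c powr (1 - r) * y powr r\<close>
  replaces the tangent line, and \<open>c\<close> is chosen so that
  \<open>c powr (1 - r) * \<phi> = c\<close>.\<close>

lemma nn_integral_powr_root_le:
  assumes "emeasure M (space M) \<le> ennreal W" "0 \<le> W"
    and F [measurable]: "F \<in> borel_measurable M" and F0: "\<And>x. 0 \<le> F x"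
    and r: "1 \<le> r" and \<phi>: "0 < \<phi>" "(\<integral>\<^sup>+ x. ennreal (F x) \<partial>M) \<le> ennreal \<phi>"
  shows "(\<integral>\<^sup>+ x. ennreal (F x powr (1 / r)) \<partial>M) \<le> ennreal ((W + 1) * \<phi> powr (1 / r))"
proof -
  define c where "c = \<phi> powr (1 / r)"
  have c: "0 < c" using \<phi> by (simp add: c_def)
  have pw: "F x powr (1 / r) \<le> c + c powr (1 - r) * F x" for x
  proof (cases "F x powr (1 / r) \<le> c")
    case True then show ?thesis using F0[of x] by (simp add: add_increasing2)
  next
    case False
    define y where "y = F x powr (1 / r)"
    have y: "c < y" "0 < y" using False c by (auto simp: y_def)
    have Fy: "F x = y powr r" using F0[of x] r by (simp add: y_def powr_powr)
    have "y = y powr (1 - r) * y powr r" using y by (simp add: powr_add[symmetric])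
    also have "\<dots> \<le> c powr (1 - r) * y powr r"
      using y c r by (intro mult_right_mono powr_mono2') auto
    finally have "y \<le> c powr (1 - r) * F x" by (simp only: Fy)
    then show ?thesis using c unfolding y_def by linarith
  qed
  have "(\<integral>\<^sup>+ x. ennreal (F x powr (1 / r)) \<partial>M) \<le> (\<integral>\<^sup>+ x. ennreal c + ennreal (c powr (1 - r)) * ennreal (F x) \<partial>M)"
    using pw F0 c by (intro nn_integral_mono) (simp add: ennreal_plus[symmetric] ennreal_mult[symmetric] ennreal_leI del: ennreal_plus)
  also have "\<dots> = ennreal c * emeasure M (space M) + ennreal (c powr (1 - r)) * (\<integral>\<^sup>+ x. ennreal (F x) \<partial>M)"
    by (simp add: nn_integral_add nn_integral_cmult)
  also have "\<dots> \<le> ennreal c * ennreal W + ennreal (c powr (1 - r)) * ennreal \<phi>"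
    using assms by (intro add_mono mult_left_mono) auto
  also have "\<dots> = ennreal (c * W + c powr (1 - r) * \<phi>)"
    using assms c by (simp add: ennreal_mult[symmetric] ennreal_plus[symmetric] del: ennreal_plus)
  also have "c powr (1 - r) * \<phi> = c"
  proof -
    have "\<phi> = c powr r" using \<phi> r by (simp add: c_def powr_powr)
    then show ?thesis using c by (simp add: powr_add[symmetric])
  qed
  finally show ?thesis by (simp add: c_def algebra_simps)
qed

lemma powr_weight_finite:
  fixes \<delta> T :: real
  assumes "0 < \<delta>" "0 < T"
  shows "(\<integral>\<^sup>+ t. ennreal (t powr (\<delta> - 1)) * indicator {0..T} t \<partial>lborel) = ennreal (T powr \<delta> / \<delta>)"
proof -
  have "((\<lambda>t. t powr (\<delta> - 1)) has_integral (T powr (\<delta> - 1 + 1) / (\<delta> - 1 + 1))) {0..T}"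
    using assms by (intro has_integral_powr_from_0) auto
  then have "((\<lambda>t. t powr (\<delta> - 1)) has_integral (T powr \<delta> / \<delta>)) {0..T}" by simp
  from nn_integral_has_integral_lebesgue[OF _ this] show ?thesis
    by (simp add: nn_integral_completion indicator_mult_ennreal mult.commute)
qed

section \<open>Continuous exponents on a bounded open set\<close>

locale exponent_domain =
  fixes Om :: "'a::euclidean_space set" and p :: "'a \<Rightarrow> real"
  assumes open_Om: "open Om" and bounded_Om: "bounded Om" and nonempty_Om: "Om \<noteq> {}"
    and cont_p: "continuous_on (closure Om) p"
    and p_bounds: "\<And>x. x \<in> closure Om \<Longrightarrow> 1 < p x \<and> p x < real DIM('a)"
begin

lemma compact_closure_Om: "compact (closure Om)"
  using bounded_Om by (simp add: compact_closure)

lemma mem_closure_Om: "x \<in> Om \<Longrightarrow> x \<in> closure Om"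
  using closure_subset by blast

lemma lmeasurable_Om: "Om \<in> lmeasurable"
  using bounded_Om open_Om by (intro lmeasurable_open)

lemma finite_measure_Om: "finite_measure (lebesgue_on Om)"
  by (rule finite_measure_lebesgue_on[OF lmeasurable_Om])

text \<open>The points \<open>x + t *\<^sub>R z\<close> may leave \<open>Om\<close>; a constant
  value there makes the exponent a Borel function on the whole space, as needed for Fubini's
  theorem.\<close>

lemma exponent_borel:
  fixes s :: "'a \<Rightarrow> real"
  assumes "continuous_on (closure Om) s"
  shows "(\<lambda>x. if x \<in> Om then s x else c) \<in> borel_measurable borel"
proof -
  have "continuous_on Om s" using assms closure_subset by (rule continuous_on_subset)
  then have "s \<in> borel_measurable (restrict_space borel Om)" by (rule borel_measurable_continuous_on_restrict)
  then show ?thesis using open_Om by (intro measurable_If_restrict_space_iff[THEN iffD2]) auto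
qed

lemma exponent_measurable:
  fixes s :: "'a \<Rightarrow> real"
  assumes "continuous_on (closure Om) s"
  shows "s \<in> borel_measurable (lebesgue_on Om)"
  using borel_measurable_lebesgue_on_borel[OF exponent_borel[OF assms, of 0], of Om]
  by (rule measurable_cong[THEN iffD1, rotated]) auto

lemma exponent_max:
  fixes s :: "'a \<Rightarrow> real"
  assumes "continuous_on (closure Om) s"
  obtains S where "1 \<le> S" "\<And>x. x \<in> closure Om \<Longrightarrow> s x \<le> S"
proof -
  have "bounded (s ` closure Om)" by (intro compact_imp_bounded compact_continuous_image assms compact_closure_Om)
  then obtain S where "\<forall>y\<in>s ` closure Om. norm y \<le> S" by (auto simp: bounded_iff)
  then show ?thesis by (intro that[of "max 1 S"]) (auto simp: abs_le_iff)
qed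

lemma exponent_lower:
  fixes s :: "'a \<Rightarrow> real"
  assumes "continuous_on (closure Om) s" "\<And>x. x \<in> closure Om \<Longrightarrow> c < s x"
  obtains d where "0 < d" "\<And>x. x \<in> closure Om \<Longrightarrow> c + d \<le> s x"
proof -
  have "closure Om \<noteq> {}" using nonempty_Om by simp
  from continuous_attains_inf[OF compact_closure_Om this assms(1)]
  obtain x0 where "x0 \<in> closure Om" "\<And>x. x \<in> closure Om \<Longrightarrow> s x0 \<le> s x" by blast
  then show ?thesis using assms(2)[of x0] that[of "s x0 - c"] by auto
qed

text \<open>The inequality \<open>r x < p_star p x\<close> is equivalent to
  \<open>real DIM('a) * (1 / p x - 1 / r x) < 1\<close>. By compactness a gap \<open>d\<close>
  remains; one half pays for lowering \<open>p\<close> by \<eta>, the other half is left for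
  \<delta>.\<close>

lemma subcritical_margin:
  assumes r: "continuous_on (closure Om) r" "\<And>x. x \<in> closure Om \<Longrightarrow> 1 \<le> r x \<and> r x < p_star p x"
  obtains \<eta> \<delta> where "0 < \<eta>" "0 < \<delta>" "\<delta> < 1" "\<And>x. x \<in> closure Om \<Longrightarrow> 1 \<le> p x - \<eta>"
    "\<And>x. x \<in> closure Om \<Longrightarrow> real DIM('a) * (1 / (p x - \<eta>) - 1 / r x) \<le> 1 - \<delta>"
proof -
  let ?N = "real DIM('a)"
  have N: "0 < ?N" by simp
  have c: "continuous_on (closure Om) (\<lambda>x. - ?N * (1 / p x - 1 / r x))"
    by (intro continuous_intros cont_p r(1)) (use p_bounds r(2) in force)+
  have "-1 < - ?N * (1 / p x - 1 / r x)" if x: "x \<in> closure Om" for x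
  proof -
    have p: "0 < p x" "0 < ?N - p x" and rr: "0 < r x" using p_bounds[OF x] r(2)[OF x] by auto
    have "r x * (?N - p x) < ?N * p x" using r(2)[OF x] p by (simp add: p_star_def field_simps)
    then have "?N * r x - ?N * p x < p x * r x" by (simp add: algebra_simps)
    then have "(?N * r x - ?N * p x) / (p x * r x) < 1" using p rr by (simp add: divide_less_eq)
    moreover have "(?N * r x - ?N * p x) / (p x * r x) = ?N * (1 / p x - 1 / r x)"
      using p rr by (simp add: field_simps)
    ultimately show ?thesis by simp
  qed
  from exponent_lower[OF c this] obtain d where d: "0 < d" "\<And>x. x \<in> closure Om \<Longrightarrow> -1 + d \<le> - ?N * (1 / p x - 1 / r x)" by blast
  obtain d' where d': "0 < d'" "\<And>x. x \<in> closure Om \<Longrightarrow> 1 + d' \<le> p x"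
    using exponent_lower[OF cont_p, of 1] p_bounds by blast
  define \<delta> where "\<delta> = min (1/2) (d / 2)"
  define \<eta> where "\<eta> = min d' (d / (2 * ?N))"
  have \<eta>: "0 < \<eta>" "\<eta> \<le> d'" using d d' N by (auto simp: \<eta>_def)
  have "\<eta> \<le> d / (2 * ?N)" by (simp add: \<eta>_def)
  then have \<eta>N: "?N * \<eta> \<le> d / 2" using N by (simp add: field_simps)
  show thesis
  proof (rule that[OF \<eta>(1), of \<delta>])
    show "0 < \<delta>" "\<delta> < 1" using d by (auto simp: \<delta>_def)
    fix x assume x: "x \<in> closure Om"
    show p1: "1 \<le> p x - \<eta>" using d'(2)[OF x] \<eta> by simp
    have "1 / (p x - \<eta>) - 1 / p x = \<eta> / (p x * (p x - \<eta>))" using p1 \<eta> by (simp add: field_simps)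
    also have "\<dots> \<le> \<eta> / 1" using p1 \<eta> mult_mono[of 1 "p x" 1 "p x - \<eta>"] by (intro divide_left_mono) auto
    finally have "?N * (1 / (p x - \<eta>) - 1 / p x) \<le> ?N * \<eta>" using N by (intro mult_left_mono) auto
    then show "?N * (1 / (p x - \<eta>) - 1 / r x) \<le> 1 - \<delta>"
      using \<eta>N d(2)[OF x] by (simp add: \<delta>_def algebra_simps)
  qed
qed

end

context exponent_domain
begin

text \<open>The value 2 outside \<open>Om\<close> is arbitrary, since the gradient vanishes there
  and \<open>0 powr a = 0\<close>.\<close>

lemma modular_test_eq:
  assumes f: "test_fun Om f"
  shows "(\<integral>\<^sup>+ x. ennreal (norm (grad f x) powr (if x \<in> Om then p x else 2)) \<partial>lborel)
     = (\<integral>\<^sup>+ x. ennreal (norm (grad f x) powr p x) \<partial>lebesgue_on Om)"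
proof -
  define pe where "pe = (\<lambda>x. if x \<in> Om then p x else 2)"
  have [measurable]: "grad f \<in> borel_measurable borel" "pe \<in> borel_measurable borel"
    using test_fun_borel[OF f] exponent_borel[OF cont_p] by (auto simp: pe_def)
  have "(\<integral>\<^sup>+ x. ennreal (norm (grad f x) powr pe x) \<partial>lborel)
     = (\<integral>\<^sup>+ x. ennreal (norm (grad f x) powr pe x) \<partial>lebesgue_on Om)"
    using test_fun_outside(2)[OF f] open_Om by (intro nn_integral_lebesgue_on_eq_lborel[symmetric]) auto
  also have "\<dots> = (\<integral>\<^sup>+ x. ennreal (norm (grad f x) powr p x) \<partial>lebesgue_on Om)"
    by (intro nn_integral_cong) (simp add: pe_def)
  finally show ?thesis by (simp add: pe_def)
qed

text \<open>Write \<open>h = norm (grad f) powr p\<close> and let \<open>A t\<close> denote the average over \<open>x + t *\<^sub>R z\<close>, \<open>z\<close> in the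
  fixed ball. Near \<open>x\<close> the exponent \<open>p\<close> is almost constant and \<open>A t (1 + h)\<close> is of order at most \<open>t\<close>
  to the power \<open>- DIM('a)\<close>, so Jensen's inequality gives
  \<open>A t (norm (grad f)) \<le> K * A t (1 + h) powr (1 / r x) * t powr (\<delta> - 1)\<close>. A second use of Jensen's
  inequality, now for the finite measure \<open>t powr (\<delta> - 1) dt\<close>, bounds \<open>\<bar>f x\<bar> powr r x\<close> by an integral of
  averages of \<open>1 + h\<close>.\<close>

lemma sobolev_modular:
  fixes r :: "'a \<Rightarrow> real"
  assumes r: "continuous_on (closure Om) r" "\<And>x. x \<in> closure Om \<Longrightarrow> 1 \<le> r x \<and> r x < p_star p x"
    and A: "0 \<le> A"
  obtains C where "0 \<le> C" "\<And>f. test_fun Om f \<Longrightarrow>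
     (\<integral>\<^sup>+ x. ennreal (norm (grad f x) powr p x) \<partial>lebesgue_on Om) \<le> ennreal A \<Longrightarrow>
     (\<integral>\<^sup>+ x. ennreal (\<bar>f x\<bar> powr r x) \<partial>lebesgue_on Om) \<le> ennreal C"
proof -
  let ?N = "DIM('a)" and ?avg = "avg_measure :: 'a measure"
  interpret P: sigma_finite_measure ?avg by (rule sigma_finite_avg)
  interpret PL: pair_sigma_finite ?avg "lborel :: real measure" by standard
  interpret PX: pair_sigma_finite ?avg "lborel :: 'a measure" by standard
  obtain \<eta> \<delta> where \<eta>: "0 < \<eta>" and \<delta>: "0 < \<delta>" "\<delta> < 1"
    and p\<eta>: "\<And>x. x \<in> closure Om \<Longrightarrow> 1 \<le> p x - \<eta>"
    and marg: "\<And>x. x \<in> closure Om \<Longrightarrow> real ?N * (1 / (p x - \<eta>) - 1 / r x) \<le> 1 - \<delta>"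
    using subcritical_margin[OF r] by metis
  have "uniformly_continuous_on (closure Om) p"
    by (rule compact_uniformly_continuous[OF cont_p compact_closure_Om])
  then obtain \<rho> where \<rho>: "0 < \<rho>" "\<And>x y. x \<in> closure Om \<Longrightarrow> y \<in> closure Om \<Longrightarrow> dist y x < \<rho> \<Longrightarrow> dist (p y) (p x) < \<eta>"
    using \<eta> unfolding uniformly_continuous_on_def by metis
  obtain R where R: "0 < R" "\<And>x. x \<in> Om \<Longrightarrow> norm x \<le> R" using bounded_Om by (meson bounded_pos)
  \<comment> \<open>For \<open>norm z \<ge> 1/2\<close> this gives
    \<open>T * norm z \<ge> 2 * R + 1/2\<close>, so every segment from a point of \<open>Om\<close>
    ends outside \<open>Om\<close>.\<close>
  define T where "T = 4 * R + 1"
  have T: "0 < T" using R by (simp add: T_def)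
  obtain b :: real where b: "1 \<le> b" "\<And>F x t. F \<in> borel_measurable borel \<Longrightarrow> 0 < t \<Longrightarrow>
    (\<integral>\<^sup>+ z. F (x + t *\<^sub>R z) \<partial>?avg) \<le> ennreal (b * (1 / t) ^ ?N) * (\<integral>\<^sup>+ y. F y \<partial>lborel)"
    using avg_le by blast
  obtain rm where rm: "1 \<le> rm" "\<And>x. x \<in> closure Om \<Longrightarrow> r x \<le> rm" using exponent_max[OF r(1)] by blast
  define pe where "pe = (\<lambda>x. if x \<in> Om then p x else 2)"
  have pe [measurable]: "pe \<in> borel_measurable borel" unfolding pe_def by (rule exponent_borel[OF cont_p])
  \<comment> \<open>Chosen so that
    \<open>1 + b * (1 / t) ^ DIM('a) * A \<le> B * (1 / t) ^ DIM('a)\<close> for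
    \<open>0 < t\<close> and \<open>t \<le> T\<close>.\<close>
  define B where "B = T ^ ?N + b * A"
  \<comment> \<open>With this exponent,
    \<open>((1 / t) ^ DIM('a)) powr E = t powr (\<delta> - 1)\<close>.\<close>
  define E where "E = (1 - \<delta>) / real ?N"
  \<comment> \<open>The two entries belong to \<open>t \<le> \<rho> / 2\<close>, where exponents can
    be compared, and to larger \<open>t\<close>, where \<open>1 / t\<close> is bounded.\<close>
  define K where "K = max (2 * B powr E) (B * (2 / \<rho>) ^ ?N * T powr (1 - \<delta>))"
  define W where "W = T powr \<delta> / \<delta>"
  \<comment> \<open>The maximum with 1 allows the variable exponent \<open>r x\<close> to be
    replaced by its bound \<open>rm\<close>.\<close>
  define L where "L = max 1 (3/2 * K * (W + 1)) powr rm"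
  have B: "0 < B" using T b A by (simp add: B_def add_pos_nonneg)
  have K: "0 < K" using B by (simp add: K_def less_max_iff_disj)
  have W: "0 < W" using T \<delta> by (simp add: W_def)
  have L: "1 \<le> L" using rm by (auto simp: L_def intro!: ge_one_powr_ge_zero)
  define \<mu> where "\<mu> = density lborel (\<lambda>t. ennreal (t powr (\<delta> - 1)) * indicator {0..T} t)"
  have sets\<mu> [measurable_cong]: "sets \<mu> = sets borel" by (simp add: \<mu>_def)
  have \<mu>W: "emeasure \<mu> (space \<mu>) = ennreal W"
    using powr_weight_finite[OF \<delta>(1) T] by (simp add: \<mu>_def emeasure_density W_def)
  have \<mu>int: "(\<integral>\<^sup>+ t. g t \<partial>\<mu>) = (\<integral>\<^sup>+ t. ennreal (t powr (\<delta> - 1)) * indicator {0..T} t * g t \<partial>lborel)"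
    if [measurable]: "g \<in> borel_measurable borel" for g
    unfolding \<mu>_def by (subst nn_integral_density) auto
  interpret MU: finite_measure \<mu> by standard (simp add: \<mu>W)
  interpret PM: pair_sigma_finite \<mu> "lborel :: 'a measure" by standard
  have B1: "1 \<le> B * (1 / t) ^ ?N" if "0 < t" "t \<le> T" for t
  proof -
    have "t ^ ?N \<le> T ^ ?N" using that by (intro power_mono) auto
    also have "\<dots> \<le> B" using b A by (simp add: B_def)
    finally show ?thesis using that by (simp add: power_one_over field_simps)
  qed
  define mO where "mO = measure lborel Om"
  have mO: "emeasure lborel Om = ennreal mO" "0 \<le> mO"
    using emeasure_bounded_finite[OF bounded_Om] by (simp_all add: mO_def emeasure_eq_ennreal_measure)
  show thesis
  proof (rule that[of "L * (W * (mO + A))"])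
    show "0 \<le> L * (W * (mO + A))" using L W A mO by simp
  next
    fix f assume f: "test_fun Om f"
      and fA: "(\<integral>\<^sup>+ x. ennreal (norm (grad f x) powr p x) \<partial>lebesgue_on Om) \<le> ennreal A"
    define G where "G y = norm (grad f y)" for y
    define h where "h y = G y powr pe y" for y
    have Gm [measurable]: "G \<in> borel_measurable borel" "f \<in> borel_measurable borel"
      using test_fun_borel[OF f] unfolding G_def by measurable
    have hm [measurable]: "h \<in> borel_measurable borel" unfolding h_def by measurable
    have h0: "0 \<le> h y" for y by (simp add: h_def)
    have hA: "(\<integral>\<^sup>+ y. ennreal (h y) \<partial>lborel) \<le> ennreal A"
      using fA modular_test_eq[OF f] by (simp add: h_def G_def pe_def)
    define Hc where "Hc t x = (\<integral>\<^sup>+ z. ennreal (1 + h (x + t *\<^sub>R z)) \<partial>?avg)" for t x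
    \<comment> \<open>The real version is faithful only for \<open>0 < t\<close> and
      \<open>t \<le> T\<close>, where \<open>Hc_le\<close> gives finiteness; the point
      \<open>t = 0\<close> is a null set.\<close>
    define H where "H t x = enn2real (Hc t x)" for t x
    have Hc_eq: "Hc t x = 1 + (\<integral>\<^sup>+ z. ennreal (h (x + t *\<^sub>R z)) \<partial>?avg)" for t x
    proof -
      have "Hc t x = (\<integral>\<^sup>+ z. 1 + ennreal (h (x + t *\<^sub>R z)) \<partial>?avg)"
        unfolding Hc_def using h0 by (intro nn_integral_cong) (simp add: ennreal_plus)
      also have "\<dots> = 1 + (\<integral>\<^sup>+ z. ennreal (h (x + t *\<^sub>R z)) \<partial>?avg)"
        by (subst nn_integral_add) (auto simp: emeasure_avg)
      finally show ?thesis .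
    qed
    have Hc_le: "Hc t x \<le> ennreal (B * (1 / t) ^ ?N)" if t: "0 < t" "t \<le> T" for t x
    proof -
      have "Hc t x \<le> 1 + ennreal (b * (1 / t) ^ ?N) * ennreal A"
        unfolding Hc_eq
        by (intro add_left_mono order_trans[OF b(2) mult_left_mono[OF hA]]) (use t in auto)
      also have "\<dots> = ennreal (1 + b * (1 / t) ^ ?N * A)"
        using b A t by (simp add: ennreal_mult[symmetric] ennreal_plus[symmetric] ennreal_1[symmetric] del: ennreal_plus ennreal_1)
      also have "1 + b * (1 / t) ^ ?N * A \<le> B * (1 / t) ^ ?N"
      proof -
        have "1 \<le> T ^ ?N * (1 / t) ^ ?N"
          using t unfolding power_mult_distrib[symmetric] by (intro one_le_power) simp
        then show ?thesis by (simp add: B_def algebra_simps)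
      qed
      finally show ?thesis by (simp add: ennreal_leI)
    qed
    have HcH: "Hc t x = ennreal (H t x)" if "0 < t" "t \<le> T" for t x
      using le_less_trans[OF Hc_le[OF that] ennreal_less_top] unfolding H_def by (simp add: ennreal_enn2real)
    have H1: "1 \<le> H t x" if "0 < t" "t \<le> T" for t x
    proof -
      have "1 \<le> ennreal (H t x)" unfolding HcH[OF that, symmetric] Hc_eq by simp
      then show ?thesis by simp
    qed
    have HB: "H t x \<le> B * (1 / t) ^ ?N" if "0 < t" "t \<le> T" for t x
      using Hc_le[OF that, of x] that B unfolding HcH[OF that] by (subst (asm) ennreal_le_iff) auto
    have Hm [measurable]: "(\<lambda>w. H (fst w) (snd w)) \<in> borel_measurable (borel \<Otimes>\<^sub>M borel)"
      unfolding H_def Hc_def by measurable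
    have avg_bound: "(\<integral>\<^sup>+ z. ennreal (G (x + t *\<^sub>R z)) \<partial>?avg) \<le> ennreal (K * (H t x powr (1 / r x) * t powr (\<delta> - 1)))"
      if t: "0 < t" "t \<le> T" and x: "x \<in> Om" for t x
    proof -
      note xc = mem_closure_Om[OF x]
      have r1: "1 \<le> r x" using r(2)[OF xc] by simp
      show ?thesis
      proof (cases "t \<le> \<rho> / 2")
        case True
        define \<pi> where "\<pi> = p x - \<eta>"
        have \<pi>: "1 \<le> \<pi>" using p\<eta>[OF xc] by (simp add: \<pi>_def)
        have "AE z in ?avg. ennreal (G (x + t *\<^sub>R z)) \<le> ennreal ((1 + h (x + t *\<^sub>R z)) powr (1 / \<pi>))"
          using AE_avg
        proof eventually_elim
          case (elim z)
          define y where "y = x + t *\<^sub>R z"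
          have "dist y x < \<rho>"
          proof -
            have "dist y x = t * norm z" using t by (simp add: y_def dist_norm)
            also have "\<dots> \<le> \<rho> / 2 * (3/2)" using elim True t by (intro mult_mono) auto
            finally show ?thesis using \<rho> by simp
          qed
          have "G y \<le> (1 + h y) powr (1 / \<pi>)"
          \<comment> \<open>The summand 1 in \<open>1 + h y\<close> absorbs small gradients and
            points outside \<open>Om\<close>, so exponents need to be compared only when
            \<open>G y\<close> exceeds 1.\<close>
          proof (cases "y \<in> Om \<and> 1 < G y")
            case True
            then have "\<pi> \<le> p y" using \<rho>(2)[OF xc mem_closure_Om[of y]] \<open>dist y x < \<rho>\<close> by (auto simp: \<pi>_def dist_real_def)
            then have "G y powr \<pi> \<le> 1 + h y" using True by (simp add: h_def pe_def powr_mono add_increasing)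
            then have "(G y powr \<pi>) powr (1 / \<pi>) \<le> (1 + h y) powr (1 / \<pi>)" using \<pi> by (intro powr_mono2) auto
            then show ?thesis using True \<pi> by (simp add: powr_powr)
          next
            case False
            then have "G y \<le> 1" using test_fun_outside(2)[OF f, of y] by (auto simp: G_def)
            also have "1 \<le> (1 + h y) powr (1 / \<pi>)" using \<pi> h0[of y] by (intro ge_one_powr_ge_zero) auto
            finally show ?thesis .
          qed
          then show ?case by (simp add: y_def ennreal_leI)
        qed
        then have "(\<integral>\<^sup>+ z. ennreal (G (x + t *\<^sub>R z)) \<partial>?avg) \<le> (\<integral>\<^sup>+ z. ennreal ((1 + h (x + t *\<^sub>R z)) powr (1 / \<pi>)) \<partial>?avg)"
          by (rule nn_integral_mono_AE)
        also have "\<dots> \<le> ennreal ((1 + 1) * H t x powr (1 / \<pi>))"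
        proof (rule nn_integral_powr_root_le)
          show "(\<integral>\<^sup>+ z. ennreal (1 + h (x + t *\<^sub>R z)) \<partial>?avg) \<le> ennreal (H t x)"
            using HcH[OF t, of x] by (simp add: Hc_def)
          show "0 < H t x" using H1[OF t, of x] by simp
          show "0 \<le> 1 + h (x + t *\<^sub>R z)" for z using h0[of "x + t *\<^sub>R z"] by simp
        qed (use \<pi> in \<open>auto simp: emeasure_avg\<close>)
        also have "(1 + 1) * H t x powr (1 / \<pi>) \<le> K * (H t x powr (1 / r x) * t powr (\<delta> - 1))"
        proof -
          have e: "1 / \<pi> - 1 / r x \<le> E"
            using marg[OF xc] by (simp add: E_def \<pi>_def field_simps)
          have "H t x powr (1 / \<pi>) = H t x powr (1 / r x) * H t x powr (1 / \<pi> - 1 / r x)"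
            using H1[OF t, of x] by (simp add: powr_add[symmetric])
          also have "H t x powr (1 / \<pi> - 1 / r x) \<le> H t x powr E"
            using H1[OF t, of x] e by (intro powr_mono) auto
          also have "H t x powr E \<le> (B * (1 / t) ^ ?N) powr E"
            using HB[OF t, of x] H1[OF t, of x] \<delta> by (intro powr_mono2) (auto simp: E_def)
          also have "\<dots> = B powr E * t powr (\<delta> - 1)"
          proof -
            have "(1 / t) ^ ?N = t powr (- real ?N)"
              using t by (simp add: powr_minus powr_realpow power_one_over inverse_eq_divide)
            then have "((1 / t) ^ ?N) powr E = t powr (- real ?N * E)" by (simp only: powr_powr)
            also have "- real ?N * E = \<delta> - 1" by (simp add: E_def)
            finally show ?thesis using B t by (subst powr_mult) auto
          qed
          finally have "2 * H t x powr (1 / \<pi>) \<le> 2 * (H t x powr (1 / r x) * (B powr E * t powr (\<delta> - 1)))"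
            by (simp add: mult_left_mono)
          also have "\<dots> = (2 * B powr E) * (H t x powr (1 / r x) * t powr (\<delta> - 1))" by simp
          also have "\<dots> \<le> K * (H t x powr (1 / r x) * t powr (\<delta> - 1))"
            by (intro mult_right_mono) (auto simp: K_def)
          finally show ?thesis by simp
        qed
        finally show ?thesis by (simp add: ennreal_leI)
      next
        \<comment> \<open>For \<open>t\<close> bounded away from 0 the crude bound
          \<open>G \<le> 1 + h\<close> is enough, and no comparison of exponents is made.\<close>
        case False
        have "(\<integral>\<^sup>+ z. ennreal (G (x + t *\<^sub>R z)) \<partial>?avg) \<le> Hc t x"
          unfolding Hc_def
        proof (intro nn_integral_mono ennreal_leI)
          fix z
          let ?y = "x + t *\<^sub>R z"
          have "1 \<le> pe ?y" using p_bounds[of ?y] mem_closure_Om[of ?y] by (auto simp: pe_def)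
          then have "G ?y powr 1 \<le> G ?y powr pe ?y" if "1 < G ?y" using that by (intro powr_mono) auto
          then show "G ?y \<le> 1 + h ?y" by (cases "1 < G ?y") (auto simp: h_def add_increasing2)
        qed
        also have "\<dots> = ennreal (H t x)" by (rule HcH[OF t])
        also have "H t x \<le> K * (H t x powr (1 / r x) * t powr (\<delta> - 1))"
        proof -
          have "H t x = H t x powr (1 / r x) * H t x powr (1 - 1 / r x)"
            using H1[OF t, of x] by (simp add: powr_add[symmetric])
          also have "\<dots> \<le> H t x powr (1 / r x) * H t x powr 1"
            using H1[OF t, of x] r1 by (intro mult_left_mono powr_mono) auto
          also have "\<dots> \<le> H t x powr (1 / r x) * (B * (2 / \<rho>) ^ ?N)"
          proof -
            have "(1 / t) ^ ?N \<le> (2 / \<rho>) ^ ?N" using False \<rho> t by (intro power_mono) (auto simp: field_simps)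
            then have "B * (1 / t) ^ ?N \<le> B * (2 / \<rho>) ^ ?N" using B by simp
            then show ?thesis using HB[OF t, of x] H1[OF t, of x] by (intro mult_left_mono) auto
          qed
          also have "\<dots> \<le> H t x powr (1 / r x) * (B * (2 / \<rho>) ^ ?N * (T powr (1 - \<delta>) * t powr (\<delta> - 1)))"
          proof -
            have "1 \<le> (T / t) powr (1 - \<delta>)" using t \<delta> by (intro ge_one_powr_ge_zero) auto
            also have "\<dots> = T powr (1 - \<delta>) * t powr (\<delta> - 1)"
              using t T by (simp add: powr_divide) (metis minus_diff_eq powr_minus_divide times_divide_eq_right mult.right_neutral)
            finally show ?thesis using B \<rho> by (intro mult_left_mono) (auto simp: mult_left_le)
          qed
          also have "\<dots> = (B * (2 / \<rho>) ^ ?N * T powr (1 - \<delta>)) * (H t x powr (1 / r x) * t powr (\<delta> - 1))" by simp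
          also have "\<dots> \<le> K * (H t x powr (1 / r x) * t powr (\<delta> - 1))"
            by (intro mult_right_mono) (auto simp: K_def)
          finally show ?thesis .
        qed
        finally show ?thesis by (simp add: ennreal_leI)
      qed
    qed
    define \<Phi> where "\<Phi> x = (\<integral>\<^sup>+ t. ennreal (H t x) \<partial>\<mu>)" for x
    have Hx [measurable]: "(\<lambda>t. H t x) \<in> borel_measurable borel" for x
      unfolding H_def Hc_def by measurable
    have f\<Phi>: "ennreal (\<bar>f x\<bar> powr r x) \<le> ennreal L * \<Phi> x" if x: "x \<in> Om" for x
    proof (cases "\<Phi> x = \<infinity>")
      case True
      then show ?thesis using L by (simp add: ennreal_mult_top)
    next
      case False
      define \<phi> where "\<phi> = enn2real (\<Phi> x)"
      have \<phi>: "\<Phi> x = ennreal \<phi>" using False by (simp add: \<phi>_def less_top)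
      \<comment> \<open>This gives \<open>0 < \<phi>\<close>, which the root inequality
        requires.\<close>
      have "ennreal W \<le> \<Phi> x"
      proof -
        have "ennreal W = (\<integral>\<^sup>+ t. 1 \<partial>\<mu>)" by (simp add: \<mu>W)
        also have "\<dots> \<le> \<Phi> x" unfolding \<Phi>_def
        proof (rule nn_integral_mono_AE)
          have "AE t in lborel. t \<noteq> (0::real)" by (rule AE_lborel_singleton)
          then show "AE t in \<mu>. 1 \<le> ennreal (H t x)"
            unfolding \<mu>_def by (subst AE_density) (auto elim!: eventually_mono simp: indicator_def intro!: H1 split: if_splits)
        qed
        finally show ?thesis .
      qed
      then have \<phi>0: "0 < \<phi>" using W \<phi> by (metis ennreal_le_iff2 less_le_trans linorder_not_less)
      have xT: "f (x + T *\<^sub>R z) = 0" if "1/2 \<le> norm z" for z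
      proof -
        have "T * (1/2) \<le> T * norm z" using that T by (intro mult_left_mono) auto
        moreover have "T * (1/2) = 2 * R + 1/2" by (simp add: T_def)
        moreover have "norm (T *\<^sub>R z) = T * norm z" using T by simp
        ultimately have "R < norm (T *\<^sub>R z) - norm x" using R(2)[OF x] by linarith
        also have "\<dots> \<le> norm (x + T *\<^sub>R z)" using norm_triangle_ineq2[of "T *\<^sub>R z" "- x"] by (simp add: add.commute)
        finally show ?thesis using R(2) test_fun_outside(1)[OF f] by (meson not_le)
      qed
      \<comment> \<open>The value \<open>f x\<close> does not depend on \<open>z\<close>; averaging
        the fundamental theorem over all directions replaces the gradient on a segment by its
        averages.\<close>
      have "ennreal \<bar>f x\<bar> = (\<integral>\<^sup>+ z. ennreal \<bar>f x\<bar> \<partial>?avg)" by (simp add: emeasure_avg)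
      also have "\<dots> \<le> (\<integral>\<^sup>+ z. (\<integral>\<^sup>+ t. ennreal (3/2) * (ennreal (G (x + t *\<^sub>R z)) * indicator {0..T} t) \<partial>lborel) \<partial>?avg)"
      proof (rule nn_integral_mono_AE)
        show "AE z in ?avg. ennreal \<bar>f x\<bar> \<le> (\<integral>\<^sup>+ t. ennreal (3/2) * (ennreal (G (x + t *\<^sub>R z)) * indicator {0..T} t) \<partial>lborel)"
          using AE_avg
        proof eventually_elim
          case (elim z)
          have "ennreal \<bar>f x\<bar> = ennreal \<bar>f (x + T *\<^sub>R z) - f x\<bar>" using xT elim by simp
          also have "\<dots> \<le> (\<integral>\<^sup>+ t. ennreal (G (x + t *\<^sub>R z) * norm z) * indicator {0..T} t \<partial>lborel)"
            unfolding G_def using T by (intro test_fun_ftc test_fun_smooth[OF f]) auto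
          also have "\<dots> \<le> (\<integral>\<^sup>+ t. ennreal (3/2) * (ennreal (G (x + t *\<^sub>R z)) * indicator {0..T} t) \<partial>lborel)"
          proof (intro nn_integral_mono)
            fix t :: real
            have "G (x + t *\<^sub>R z) * norm z \<le> 3/2 * G (x + t *\<^sub>R z)" 
              using mult_right_mono[of "norm z" "3/2" "G (x + t *\<^sub>R z)"] elim by (simp add: G_def mult.commute)
            then have "ennreal (G (x + t *\<^sub>R z) * norm z) \<le> ennreal (3/2) * ennreal (G (x + t *\<^sub>R z))"
              by (subst ennreal_mult[symmetric]) (auto simp: G_def intro: ennreal_leI)
            then show "ennreal (G (x + t *\<^sub>R z) * norm z) * indicator {0..T} t \<le> ennreal (3/2) * (ennreal (G (x + t *\<^sub>R z)) * indicator {0..T} t)"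
              by (simp add: indicator_def)
          qed
          finally show ?case .
        qed
      qed
      also have "\<dots> = (\<integral>\<^sup>+ t. (\<integral>\<^sup>+ z. ennreal (3/2) * (ennreal (G (x + t *\<^sub>R z)) * indicator {0..T} t) \<partial>?avg) \<partial>lborel)"
        by (rule PL.Fubini'[symmetric]) measurable
      also have "\<dots> = (\<integral>\<^sup>+ t. ennreal (3/2) * ((\<integral>\<^sup>+ z. ennreal (G (x + t *\<^sub>R z)) \<partial>?avg) * indicator {0..T} t) \<partial>lborel)"
        by (intro nn_integral_cong) (simp add: nn_integral_cmult nn_integral_multc)
      also have "\<dots> \<le> (\<integral>\<^sup>+ t. ennreal (3/2 * K) * (ennreal (t powr (\<delta> - 1)) * indicator {0..T} t * ennreal (H t x powr (1 / r x))) \<partial>lborel)"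
      proof (rule nn_integral_mono_AE)
        have "AE t in lborel. t \<noteq> (0::real)" by (rule AE_lborel_singleton)
        then show "AE t in lborel. ennreal (3/2) * ((\<integral>\<^sup>+ z. ennreal (G (x + t *\<^sub>R z)) \<partial>?avg) * indicator {0..T} t)
           \<le> ennreal (3/2 * K) * (ennreal (t powr (\<delta> - 1)) * indicator {0..T} t * ennreal (H t x powr (1 / r x)))"
        proof eventually_elim
          case (elim t)
          show ?case
          proof (cases "t \<in> {0..T}")
            case True
            then have t: "0 < t" "t \<le> T" using elim by auto
            have "ennreal (3/2) * (\<integral>\<^sup>+ z. ennreal (G (x + t *\<^sub>R z)) \<partial>?avg) \<le> ennreal (3/2) * ennreal (K * (H t x powr (1 / r x) * t powr (\<delta> - 1)))"
              by (intro mult_left_mono avg_bound t x) auto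
            also have "\<dots> = ennreal (3/2 * K) * (ennreal (t powr (\<delta> - 1)) * ennreal (H t x powr (1 / r x)))"
              using K by (simp add: ennreal_mult[symmetric] mult_ac)
            finally show ?thesis using True by simp
          qed simp
        qed
      qed
      also have "\<dots> = ennreal (3/2 * K) * (\<integral>\<^sup>+ t. ennreal (H t x powr (1 / r x)) \<partial>\<mu>)"
        by (subst \<mu>int, measurable, subst nn_integral_cmult[symmetric]) auto
      also have "\<dots> \<le> ennreal (3/2 * K) * ennreal ((W + 1) * \<phi> powr (1 / r x))"
      proof (intro mult_left_mono nn_integral_powr_root_le)
        show "(\<integral>\<^sup>+ t. ennreal (H t x) \<partial>\<mu>) \<le> ennreal \<phi>" using \<phi> by (simp add: \<Phi>_def)
        show "1 \<le> r x" using r(2)[OF mem_closure_Om[OF x]] by simp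
        show "(\<lambda>t. H t x) \<in> borel_measurable \<mu>" by measurable
        show "0 \<le> H t x" for t by (simp add: H_def)
      qed (use W \<phi>0 in \<open>auto simp: \<mu>W\<close>)
      also have "\<dots> = ennreal (3/2 * K * (W + 1) * \<phi> powr (1 / r x))"
        using K W by (simp add: ennreal_mult[symmetric] mult_ac)
      finally have fx: "\<bar>f x\<bar> \<le> 3/2 * K * (W + 1) * \<phi> powr (1 / r x)" 
        using K W by (subst (asm) ennreal_le_iff) auto
      also have "\<dots> \<le> max 1 (3/2 * K * (W + 1)) * \<phi> powr (1 / r x)" by (intro mult_right_mono) auto
      finally have fx: "\<bar>f x\<bar> \<le> max 1 (3/2 * K * (W + 1)) * \<phi> powr (1 / r x)" .
      have rx: "1 \<le> r x" "r x \<le> rm" using r(2) rm(2) mem_closure_Om[OF x] by auto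
      have "\<bar>f x\<bar> powr r x \<le> (max 1 (3/2 * K * (W + 1)) * \<phi> powr (1 / r x)) powr r x"
        using fx rx by (intro powr_mono2) auto
      also have "\<dots> = max 1 (3/2 * K * (W + 1)) powr r x * \<phi>"
        using \<phi>0 rx by (subst powr_mult) (auto simp: powr_powr)
      also have "\<dots> \<le> L * \<phi>" unfolding L_def using rx \<phi>0 by (intro mult_right_mono powr_mono) auto
      finally show ?thesis using \<phi>0 L unfolding \<phi> by (simp add: ennreal_mult[symmetric] ennreal_leI)
    qed
    have [measurable]: "Om \<in> sets borel" using open_Om by simp
    have \<Phi>m [measurable]: "\<Phi> \<in> borel_measurable borel" 
    proof -
      have "(\<lambda>x. \<integral>\<^sup>+ t. ennreal (H t x) \<partial>\<mu>) \<in> borel_measurable borel"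
        unfolding H_def Hc_def by measurable
      then show ?thesis by (simp add: \<Phi>_def[abs_def])
    qed
    have "(\<integral>\<^sup>+ x. ennreal (\<bar>f x\<bar> powr r x) \<partial>lebesgue_on Om) \<le> (\<integral>\<^sup>+ x. ennreal L * (\<Phi> x * indicator Om x) \<partial>lebesgue_on Om)"
      by (intro nn_integral_mono) (use f\<Phi> in simp)
    also have "\<dots> = (\<integral>\<^sup>+ x. ennreal L * (\<Phi> x * indicator Om x) \<partial>lborel)"
      using open_Om by (intro nn_integral_lebesgue_on_eq_lborel) auto
    also have "\<dots> = ennreal L * (\<integral>\<^sup>+ x. \<Phi> x * indicator Om x \<partial>lborel)"
      by (rule nn_integral_cmult) measurable
    also have "(\<integral>\<^sup>+ x. \<Phi> x * indicator Om x \<partial>lborel) = (\<integral>\<^sup>+ x. (\<integral>\<^sup>+ t. ennreal (H t x) * indicator Om x \<partial>\<mu>) \<partial>lborel)"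
      by (intro nn_integral_cong) (simp add: \<Phi>_def nn_integral_multc)
    also have "\<dots> = (\<integral>\<^sup>+ t. (\<integral>\<^sup>+ x. ennreal (H t x) * indicator Om x \<partial>lborel) \<partial>\<mu>)"
      unfolding H_def Hc_def by (rule PM.Fubini') measurable
    also have "ennreal L * \<dots> \<le> ennreal L * (\<integral>\<^sup>+ t. ennreal (mO + A) \<partial>\<mu>)"
    proof (intro mult_left_mono nn_integral_mono)
      fix t
      \<comment> \<open>For each \<open>t\<close>, translation invariance bounds the integral over
        \<open>x\<close> by the measure of \<open>Om\<close> plus the modular, independently of
        \<open>t\<close>.\<close>
      have "(\<integral>\<^sup>+ x. ennreal (H t x) * indicator Om x \<partial>lborel) \<le> (\<integral>\<^sup>+ x. Hc t x * indicator Om x \<partial>lborel)"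
        unfolding H_def by (intro nn_integral_mono mult_right_mono) (auto simp: ennreal_enn2real_if)
      also have "\<dots> \<le> (\<integral>\<^sup>+ x. indicator Om x + (\<integral>\<^sup>+ z. ennreal (h (x + t *\<^sub>R z)) \<partial>?avg) \<partial>lborel)"
        unfolding Hc_eq by (intro nn_integral_mono) (auto simp: indicator_def)
      also have "\<dots> = ennreal mO + (\<integral>\<^sup>+ x. (\<integral>\<^sup>+ z. ennreal (h (x + t *\<^sub>R z)) \<partial>?avg) \<partial>lborel)"
        using open_Om by (subst nn_integral_add) (auto simp: mO)
      also have "(\<integral>\<^sup>+ x. (\<integral>\<^sup>+ z. ennreal (h (x + t *\<^sub>R z)) \<partial>?avg) \<partial>lborel) = (\<integral>\<^sup>+ z. (\<integral>\<^sup>+ x. ennreal (h (x + t *\<^sub>R z)) \<partial>lborel) \<partial>?avg)"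
        by (rule PX.Fubini') measurable
      also have "\<dots> = (\<integral>\<^sup>+ z. (\<integral>\<^sup>+ x. ennreal (h x) \<partial>lborel) \<partial>?avg)"
        by (intro nn_integral_cong nn_integral_lborel_translate) measurable
      also have "\<dots> = (\<integral>\<^sup>+ x. ennreal (h x) \<partial>lborel)" by (simp add: emeasure_avg)
      finally show "(\<integral>\<^sup>+ x. ennreal (H t x) * indicator Om x \<partial>lborel) \<le> ennreal (mO + A)"
        using hA mO(2) A by (auto simp: ennreal_plus intro: order_trans add_left_mono)
    qed auto
    also have "\<dots> = ennreal (L * (W * (mO + A)))"
      using L W mO(2) A by (simp add: \<mu>W ennreal_mult ennreal_plus mult_ac)
    finally show "(\<integral>\<^sup>+ x. ennreal (\<bar>f x\<bar> powr r x) \<partial>lebesgue_on Om) \<le> ennreal (L * (W * (mO + A)))" .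
  qed
qed

end

section \<open>Rellich's theorem\<close>

context exponent_domain
begin

lemma integrable_test_fun: "test_fun Om f \<Longrightarrow> integrable (lebesgue_on Om) f"
  by (metis integrable_lebesgue_on_bounded borel_measurable_lebesgue_on_borel lmeasurable_Om
      real_norm_def test_fun_borel(1) test_fun_bounded)

text \<open>For fixed \<open>t\<close> the averages are bounded and Lipschitz with constants
  independent of \<open>n\<close>, so a subsequence that converges on a countable dense set
  converges everywhere. They differ from \<open>f n\<close> in L1 by at most
  \<open>3/2 * t * A\<close>, uniformly in \<open>n\<close>, which lets \<open>t\<close> tend to 0
  afterwards.\<close>

lemma rellich_L1:
  fixes f :: "nat \<Rightarrow> 'a \<Rightarrow> real"
  assumes f: "\<And>n. test_fun Om (f n)" and A: "0 \<le> A"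
    and fA: "\<And>n. (\<integral>\<^sup>+ x. ennreal (norm (grad (f n) x)) \<partial>lborel) \<le> ennreal A"
  obtains k :: "nat \<Rightarrow> nat" where "strict_mono k"
    "\<And>e. 0 < e \<Longrightarrow> \<exists>N. \<forall>i\<ge>N. \<forall>j\<ge>N. (LINT x|lebesgue_on Om. norm (f (k i) x - f (k j) x)) < e"
proof -
  let ?N = "DIM('a)" and ?avg = "avg_measure :: 'a measure"
  interpret P: finite_measure ?avg by standard (simp add: emeasure_avg)
  interpret PX: pair_sigma_finite ?avg "lborel :: 'a measure" by standard
  interpret Om: finite_measure "lebesgue_on Om" by (rule finite_measure_Om)
  obtain b :: real where b: "1 \<le> b" "\<And>F x t. F \<in> borel_measurable borel \<Longrightarrow> 0 < t \<Longrightarrow>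
    (\<integral>\<^sup>+ z. F (x + t *\<^sub>R z) \<partial>?avg) \<le> ennreal (b * (1 / t) ^ ?N) * (\<integral>\<^sup>+ y. F y \<partial>lborel)"
    using avg_le by blast
  have fm [measurable]: "f n \<in> borel_measurable borel" for n using test_fun_borel[OF f] by simp
  have shift: "(\<integral>\<^sup>+ x. ennreal \<bar>f n (x + h) - f n x\<bar> \<partial>lborel) \<le> ennreal (norm h * A)" for n h
    using order_trans[OF nn_integral_shift_le[OF f] mult_left_mono[OF fA]] A by (simp add: ennreal_mult)
  obtain R where R: "0 < R" "\<And>x. x \<in> Om \<Longrightarrow> norm x \<le> R" using bounded_Om by (meson bounded_pos)
  define A1 where "A1 = (2 * R + 1) * A"
  have A1: "0 \<le> A1" using R A by (simp add: A1_def)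
  have L1: "(\<integral>\<^sup>+ x. ennreal \<bar>f n x\<bar> \<partial>lborel) \<le> ennreal A1" for n
  proof -
    \<comment> \<open>A shift by more than the diameter moves \<open>Om\<close> off itself, so the
      shift estimate bounds the L1 norm of \<open>f n\<close> itself.\<close>
    define h :: 'a where "h = (2 * R + 1) *\<^sub>R (SOME i. i \<in> Basis)"
    have h: "norm h = 2 * R + 1" using R some_Basis[where 'a='a] by (simp add: h_def)
    have "(\<integral>\<^sup>+ x. ennreal \<bar>f n x\<bar> \<partial>lborel) \<le> (\<integral>\<^sup>+ x. ennreal \<bar>f n (x + h) - f n x\<bar> \<partial>lborel)"
    proof (intro nn_integral_mono ennreal_leI)
      fix x show "\<bar>f n x\<bar> \<le> \<bar>f n (x + h) - f n x\<bar>"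
      proof (cases "x \<in> Om")
        case True
        have "norm h - norm x \<le> norm (x + h)" using norm_triangle_ineq2[of h "- x"] by (simp add: add.commute)
        then have "x + h \<notin> Om" using R(1) R(2)[OF True] R(2)[of "x + h"] h by auto
        then show ?thesis using test_fun_outside(1)[OF f] by simp
      qed (simp add: test_fun_outside(1)[OF f])
    qed
    also have "\<dots> \<le> ennreal A1" using shift[of n h] by (simp add: h A1_def)
    finally show ?thesis .
  qed
  define Mf where "Mf t n x = (LINT z|?avg. f n (x + t *\<^sub>R z))" for t :: real and n x
  have fint: "integrable ?avg (\<lambda>z. f n (x + t *\<^sub>R z))" for n x and t :: real
  proof -
    obtain B where "\<And>x. \<bar>f n x\<bar> \<le> B" using test_fun_bounded[OF f] by metis
    then show ?thesis by (intro P.integrable_const_bound[where B=B]) auto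
  qed
  have lip: "\<bar>Mf t n x - Mf t n y\<bar> \<le> b * (1 / t) ^ ?N * A * norm (y - x)" if t: "0 < t" for t n x y
  proof -
    have "ennreal \<bar>Mf t n x - Mf t n y\<bar> = ennreal (norm (LINT z|?avg. f n (x + t *\<^sub>R z) - f n (y + t *\<^sub>R z)))"
      unfolding Mf_def using fint by simp
    also have "\<dots> \<le> (\<integral>\<^sup>+ z. ennreal (norm (f n (x + t *\<^sub>R z) - f n (y + t *\<^sub>R z))) \<partial>?avg)"
      using fint by (intro integral_norm_bound_ennreal) auto
    also have "\<dots> = (\<integral>\<^sup>+ z. ennreal \<bar>f n ((x + t *\<^sub>R z) + (y - x)) - f n (x + t *\<^sub>R z)\<bar> \<partial>?avg)"
      by (intro nn_integral_cong) (simp add: abs_minus_commute algebra_simps)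
    also have "\<dots> \<le> ennreal (b * (1 / t) ^ ?N) * (\<integral>\<^sup>+ w. ennreal \<bar>f n (w + (y - x)) - f n w\<bar> \<partial>lborel)"
      by (rule b(2)[where F="\<lambda>w. ennreal \<bar>f n (w + (y - x)) - f n w\<bar>"]) (use t in auto)
    also have "\<dots> \<le> ennreal (b * (1 / t) ^ ?N) * ennreal (norm (y - x) * A)"
      by (intro mult_left_mono shift) auto
    also have "\<dots> = ennreal (b * (1 / t) ^ ?N * A * norm (y - x))"
      using b t A by (simp add: ennreal_mult[symmetric] mult_ac)
    finally show ?thesis using b t A by (subst (asm) ennreal_le_iff) auto
  qed
  have bnd: "\<bar>Mf t n x\<bar> \<le> b * (1 / t) ^ ?N * A1" if t: "0 < t" for t n x
  proof -
    have "ennreal \<bar>Mf t n x\<bar> \<le> (\<integral>\<^sup>+ z. ennreal (norm (f n (x + t *\<^sub>R z))) \<partial>?avg)"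
      unfolding Mf_def real_norm_def[symmetric] using fint by (intro integral_norm_bound_ennreal) auto
    also have "\<dots> \<le> ennreal (b * (1 / t) ^ ?N) * (\<integral>\<^sup>+ w. ennreal \<bar>f n w\<bar> \<partial>lborel)"
      using b(2)[where F="\<lambda>w. ennreal \<bar>f n w\<bar>"] t by simp
    also have "\<dots> \<le> ennreal (b * (1 / t) ^ ?N) * ennreal A1"
      by (intro mult_left_mono L1) auto
    also have "\<dots> = ennreal (b * (1 / t) ^ ?N * A1)"
      using b t A1 by (simp add: ennreal_mult[symmetric])
    finally show ?thesis using b t A1 by (subst (asm) ennreal_le_iff) auto
  qed
  have Mcont: "continuous_on UNIV (Mf t n)" if t: "0 < t" for t n
  proof -
    have "(b * (1 / t) ^ ?N * A)-lipschitz_on UNIV (Mf t n)"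
      using lip[OF t] b t A by (intro lipschitz_onI) (auto simp: dist_real_def dist_norm norm_minus_commute)
    then show ?thesis by (rule lipschitz_on_continuous_on)
  qed
  have Mm: "Mf t n \<in> borel_measurable borel" if t: "0 < t" for t n
    using Mcont[OF t] by (rule borel_measurable_continuous_onI)
  have Mint: "integrable (lebesgue_on Om) (Mf t n)" if t: "0 < t" for t n
    by (rule integrable_lebesgue_on_bounded[OF borel_measurable_lebesgue_on_borel[OF Mm[OF t]] _ lmeasurable_Om, of _ "b * (1 / t) ^ ?N * A1"])
       (use bnd[OF t] in simp)
  note fi = integrable_test_fun[OF f]
  have close: "(LINT x|lebesgue_on Om. \<bar>f n x - Mf t n x\<bar>) \<le> 3/2 * t * A" if t: "0 < t" for t n
  proof -
    have "ennreal (LINT x|lebesgue_on Om. \<bar>f n x - Mf t n x\<bar>) = (\<integral>\<^sup>+ x. ennreal \<bar>f n x - Mf t n x\<bar> \<partial>lebesgue_on Om)"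
      using fi Mint[OF t] by (intro nn_integral_eq_integral[symmetric]) auto
    also have "\<dots> = (\<integral>\<^sup>+ x. ennreal \<bar>f n x - Mf t n x\<bar> * indicator Om x \<partial>lebesgue_on Om)"
      by (intro nn_integral_cong) simp
    also have "\<dots> = (\<integral>\<^sup>+ x. ennreal \<bar>f n x - Mf t n x\<bar> * indicator Om x \<partial>lborel)"
      using open_Om Mm[OF t] by (intro nn_integral_lebesgue_on_eq_lborel) auto
    also have "\<dots> \<le> (\<integral>\<^sup>+ x. (\<integral>\<^sup>+ z. ennreal \<bar>f n (x + t *\<^sub>R z) - f n x\<bar> \<partial>?avg) \<partial>lborel)"
    proof (intro nn_integral_mono)
      fix x
      have "ennreal \<bar>f n x - Mf t n x\<bar> = ennreal (norm (LINT z|?avg. f n x - f n (x + t *\<^sub>R z)))"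
        unfolding Mf_def using fint by (simp add: measure_def emeasure_avg)
      also have "\<dots> \<le> (\<integral>\<^sup>+ z. ennreal (norm (f n x - f n (x + t *\<^sub>R z))) \<partial>?avg)"
        using fint by (intro integral_norm_bound_ennreal) auto
      also have "\<dots> = (\<integral>\<^sup>+ z. ennreal \<bar>f n (x + t *\<^sub>R z) - f n x\<bar> \<partial>?avg)"
        by (intro nn_integral_cong) (simp add: abs_minus_commute)
      finally show "ennreal \<bar>f n x - Mf t n x\<bar> * indicator Om x \<le> (\<integral>\<^sup>+ z. ennreal \<bar>f n (x + t *\<^sub>R z) - f n x\<bar> \<partial>?avg)"
        by (simp add: indicator_def)
    qed
    also have "\<dots> = (\<integral>\<^sup>+ z. (\<integral>\<^sup>+ x. ennreal \<bar>f n (x + t *\<^sub>R z) - f n x\<bar> \<partial>lborel) \<partial>?avg)"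
      by (rule PX.Fubini') measurable
    also have "\<dots> \<le> (\<integral>\<^sup>+ z. ennreal (3/2 * t * A) \<partial>?avg)"
    proof (rule nn_integral_mono_AE)
      show "AE z in ?avg. (\<integral>\<^sup>+ x. ennreal \<bar>f n (x + t *\<^sub>R z) - f n x\<bar> \<partial>lborel) \<le> ennreal (3/2 * t * A)"
        using AE_avg
      proof eventually_elim
        case (elim z)
        have "norm (t *\<^sub>R z) * A \<le> 3/2 * t * A" using elim t A by (intro mult_right_mono) auto
        then show ?case using order_trans[OF shift ennreal_leI] by blast
      qed
    qed
    also have "\<dots> = ennreal (3/2 * t * A)" by (simp add: emeasure_avg)
    finally show ?thesis using t A by (subst (asm) ennreal_le_iff) auto
  qed
  define t where "t j = inverse (real (Suc j))" for j
  have t: "0 < t j" for j by (simp add: t_def)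
  obtain D :: "'a set" where D: "countable D" "\<And>X. open X \<Longrightarrow> X \<noteq> {} \<Longrightarrow> \<exists>d\<in>D. d \<in> X"
    using countable_dense_setE by blast
  \<comment> \<open>The factor \<open>t ^ DIM('a)\<close> makes the bound the same for all
    \<open>t\<close>, so one diagonal argument over pairs of an index and a dense point serves all
    scales.\<close>
  define g where "g n w = t (fst w) ^ ?N * Mf (t (fst w)) n (snd w)" for n and w :: "nat \<times> 'a"
  have "countable (UNIV \<times> D :: (nat \<times> 'a) set)" using D(1) by auto
  moreover have "norm (g n w) \<le> b * A1" for n w
  proof -
    have "norm (g n w) = t (fst w) ^ ?N * \<bar>Mf (t (fst w)) n (snd w)\<bar>" using t[of "fst w"] by (simp add: g_def abs_mult)
    also have "\<dots> \<le> t (fst w) ^ ?N * (b * (1 / t (fst w)) ^ ?N * A1)"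
      using t[of "fst w"] by (intro mult_left_mono bnd t) auto
    also have "\<dots> = b * A1" using t[of "fst w"] by (simp add: power_one_over)
    finally show ?thesis .
  qed
  ultimately obtain k where k: "strict_mono (k::nat\<Rightarrow>nat)"
      "\<And>w. w \<in> UNIV \<times> D \<Longrightarrow> \<exists>l. (\<lambda>n. g (k n) w) \<longlonglongrightarrow> l"
    using function_convergent_subsequence[of "UNIV \<times> D" g "b * A1"] by metis
  have convD: "Cauchy (\<lambda>i. Mf (t j) (k i) x)" if x: "x \<in> D" for j x
  proof -
    obtain l where "(\<lambda>n. g (k n) (j, x)) \<longlonglongrightarrow> l" using k(2)[of "(j, x)"] x by auto
    then have "(\<lambda>n. inverse (t j ^ ?N) * g (k n) (j, x)) \<longlonglongrightarrow> inverse (t j ^ ?N) * l" by (intro tendsto_intros)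
    moreover have "inverse (t j ^ ?N) * g n (j, x) = Mf (t j) n x" for n using t[of j] by (simp add: g_def)
    ultimately show ?thesis by (auto intro: LIMSEQ_imp_Cauchy)
  qed
  have conv: "Cauchy (\<lambda>i. Mf (t j) (k i) x)" for j x
  proof (rule metric_CauchyI)
    fix e :: real assume e: "0 < e"
    define Q where "Q = b * (1 / t j) ^ ?N * A + 1"
    have Q: "0 < Q" using b t[of j] A by (simp add: Q_def add_nonneg_pos)
    have eQ: "0 < e / (3 * Q)" using e Q by simp
    then have "ball x (e / (3 * Q)) \<noteq> {}" by (metis centre_in_ball empty_iff)
    then obtain d where d: "d \<in> D" "dist x d < e / (3 * Q)"
      using D(2)[OF open_ball] by (metis mem_ball)
    have near: "\<bar>Mf (t j) n x - Mf (t j) n d\<bar> < e / 3" for n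
    proof -
      have "\<bar>Mf (t j) n x - Mf (t j) n d\<bar> \<le> b * (1 / t j) ^ ?N * A * norm (d - x)" by (rule lip[OF t])
      also have "\<dots> \<le> Q * norm (d - x)" by (intro mult_right_mono) (auto simp: Q_def)
      also have "\<dots> < Q * (e / (3 * Q))" using d Q by (intro mult_strict_left_mono) (auto simp: dist_norm norm_minus_commute)
      also have "\<dots> = e / 3" using Q by simp
      finally show ?thesis .
    qed
    obtain M where M: "\<And>m n. m \<ge> M \<Longrightarrow> n \<ge> M \<Longrightarrow> dist (Mf (t j) (k m) d) (Mf (t j) (k n) d) < e / 3"
      using metric_CauchyD[OF convD[OF d(1), of j], of "e/3"] e by auto
    have "dist (Mf (t j) (k m) x) (Mf (t j) (k n) x) < e" if "m \<ge> M" "n \<ge> M" for m n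
      using M[OF that] near[of "k m"] near[of "k n"] unfolding dist_real_def by linarith
    then show "\<exists>M. \<forall>m\<ge>M. \<forall>n\<ge>M. dist (Mf (t j) (k m) x) (Mf (t j) (k n) x) < e" by blast
  qed
  define l where "l j x = lim (\<lambda>i. Mf (t j) (k i) x)" for j x
  have lim: "(\<lambda>i. Mf (t j) (k i) x) \<longlonglongrightarrow> l j x" for j x
    unfolding l_def using conv by (simp add: Cauchy_convergent_iff convergent_LIMSEQ_iff[symmetric])
  have lbnd: "\<bar>l j x\<bar> \<le> b * (1 / t j) ^ ?N * A1" for j x
    by (rule tendsto_upperbound[OF tendsto_rabs[OF lim]]) (use bnd[OF t] in auto)
  have lm: "l j \<in> borel_measurable borel" for j
    by (rule borel_measurable_LIMSEQ_real[OF lim Mm[OF t]])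
  have lint: "integrable (lebesgue_on Om) (l j)" for j
    by (rule integrable_lebesgue_on_bounded[OF borel_measurable_lebesgue_on_borel[OF lm] _ lmeasurable_Om]) (use lbnd in simp)
  have conv1: "(\<lambda>i. LINT x|lebesgue_on Om. \<bar>Mf (t j) (k i) x - l j x\<bar>) \<longlonglongrightarrow> 0" for j
  proof -
    have "(\<lambda>i. LINT x|lebesgue_on Om. \<bar>Mf (t j) (k i) x - l j x\<bar>) \<longlonglongrightarrow> (LINT x|lebesgue_on Om. 0)"
    proof (rule integral_dominated_convergence)
      show "integrable (lebesgue_on Om) (\<lambda>x. 2 * (b * (1 / t j) ^ ?N * A1))" by simp
      show "AE x in lebesgue_on Om. (\<lambda>i. \<bar>Mf (t j) (k i) x - l j x\<bar>) \<longlonglongrightarrow> 0"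
        using tendsto_rabs_zero[OF LIM_zero[OF lim]] by simp
      show "AE x in lebesgue_on Om. norm \<bar>Mf (t j) (k i) x - l j x\<bar> \<le> 2 * (b * (1 / t j) ^ ?N * A1)" for i
      proof (intro AE_I2)
        fix x show "norm \<bar>Mf (t j) (k i) x - l j x\<bar> \<le> 2 * (b * (1 / t j) ^ ?N * A1)"
          using bnd[OF t, of j "k i" x] lbnd[of j x] unfolding real_norm_def by linarith
      qed
      show "(\<lambda>x. \<bar>Mf (t j) (k i) x - l j x\<bar>) \<in> borel_measurable (lebesgue_on Om)" for i
        using Mint[OF t, of j "k i"] lint[of j] by auto
    qed simp
    then show ?thesis by simp
  qed
  show thesis
  proof (rule that[OF k(1)])
    fix e :: real assume e: "0 < e"
    \<comment> \<open>This makes each of the two smoothing errors at most \<open>e / 8\<close>; the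
      two errors of the smoothed functions are below \<open>e / 8\<close> as well.\<close>
    obtain j where j: "t j < e / (12 * (A + 1))"
      using reals_Archimedean[of "e / (12 * (A + 1))"] e A unfolding t_def by auto
    have tA: "3/2 * t j * A \<le> e / 8"
    proof -
      have "t j * A \<le> t j * (A + 1)" using t[of j] by simp
      also have "\<dots> \<le> e / 12" using j A by (simp add: field_simps)
      finally show ?thesis unfolding mult.assoc by linarith
    qed
    obtain M where M: "\<And>i. i \<ge> M \<Longrightarrow> (LINT x|lebesgue_on Om. \<bar>Mf (t j) (k i) x - l j x\<bar>) < e / 8"
      using order_tendstoD(2)[OF conv1[of j], of "e/8"] e by (auto simp: eventually_sequentially)
    have "(LINT x|lebesgue_on Om. norm (f (k m) x - f (k n) x)) < e" if mn: "m \<ge> M" "n \<ge> M" for m n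
    proof -
      let ?I = "\<lambda>n x. \<bar>f (k n) x - Mf (t j) (k n) x\<bar>" and ?J = "\<lambda>n x. \<bar>Mf (t j) (k n) x - l j x\<bar>"
      have i: "integrable (lebesgue_on Om) (?I n)" "integrable (lebesgue_on Om) (?J n)" for n
        using fi Mint[OF t] lint by auto
      have "(LINT x|lebesgue_on Om. norm (f (k m) x - f (k n) x)) \<le> (LINT x|lebesgue_on Om. (?I m x + ?J m x) + (?I n x + ?J n x))"
      proof (rule integral_mono)
        show "integrable (lebesgue_on Om) (\<lambda>x. norm (f (k m) x - f (k n) x))" using fi by auto
        show "integrable (lebesgue_on Om) (\<lambda>x. (?I m x + ?J m x) + (?I n x + ?J n x))"
          by (intro Bochner_Integration.integrable_add i)
        show "norm (f (k m) x - f (k n) x) \<le> (?I m x + ?J m x) + (?I n x + ?J n x)" for x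
          unfolding real_norm_def by linarith
      qed
      also have "\<dots> = ((LINT x|lebesgue_on Om. ?I m x) + (LINT x|lebesgue_on Om. ?J m x))
          + ((LINT x|lebesgue_on Om. ?I n x) + (LINT x|lebesgue_on Om. ?J n x))"
        using i by (simp add: Bochner_Integration.integral_add)
      also have "\<dots> < e"
        using close[OF t, of "k m" j] close[OF t, of "k n" j] M[OF mn(1)] M[OF mn(2)] tA e by linarith
      finally show ?thesis .
    qed
    then show "\<exists>N. \<forall>i\<ge>N. \<forall>j\<ge>N. (LINT x|lebesgue_on Om. norm (f (k i) x - f (k j) x)) < e" by blast
  qed
qed

end

section \<open>Closure of the test functions\<close>

context exponent_domain
begin

abbreviation "\<Omega> \<equiv> lebesgue_on Om"

lemma p_measurable [measurable]: "p \<in> borel_measurable \<Omega>"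
  by (rule exponent_measurable[OF cont_p])

definition p_bound where "p_bound = (SOME S. 1 \<le> S \<and> (\<forall>x\<in>closure Om. p x \<le> S))"

lemma p_bound: "1 \<le> p_bound" "\<And>x. x \<in> closure Om \<Longrightarrow> p x \<le> p_bound"
proof -
  have "\<exists>S. 1 \<le> S \<and> (\<forall>x\<in>closure Om. p x \<le> S)" using exponent_max[OF cont_p] by metis
  from someI_ex[OF this] show "1 \<le> p_bound" "\<And>x. x \<in> closure Om \<Longrightarrow> p x \<le> p_bound" unfolding p_bound_def by auto
qed

lemma p_Om: "x \<in> Om \<Longrightarrow> 1 < p x" "x \<in> Om \<Longrightarrow> p x \<le> p_bound"
  using p_bounds p_bound mem_closure_Om by auto

lemma AE_p: "AE x in \<Omega>. 1 < p x \<and> p x \<le> p_bound"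
  using p_Om by (intro AE_I2) auto

section \<open>Modulars and the Luxemburg norm\<close>

lemma Lvar_iff:
  fixes w :: "'a \<Rightarrow> 'b::euclidean_space"
  assumes [measurable]: "s \<in> borel_measurable \<Omega>"
  shows "w \<in> Lvar Om s \<longleftrightarrow> w \<in> borel_measurable \<Omega> \<and> integrable \<Omega> (\<lambda>x. norm (w x) powr s x)"
proof (cases "w \<in> borel_measurable \<Omega>")
  case True
  note [measurable] = this
  have "(\<lambda>x. norm (w x) powr s x) \<in> borel_measurable \<Omega>" by measurable
  then show ?thesis using True by (auto simp: Lvar_def modular_def integrable_iff_bounded)
qed (simp add: Lvar_def)

text \<open>Division by \<open>e \<le> 1\<close> multiplies the modular by at most
  \<open>e powr (- p_bound)\<close>. With \<open>luxemburg_less_imp\<close> this shows that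
  convergence in norm and in modular agree.\<close>

lemma luxemburg_le:
  fixes w :: "'a \<Rightarrow> 'b::euclidean_space"
  assumes w: "integrable \<Omega> (\<lambda>x. norm (w x) powr p x)"
    and e: "0 < e" "e \<le> 1" "(LINT x|\<Omega>. norm (w x) powr p x) \<le> e powr p_bound"
  shows "luxemburg_norm Om p w \<le> e"
proof -
  have "modular Om p (\<lambda>x. w x /\<^sub>R e) \<le> (\<integral>\<^sup>+ x. ennreal (inverse (e powr p_bound)) * ennreal (norm (w x) powr p x) \<partial>\<Omega>)"
    unfolding modular_def
  proof (intro nn_integral_mono)
    fix x assume "x \<in> space \<Omega>"
    then have px: "p x \<le> p_bound" using p_Om by simp
    have "norm (w x /\<^sub>R e) powr p x = inverse e powr p x * norm (w x) powr p x" using e by (simp add: powr_mult)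
    also have "\<dots> \<le> inverse e powr p_bound * norm (w x) powr p x"
      using e px by (intro mult_right_mono powr_mono) (auto simp: one_le_inverse_iff)
    finally show "ennreal (norm (w x /\<^sub>R e) powr p x) \<le> ennreal (inverse (e powr p_bound)) * ennreal (norm (w x) powr p x)"
      using e by (simp add: ennreal_mult[symmetric] ennreal_leI powr_minus inverse_powr)
  qed
  also have "\<dots> = ennreal (inverse (e powr p_bound)) * ennreal (LINT x|\<Omega>. norm (w x) powr p x)"
    using w by (subst nn_integral_cmult) (auto simp: nn_integral_eq_integral)
  also have "\<dots> \<le> ennreal (inverse (e powr p_bound)) * ennreal (e powr p_bound)" using e by (intro mult_left_mono ennreal_leI) auto
  also have "\<dots> = 1" using e by (simp add: ennreal_mult[symmetric])
  finally show ?thesis unfolding luxemburg_norm_def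
    using e by (intro cInf_lower bdd_belowI[of _ 0]) auto
qed

text \<open>The infimum in the norm is meaningful only over a nonempty set. Since
  \<open>p > 1\<close>, division by \<open>\<mu> \<ge> 1\<close> gains at least one factor
  \<open>1 / \<mu>\<close>, so \<open>\<mu> = max 1 I\<close> is a witness.\<close>

lemma luxemburg_set_nonempty:
  fixes w :: "'a \<Rightarrow> 'b::euclidean_space"
  assumes w: "integrable \<Omega> (\<lambda>x. norm (w x) powr p x)"
  shows "{\<mu>. 0 < \<mu> \<and> modular Om p (\<lambda>x. w x /\<^sub>R \<mu>) \<le> 1} \<noteq> {}"
proof -
  define I where "I = (LINT x|\<Omega>. norm (w x) powr p x)"
  define \<mu> where "\<mu> = max 1 I"
  have \<mu>: "1 \<le> \<mu>" "I \<le> \<mu>" by (auto simp: \<mu>_def)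
  have "modular Om p (\<lambda>x. w x /\<^sub>R \<mu>) \<le> (\<integral>\<^sup>+ x. ennreal (inverse \<mu>) * ennreal (norm (w x) powr p x) \<partial>\<Omega>)"
    unfolding modular_def
  proof (intro nn_integral_mono)
    fix x assume "x \<in> space \<Omega>"
    then have px: "1 < p x" using p_Om by simp
    have "norm (w x /\<^sub>R \<mu>) powr p x = inverse \<mu> powr p x * norm (w x) powr p x" using \<mu> by (simp add: powr_mult)
    also have "\<dots> \<le> inverse \<mu> powr 1 * norm (w x) powr p x"
      using \<mu> px by (intro mult_right_mono powr_mono') (auto simp: inverse_le_1_iff)
    finally show "ennreal (norm (w x /\<^sub>R \<mu>) powr p x) \<le> ennreal (inverse \<mu>) * ennreal (norm (w x) powr p x)"
      using \<mu> by (simp add: ennreal_mult[symmetric] ennreal_leI)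
  qed
  also have "\<dots> = ennreal (inverse \<mu>) * ennreal I"
    using w by (subst nn_integral_cmult) (auto simp: nn_integral_eq_integral I_def)
  also have "\<dots> \<le> ennreal (inverse \<mu>) * ennreal \<mu>" using \<mu> by (intro mult_left_mono ennreal_leI) auto
  also have "\<dots> = 1" using \<mu> by (simp add: ennreal_mult[symmetric])
  finally have "\<mu> \<in> {\<mu>. 0 < \<mu> \<and> modular Om p (\<lambda>x. w x /\<^sub>R \<mu>) \<le> 1}" using \<mu> by auto
  then show ?thesis by blast
qed

lemma luxemburg_nonneg:
  fixes w :: "'a \<Rightarrow> 'b::euclidean_space"
  assumes w: "integrable \<Omega> (\<lambda>x. norm (w x) powr p x)"
  shows "0 \<le> luxemburg_norm Om p w"
  unfolding luxemburg_norm_def by (intro cInf_greatest luxemburg_set_nonempty w) auto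

text \<open>An admissible \<mu> below \<open>e \<le> 1\<close> satisfies
  \<open>\<mu> powr p x \<le> \<mu>\<close>, because \<open>p x > 1\<close>.\<close>

lemma luxemburg_less_imp:
  fixes w :: "'a \<Rightarrow> 'b::euclidean_space"
  assumes w: "integrable \<Omega> (\<lambda>x. norm (w x) powr p x)"
    and e: "e \<le> 1" "luxemburg_norm Om p w < e"
  shows "(LINT x|\<Omega>. norm (w x) powr p x) \<le> e"
proof -
  obtain \<mu> where \<mu>: "0 < \<mu>" "modular Om p (\<lambda>x. w x /\<^sub>R \<mu>) \<le> 1" "\<mu> < e"
    using cInf_lessD[OF luxemburg_set_nonempty[OF w]] e(2) unfolding luxemburg_norm_def by blast
  have [measurable]: "(\<lambda>x. norm (w x) powr p x) \<in> borel_measurable \<Omega>" using w by auto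
  have eq: "norm (w x /\<^sub>R \<mu>) powr p x = inverse \<mu> powr p x * norm (w x) powr p x" for x using \<mu> by (simp add: powr_mult)
  have "ennreal (LINT x|\<Omega>. norm (w x) powr p x) = (\<integral>\<^sup>+ x. ennreal (norm (w x) powr p x) \<partial>\<Omega>)"
    using w by (intro nn_integral_eq_integral[symmetric]) auto
  also have "\<dots> \<le> (\<integral>\<^sup>+ x. ennreal \<mu> * ennreal (norm (w x /\<^sub>R \<mu>) powr p x) \<partial>\<Omega>)"
  proof (intro nn_integral_mono)
    fix x assume "x \<in> space \<Omega>"
    then have px: "1 < p x" using p_Om by simp
    have "norm (w x) powr p x = \<mu> powr p x * norm (w x /\<^sub>R \<mu>) powr p x"
      unfolding eq using \<mu> by (simp add: powr_mult[symmetric] mult.assoc[symmetric])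
    also have "\<dots> \<le> \<mu> powr 1 * norm (w x /\<^sub>R \<mu>) powr p x"
      using \<mu> e px by (intro mult_right_mono powr_mono') auto
    finally show "ennreal (norm (w x) powr p x) \<le> ennreal \<mu> * ennreal (norm (w x /\<^sub>R \<mu>) powr p x)"
      using \<mu> by (simp add: ennreal_mult[symmetric] ennreal_leI)
  qed
  also have "\<dots> = ennreal \<mu> * modular Om p (\<lambda>x. w x /\<^sub>R \<mu>)"
    unfolding modular_def eq by (intro nn_integral_cmult) measurable
  also have "\<dots> \<le> ennreal \<mu> * 1" using \<mu> by (intro mult_left_mono) auto
  also have "\<dots> \<le> ennreal e" using \<mu> by (simp add: ennreal_leI)
  finally show ?thesis using \<mu> by (subst (asm) ennreal_le_iff) auto
qed

lemma luxemburg_cong_AE: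
  fixes v w :: "'a \<Rightarrow> 'b::euclidean_space"
  assumes "AE x in \<Omega>. v x = w x"
  shows "luxemburg_norm Om p v = luxemburg_norm Om p w"
proof -
  have "modular Om p (\<lambda>x. v x /\<^sub>R \<mu>) = modular Om p (\<lambda>x. w x /\<^sub>R \<mu>)" for \<mu>
    unfolding modular_def using assms by (intro nn_integral_cong_AE) (auto elim!: eventually_mono)
  then show ?thesis by (simp add: luxemburg_norm_def)
qed

section \<open>Modular convergence\<close>

text \<open>For the bounded exponent \<open>p\<close> this is convergence in the Luxemburg norm, put
  in the form that Fatou and Vitali arguments can use directly.\<close>

definition mconv :: "(nat \<Rightarrow> 'a \<Rightarrow> 'b::euclidean_space) \<Rightarrow> ('a \<Rightarrow> 'b) \<Rightarrow> bool" where
  "mconv f u \<longleftrightarrow> (\<forall>n. integrable \<Omega> (\<lambda>x. norm (f n x - u x) powr p x)) \<and>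
     (\<lambda>n. LINT x|\<Omega>. norm (f n x - u x) powr p x) \<longlonglongrightarrow> 0"

lemma mconv_subseq: "mconv f u \<Longrightarrow> strict_mono k \<Longrightarrow> mconv (\<lambda>n. f (k n)) u"
  unfolding mconv_def
  using LIMSEQ_subseq_LIMSEQ[of "\<lambda>n. LINT x|\<Omega>. norm (f n x - u x) powr p x" 0 k] by (simp add: o_def)

lemma integrable_powr_add:
  fixes v w :: "'a \<Rightarrow> 'b::euclidean_space"
  assumes s [measurable]: "s \<in> borel_measurable \<Omega>" and S: "\<And>x. x \<in> Om \<Longrightarrow> 0 \<le> s x \<and> s x \<le> S"
    and [measurable]: "v \<in> borel_measurable \<Omega>" "w \<in> borel_measurable \<Omega>"
    and "integrable \<Omega> (\<lambda>x. norm (v x) powr s x)" "integrable \<Omega> (\<lambda>x. norm (w x) powr s x)"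
  shows "integrable \<Omega> (\<lambda>x. norm (v x + w x) powr s x)"
    "(LINT x|\<Omega>. norm (v x + w x) powr s x) \<le> 2 powr S * ((LINT x|\<Omega>. norm (v x) powr s x) + (LINT x|\<Omega>. norm (w x) powr s x))"
proof -
  have le: "norm (v x + w x) powr s x \<le> 2 powr S * (norm (v x) powr s x + norm (w x) powr s x)" if "x \<in> Om" for x
    using S[OF that] by (intro norm_add_powr_le) auto
  have i: "integrable \<Omega> (\<lambda>x. 2 powr S * (norm (v x) powr s x + norm (w x) powr s x))" using assms by auto
  show int: "integrable \<Omega> (\<lambda>x. norm (v x + w x) powr s x)"
    by (rule Bochner_Integration.integrable_bound[OF i]) (use le in \<open>auto intro!: AE_I2\<close>)
  have "(LINT x|\<Omega>. norm (v x + w x) powr s x) \<le> (LINT x|\<Omega>. 2 powr S * (norm (v x) powr s x + norm (w x) powr s x))"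
    by (intro integral_mono int i) (use le in auto)
  also have "\<dots> = 2 powr S * ((LINT x|\<Omega>. norm (v x) powr s x) + (LINT x|\<Omega>. norm (w x) powr s x))"
    using assms by simp
  finally show "(LINT x|\<Omega>. norm (v x + w x) powr s x) \<le> 2 powr S * ((LINT x|\<Omega>. norm (v x) powr s x) + (LINT x|\<Omega>. norm (w x) powr s x))" .
qed

lemma integrable_powr_diff:
  fixes v w :: "'a \<Rightarrow> 'b::euclidean_space"
  assumes s [measurable]: "s \<in> borel_measurable \<Omega>" and S: "\<And>x. x \<in> Om \<Longrightarrow> 0 \<le> s x \<and> s x \<le> S"
    and [measurable]: "v \<in> borel_measurable \<Omega>" "w \<in> borel_measurable \<Omega>"
    and "integrable \<Omega> (\<lambda>x. norm (v x) powr s x)" "integrable \<Omega> (\<lambda>x. norm (w x) powr s x)"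
  shows "integrable \<Omega> (\<lambda>x. norm (v x - w x) powr s x)"
    "(LINT x|\<Omega>. norm (v x - w x) powr s x) \<le> 2 powr S * ((LINT x|\<Omega>. norm (v x) powr s x) + (LINT x|\<Omega>. norm (w x) powr s x))"
  using integrable_powr_add[OF s S, of v "\<lambda>x. - w x"] assms by auto

lemma integrable_powr_bounded:
  fixes w :: "'a \<Rightarrow> 'b::euclidean_space"
  assumes s [measurable]: "s \<in> borel_measurable \<Omega>" and S: "\<And>x. x \<in> Om \<Longrightarrow> 0 \<le> s x \<and> s x \<le> S"
    and [measurable]: "w \<in> borel_measurable \<Omega>" and B: "\<And>x. norm (w x) \<le> B"
  shows "integrable \<Omega> (\<lambda>x. norm (w x) powr s x)"
proof -
  interpret finite_measure \<Omega> by (rule finite_measure_Om)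
  show ?thesis
  proof (rule integrable_const_bound[where B="max 1 B powr S"])
    show "AE x in \<Omega>. norm (norm (w x) powr s x) \<le> max 1 B powr S"
    proof (intro AE_I2)
      fix x assume "x \<in> space \<Omega>"
      then have sx: "0 \<le> s x" "s x \<le> S" using S by auto
      have "norm (w x) powr s x \<le> max 1 B powr s x" using B[of x] sx by (intro powr_mono2) auto
      also have "\<dots> \<le> max 1 B powr S" using sx by (intro powr_mono) auto
      finally show "norm (norm (w x) powr s x) \<le> max 1 B powr S" by simp
    qed
  qed measurable
qed

lemma test_fun_measurable:
  assumes "test_fun Om f"
  shows "f \<in> borel_measurable \<Omega>" "grad f \<in> borel_measurable \<Omega>"
  using test_fun_borel[OF assms] by (auto intro: borel_measurable_lebesgue_on_borel)

lemma integrable_test_powr: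
  assumes f: "test_fun Om f" and s: "s \<in> borel_measurable \<Omega>" "\<And>x. x \<in> Om \<Longrightarrow> 0 \<le> s x \<and> s x \<le> S"
  shows "integrable \<Omega> (\<lambda>x. \<bar>f x\<bar> powr s x)" "integrable \<Omega> (\<lambda>x. norm (grad f x) powr s x)"
proof -
  obtain B where "\<And>x. \<bar>f x\<bar> \<le> B" "\<And>x. norm (grad f x) \<le> B" using test_fun_bounded[OF f] by metis
  then show "integrable \<Omega> (\<lambda>x. \<bar>f x\<bar> powr s x)" "integrable \<Omega> (\<lambda>x. norm (grad f x) powr s x)"
    using integrable_powr_bounded[OF s, of f B] integrable_powr_bounded[OF s, of "grad f" B] test_fun_measurable[OF f] by auto
qed

lemma p_range: "x \<in> Om \<Longrightarrow> 0 \<le> p x \<and> p x \<le> p_bound" using p_Om[of x] by simp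

lemma integrable_of_powr:
  fixes w :: "'a \<Rightarrow> 'b::euclidean_space"
  assumes [measurable]: "w \<in> borel_measurable \<Omega>" and w: "integrable \<Omega> (\<lambda>x. norm (w x) powr p x)"
  shows "integrable \<Omega> w"
proof -
  interpret finite_measure \<Omega> by (rule finite_measure_Om)
  show ?thesis
  proof (rule Bochner_Integration.integrable_bound)
    show "integrable \<Omega> (\<lambda>x. 1 + norm (w x) powr p x)" using w by simp
    show "AE x in \<Omega>. norm (w x) \<le> norm (1 + norm (w x) powr p x)" using AE_p
    proof eventually_elim
      case (elim x)
      then show ?case using powr_mono[of 1 "p x" "norm (w x)"] by (cases "norm (w x) \<le> 1") (auto simp: add_increasing add_increasing2)
    qed
  qed measurable
qed

text \<open>Young's inequality against 1 bounds the norm by \<open>d\<close> plus a multiple of its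
  power; on a set of finite measure \<open>d\<close> can be made negligible first.\<close>

lemma mconv_imp_L1:
  assumes "mconv f u" and [measurable]: "\<And>n. f n \<in> borel_measurable \<Omega>" "u \<in> borel_measurable \<Omega>"
  shows "(\<lambda>n. LINT x|\<Omega>. norm (f n x - u x)) \<longlonglongrightarrow> 0" "\<And>n. integrable \<Omega> (\<lambda>x. f n x - u x)"
proof -
  interpret finite_measure \<Omega> by (rule finite_measure_Om)
  have int: "\<And>n. integrable \<Omega> (\<lambda>x. norm (f n x - u x) powr p x)"
    and lim: "(\<lambda>n. LINT x|\<Omega>. norm (f n x - u x) powr p x) \<longlonglongrightarrow> 0" using assms(1) by (auto simp: mconv_def)
  show i: "\<And>n. integrable \<Omega> (\<lambda>x. f n x - u x)" by (rule integrable_of_powr[OF _ int]) measurable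
  show "(\<lambda>n. LINT x|\<Omega>. norm (f n x - u x)) \<longlonglongrightarrow> 0"
  proof (rule LIMSEQ_I)
    fix e :: real assume e: "0 < e"
    define m where "m = measure \<Omega> (space \<Omega>)"
    have m: "0 \<le> m" by (simp add: m_def)
    define d where "d = min 1 (e / (2 * (m + 1)))"
    have "0 < e / (2 * (m + 1))" using e m by (intro divide_pos_pos mult_pos_pos) auto
    then have d: "0 < d" "d \<le> 1" "d \<le> e / (2 * (m + 1))" by (auto simp: d_def)
    have dm: "d * m \<le> e / 2"
    proof -
      have "d * (m + 1) \<le> e / (2 * (m + 1)) * (m + 1)" using d(3) m by (intro mult_right_mono) auto
      also have "\<dots> = e / 2" using m by (simp add: field_simps)
      finally show ?thesis using d by (simp add: algebra_simps)
    qed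
    define K where "K = (1 / d) powr p_bound"
    have K: "0 < K" using d by (simp add: K_def)
    have "\<forall>\<^sub>F n in sequentially. (LINT x|\<Omega>. norm (f n x - u x) powr p x) < e / (2 * K)"
      using order_tendstoD(2)[OF lim, of "e / (2 * K)"] e K by simp
    then have "\<forall>\<^sub>F n in sequentially. norm ((LINT x|\<Omega>. norm (f n x - u x)) - 0) < e"
    proof eventually_elim
      case (elim n)
      have "(LINT x|\<Omega>. norm (f n x - u x)) \<le> (LINT x|\<Omega>. d + K * norm (f n x - u x) powr p x)"
      proof (intro integral_mono_AE)
        show "AE x in \<Omega>. norm (f n x - u x) \<le> d + K * norm (f n x - u x) powr p x"
          using AE_p
        proof eventually_elim
          case (elim x)
          then show ?case using powr_mult_young[of 1 "norm (f n x - u x)" "p x" p_bound d] d by (simp add: K_def)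
        qed
      qed (use i int in auto)
      also have "\<dots> = d * m + K * (LINT x|\<Omega>. norm (f n x - u x) powr p x)" using int by (simp add: m_def mult.commute)
      also have "\<dots> < e / 2 + K * (e / (2 * K))"
        using elim dm K by (intro add_le_less_mono mult_strict_left_mono) auto
      also have "\<dots> = e" using K by simp
      finally show ?case by simp
    qed
    then show "\<exists>no. \<forall>n\<ge>no. norm ((LINT x|\<Omega>. norm (f n x - u x)) - 0) < e" by (simp add: eventually_sequentially)
  qed
qed

lemma mconv_AE_subseq:
  assumes "mconv f u" and m: "\<And>n. f n \<in> borel_measurable \<Omega>" "u \<in> borel_measurable \<Omega>"
  obtains k :: "nat \<Rightarrow> nat" where "strict_mono k" "AE x in \<Omega>. (\<lambda>n. f (k n) x) \<longlonglongrightarrow> u x"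
proof -
  from tendsto_L1_AE_subseq[OF mconv_imp_L1(2)[OF assms] mconv_imp_L1(1)[OF assms]]
  obtain k :: "nat \<Rightarrow> nat" where k: "strict_mono k" "AE x in \<Omega>. (\<lambda>n. f (k n) x - u x) \<longlonglongrightarrow> 0" by blast
  then have "AE x in \<Omega>. (\<lambda>n. f (k n) x) \<longlonglongrightarrow> u x" by (auto simp: LIM_zero_iff)
  with k(1) that show thesis by blast
qed

section \<open>The modular closure of the test functions\<close>

text \<open>Almost everywhere convergence costs only a subsequence, and keeping it here spares later
  limit arguments a further extraction.\<close>

definition approximates :: "(nat \<Rightarrow> 'a \<Rightarrow> real) \<Rightarrow> ('a \<Rightarrow> real) \<Rightarrow> ('a \<Rightarrow> 'a) \<Rightarrow> bool" where
  "approximates f u g \<longleftrightarrow> (\<forall>n. test_fun Om (f n)) \<and> mconv f u \<and> mconv (\<lambda>n. grad (f n)) g \<and>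
     (AE x in \<Omega>. (\<lambda>n. f n x) \<longlonglongrightarrow> u x) \<and> (AE x in \<Omega>. (\<lambda>n. grad (f n) x) \<longlonglongrightarrow> g x)"

text \<open>A version of \<open>W10\<close> that carries the gradient as a second component, so that
  limits can be taken without reference to the choice made by \<open>wgrad\<close>.\<close>

definition H10 :: "('a \<Rightarrow> real) \<Rightarrow> ('a \<Rightarrow> 'a) \<Rightarrow> bool" where
  "H10 u g \<longleftrightarrow> u \<in> borel_measurable \<Omega> \<and> g \<in> borel_measurable \<Omega> \<and> (\<exists>f. approximates f u g)"

lemma H10I:
  assumes m: "u \<in> borel_measurable \<Omega>" "g \<in> borel_measurable \<Omega>" and f: "\<And>n. test_fun Om (f n)"
    and c: "mconv f u" "mconv (\<lambda>n. grad (f n)) g"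
  shows "H10 u g"
proof -
  obtain k :: "nat \<Rightarrow> nat" where k: "strict_mono k" "AE x in \<Omega>. (\<lambda>n. f (k n) x) \<longlonglongrightarrow> u x"
    using mconv_AE_subseq[OF c(1) test_fun_measurable(1)[OF f] m(1)] .
  obtain l :: "nat \<Rightarrow> nat" where l: "strict_mono l" "AE x in \<Omega>. (\<lambda>n. grad (f (k (l n))) x) \<longlonglongrightarrow> g x"
    using mconv_AE_subseq[OF mconv_subseq[OF c(2) k(1)] test_fun_measurable(2)[OF f] m(2)] .
  have "AE x in \<Omega>. (\<lambda>n. f (k (l n)) x) \<longlonglongrightarrow> u x"
    using k(2) by eventually_elim (drule LIMSEQ_subseq_LIMSEQ[OF _ l(1)], simp add: o_def)
  then have "approximates (\<lambda>n. f (k (l n))) u g"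
    unfolding approximates_def using l f mconv_subseq[OF mconv_subseq[OF c(1) k(1)] l(1)]
      mconv_subseq[OF mconv_subseq[OF c(2) k(1)] l(1)] by auto
  with m show ?thesis unfolding H10_def by blast
qed

lemma H10_test: "test_fun Om f \<Longrightarrow> H10 f (grad f)"
  by (rule H10I[of _ _ "\<lambda>n. f"]) (auto simp: mconv_def test_fun_measurable)

lemma H10_integrable:
  assumes "H10 u g"
  shows "integrable \<Omega> (\<lambda>x. \<bar>u x\<bar> powr p x)" "integrable \<Omega> (\<lambda>x. norm (g x) powr p x)"
    "integrable \<Omega> u" "integrable \<Omega> g"
proof -
  obtain f where f: "\<And>n. test_fun Om (f n)" "mconv f u" "mconv (\<lambda>n. grad (f n)) g"
    and m: "u \<in> borel_measurable \<Omega>" "g \<in> borel_measurable \<Omega>"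
    using assms by (auto simp: H10_def approximates_def)
  note fm = test_fun_measurable[OF f(1)[of 0]]
  have i: "integrable \<Omega> (\<lambda>x. norm (f 0 x - (f 0 x - u x)) powr p x)"
    by (rule integrable_powr_diff(1)[OF p_measurable p_range])
      (use integrable_test_powr(1)[OF f(1) p_measurable p_range] f(2) fm m in \<open>simp_all add: mconv_def\<close>)
  then show "integrable \<Omega> (\<lambda>x. \<bar>u x\<bar> powr p x)" by simp
  have j: "integrable \<Omega> (\<lambda>x. norm (grad (f 0) x - (grad (f 0) x - g x)) powr p x)"
    by (rule integrable_powr_diff(1)[OF p_measurable p_range])
      (use integrable_test_powr(2)[OF f(1) p_measurable p_range] f(3) fm m in \<open>simp_all add: mconv_def\<close>)
  then show "integrable \<Omega> (\<lambda>x. norm (g x) powr p x)" by simp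
  show "integrable \<Omega> u" "integrable \<Omega> g" using integrable_of_powr[OF m(1)] integrable_of_powr[OF m(2)] i j by simp_all
qed

lemma locally_integrable_of_integrable:
  fixes w :: "'a \<Rightarrow> 'b::euclidean_space"
  assumes "integrable \<Omega> w" shows "locally_integrable Om w"
  unfolding locally_integrable_def
proof (intro allI impI)
  fix K assume K: "compact K \<and> K \<subseteq> Om"
  then have Ks: "K \<in> sets lebesgue" by (simp add: borel_compact)
  have "integrable lebesgue (\<lambda>x. indicator Om x *\<^sub>R w x)"
    using assms open_Om by (subst (asm) integrable_restrict_space) auto
  then have "integrable lebesgue (\<lambda>x. indicator K x *\<^sub>R indicator Om x *\<^sub>R w x)"
    by (rule integrable_mult_indicator[OF Ks])
  moreover have "(\<lambda>x. indicator K x *\<^sub>R indicator Om x *\<^sub>R w x) = (\<lambda>x. indicator K x *\<^sub>R w x)"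
    using K by (auto simp: indicator_def fun_eq_iff)
  ultimately show "integrable (lebesgue_on K) w" using Ks by (subst integrable_restrict_space) auto
qed

lemma integral_bounded_mult_tendsto:
  fixes w :: "nat \<Rightarrow> 'a \<Rightarrow> real"
  assumes i: "\<And>n. integrable \<Omega> (w n)" "integrable \<Omega> v"
    and lim: "(\<lambda>n. LINT x|\<Omega>. norm (w n x - v x)) \<longlonglongrightarrow> 0"
    and [measurable]: "F \<in> borel_measurable \<Omega>" and B: "\<And>x. \<bar>F x\<bar> \<le> B"
  shows "(\<lambda>n. LINT x|\<Omega>. w n x * F x) \<longlonglongrightarrow> (LINT x|\<Omega>. v x * F x)"
proof -
  have [measurable]: "w n \<in> borel_measurable \<Omega>" "v \<in> borel_measurable \<Omega>" for n using i by auto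
  have iF: "integrable \<Omega> (\<lambda>x. z x * F x)" if z: "integrable \<Omega> z" for z
  proof (rule Bochner_Integration.integrable_bound[of _ "\<lambda>x. B * z x"])
    have [measurable]: "z \<in> borel_measurable \<Omega>" using z by auto
    show "(\<lambda>x. z x * F x) \<in> borel_measurable \<Omega>" by measurable
    show "AE x in \<Omega>. norm (z x * F x) \<le> norm (B * z x)"
    proof (intro AE_I2)
      fix x show "norm (z x * F x) \<le> norm (B * z x)"
        unfolding real_norm_def abs_mult using mult_right_mono[of "\<bar>F x\<bar>" "\<bar>B\<bar>" "\<bar>z x\<bar>"] B[of x] by (simp add: mult.commute)
    qed
  qed (use z in auto)
  have le: "norm ((LINT x|\<Omega>. w n x * F x) - (LINT x|\<Omega>. v x * F x)) \<le> B * (LINT x|\<Omega>. norm (w n x - v x))" for n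
  proof -
    have "(LINT x|\<Omega>. w n x * F x) - (LINT x|\<Omega>. v x * F x) = (LINT x|\<Omega>. (w n x - v x) * F x)"
      using iF i by (simp add: left_diff_distrib)
    also have "norm \<dots> \<le> (LINT x|\<Omega>. norm ((w n x - v x) * F x))" by (rule integral_norm_bound)
    also have "\<dots> \<le> (LINT x|\<Omega>. B * norm (w n x - v x))"
    proof (rule integral_mono)
      show "integrable \<Omega> (\<lambda>x. norm ((w n x - v x) * F x))" using iF[of "\<lambda>x. w n x - v x"] i by auto
      show "norm ((w n x - v x) * F x) \<le> B * norm (w n x - v x)" for x
        unfolding real_norm_def abs_mult using mult_right_mono[OF B[of x], of "\<bar>w n x - v x\<bar>"] by (simp add: mult.commute)
    qed (use i in auto)
    finally show ?thesis by simp
  qed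
  have "(\<lambda>n. (LINT x|\<Omega>. w n x * F x) - (LINT x|\<Omega>. v x * F x)) \<longlonglongrightarrow> 0"
    by (rule Lim_null_comparison[OF always_eventually]) (use le tendsto_mult_right_zero[OF lim, of B] in \<open>auto simp: tendsto_mult_right_zero\<close>)
  then show ?thesis by (simp add: LIM_zero_iff)
qed

text \<open>Integration by parts survives L1 limits, because test functions and their partial
  derivatives are bounded.\<close>

lemma H10_weak_gradient:
  assumes "H10 u g" shows "is_weak_gradient Om u g"
  unfolding is_weak_gradient_def
proof (intro conjI allI impI ballI)
  show "locally_integrable Om u" "locally_integrable Om g"
    using H10_integrable[OF assms] by (auto intro: locally_integrable_of_integrable)
  fix \<phi> :: "'a \<Rightarrow> real" and i :: 'a assume \<phi>: "test_fun Om \<phi>" and i: "i \<in> Basis"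
  obtain f where f: "\<And>n. test_fun Om (f n)" "mconv f u" "mconv (\<lambda>n. grad (f n)) g"
    and m [measurable]: "u \<in> borel_measurable \<Omega>" "g \<in> borel_measurable \<Omega>"
    using assms by (auto simp: H10_def approximates_def)
  note fm [measurable] = test_fun_measurable[OF f(1)] and \<phi>m [measurable] = test_fun_measurable[OF \<phi>]
  obtain B where B: "\<And>x. \<bar>\<phi> x\<bar> \<le> B" "\<And>x. norm (grad \<phi> x) \<le> B" using test_fun_bounded[OF \<phi>] by metis
  have Bi: "\<bar>grad \<phi> x \<bullet> i\<bar> \<le> B" for x using order_trans[OF Basis_le_norm[OF i] B(2)] .
  have fi: "integrable \<Omega> (f n)" "integrable \<Omega> (grad (f n))" for n
    using H10_integrable[OF H10_test[OF f(1)]] by auto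
  note ui = H10_integrable[OF assms]
  have 1: "(\<lambda>n. LINT x|\<Omega>. f n x * (grad \<phi> x \<bullet> i)) \<longlonglongrightarrow> (LINT x|\<Omega>. u x * (grad \<phi> x \<bullet> i))"
    by (rule integral_bounded_mult_tendsto[OF fi(1) ui(3) mconv_imp_L1(1)[OF f(2)] _ Bi]) measurable
  have "(\<lambda>n. LINT x|\<Omega>. norm (grad (f n) x \<bullet> i - g x \<bullet> i)) \<longlonglongrightarrow> 0"
  proof (rule Lim_null_comparison[OF always_eventually])
    show "(\<lambda>n. LINT x|\<Omega>. norm (grad (f n) x - g x)) \<longlonglongrightarrow> 0"
      by (rule mconv_imp_L1(1)[OF f(3)]) measurable
    show "\<forall>n. norm (LINT x|\<Omega>. norm (grad (f n) x \<bullet> i - g x \<bullet> i)) \<le> (LINT x|\<Omega>. norm (grad (f n) x - g x))"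
    proof
      fix n
      have "(LINT x|\<Omega>. norm (grad (f n) x \<bullet> i - g x \<bullet> i)) \<le> (LINT x|\<Omega>. norm (grad (f n) x - g x))"
        using fi ui Basis_le_norm[OF i, of "grad (f n) _ - g _"] by (intro integral_mono) (auto simp: inner_diff_left)
      then show "norm (LINT x|\<Omega>. norm (grad (f n) x \<bullet> i - g x \<bullet> i)) \<le> (LINT x|\<Omega>. norm (grad (f n) x - g x))"
        by simp
    qed
  qed
  then have 2: "(\<lambda>n. LINT x|\<Omega>. (grad (f n) x \<bullet> i) * \<phi> x) \<longlonglongrightarrow> (LINT x|\<Omega>. (g x \<bullet> i) * \<phi> x)"
    using fi ui by (intro integral_bounded_mult_tendsto[OF _ _ _ _ B(1)]) auto
  have "(LINT x|\<Omega>. f n x * (grad \<phi> x \<bullet> i)) = - (LINT x|\<Omega>. (grad (f n) x \<bullet> i) * \<phi> x)" for n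
    using test_fun_weak_gradient[OF open_Om f(1)[of n]] \<phi> i by (auto simp: is_weak_gradient_def grad_inner_Basis)
  then have "(\<lambda>n. LINT x|\<Omega>. f n x * (grad \<phi> x \<bullet> i)) \<longlonglongrightarrow> - (LINT x|\<Omega>. (g x \<bullet> i) * \<phi> x)"
    using tendsto_minus[OF 2] by simp
  from LIMSEQ_unique[OF 1 this]
  show "(LINT x|\<Omega>. u x * frechet_derivative \<phi> (at x) i) = - (LINT x|\<Omega>. g x \<bullet> i * \<phi> x)"
    by (simp add: grad_inner_Basis[OF i])
qed

lemma wgrad_AE_eq:
  assumes "is_weak_gradient Om u g" shows "AE x in \<Omega>. wgrad Om u x = g x"
proof -
  have "is_weak_gradient Om u (wgrad Om u)" unfolding wgrad_def by (rule someI[of "is_weak_gradient Om u", OF assms])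
  from weak_gradient_unique[OF open_Om this assms] show ?thesis .
qed

lemma H10_imp_W10:
  assumes H: "H10 u g" shows "u \<in> W10 Om p" "AE x in \<Omega>. wgrad Om u x = g x"
proof -
  note wg = H10_weak_gradient[OF H]
  show "AE x in \<Omega>. wgrad Om u x = g x" by (rule wgrad_AE_eq[OF wg])
  obtain f where f: "\<And>n. test_fun Om (f n)" "mconv f u" "mconv (\<lambda>n. grad (f n)) g"
    and m [measurable]: "u \<in> borel_measurable \<Omega>" "g \<in> borel_measurable \<Omega>"
    using H by (auto simp: H10_def approximates_def)
  have "u \<in> W1 Om p" unfolding W1_def
    using wg H10_integrable[OF H] m by (auto simp: Lvar_iff[OF p_measurable])
  moreover have "\<exists>f. test_fun Om f \<and> W1_norm Om p (\<lambda>x. u x - f x) < e" if e: "0 < e" for e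
  proof -
    define d where "d = min 1 (e / 3)"
    have d: "0 < d" "d \<le> 1" "2 * d < e" using e by (auto simp: d_def)
    have c: "\<And>n. integrable \<Omega> (\<lambda>x. norm (u x - f n x) powr p x)" "(\<lambda>n. LINT x|\<Omega>. norm (u x - f n x) powr p x) \<longlonglongrightarrow> 0"
      "\<And>n. integrable \<Omega> (\<lambda>x. norm (g x - grad (f n) x) powr p x)" "(\<lambda>n. LINT x|\<Omega>. norm (g x - grad (f n) x) powr p x) \<longlonglongrightarrow> 0"
      using f(2,3) by (auto simp: mconv_def norm_minus_commute abs_minus_commute)
    have dP: "0 < d powr p_bound" using d by simp
    obtain n where n: "(LINT x|\<Omega>. norm (u x - f n x) powr p x) < d powr p_bound" "(LINT x|\<Omega>. norm (g x - grad (f n) x) powr p x) < d powr p_bound"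
      using eventually_happens'[OF sequentially_bot eventually_conj[OF order_tendstoD(2)[OF c(2) dP] order_tendstoD(2)[OF c(4) dP]]] by blast
    have "luxemburg_norm Om p (\<lambda>x. u x - f n x) \<le> d" using n d by (intro luxemburg_le c) auto
    moreover have "luxemburg_norm Om p (wgrad Om (\<lambda>x. u x - f n x)) = luxemburg_norm Om p (\<lambda>x. g x - grad (f n) x)"
      by (rule luxemburg_cong_AE[OF wgrad_AE_eq[OF weak_gradient_diff_test[OF open_Om wg f(1)]]])
    moreover have "luxemburg_norm Om p (\<lambda>x. g x - grad (f n) x) \<le> d" using n d by (intro luxemburg_le c) auto
    ultimately have "W1_norm Om p (\<lambda>x. u x - f n x) < e" unfolding W1_norm_def using d by linarith
    with f(1) show ?thesis by blast
  qed
  ultimately show "u \<in> W10 Om p" by (simp add: W10_def)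
qed

text \<open>Both Luxemburg norms are nonnegative, so smallness of their sum makes each of them
  small. The weak gradient of \<open>u - f n\<close> is \<open>g - grad (f n)\<close> up to a null
  set, which removes the choice.\<close>

lemma W10_imp_H10:
  assumes u: "u \<in> W10 Om p" obtains g where "H10 u g" "AE x in \<Omega>. wgrad Om u x = g x"
proof -
  obtain g where uL: "u \<in> Lvar Om p" and wg: "is_weak_gradient Om u g" and gL: "g \<in> Lvar Om p"
    using u by (auto simp: W10_def W1_def)
  have m [measurable]: "u \<in> borel_measurable \<Omega>" "g \<in> borel_measurable \<Omega>"
    and i: "integrable \<Omega> (\<lambda>x. norm (u x) powr p x)" "integrable \<Omega> (\<lambda>x. norm (g x) powr p x)"
    using uL gL by (auto simp: Lvar_iff[OF p_measurable])
  have "\<forall>n. \<exists>f. test_fun Om f \<and> W1_norm Om p (\<lambda>x. u x - f x) < inverse (real (Suc n))"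
    using u by (auto simp: W10_def)
  then obtain f where f: "\<And>n. test_fun Om (f n)" "\<And>n. W1_norm Om p (\<lambda>x. u x - f n x) < inverse (real (Suc n))" by metis
  note fm [measurable] = test_fun_measurable[OF f(1)]
  have c: "integrable \<Omega> (\<lambda>x. norm (u x - f n x) powr p x)" "integrable \<Omega> (\<lambda>x. norm (g x - grad (f n) x) powr p x)" for n
    using integrable_test_powr[OF f(1)[of n] p_measurable p_range] i fm m
    by (auto intro!: integrable_powr_diff[OF p_measurable p_range, where 'b=real, simplified] integrable_powr_diff[OF p_measurable p_range])
  have eq: "luxemburg_norm Om p (wgrad Om (\<lambda>x. u x - f n x)) = luxemburg_norm Om p (\<lambda>x. g x - grad (f n) x)" for n
    by (rule luxemburg_cong_AE[OF wgrad_AE_eq[OF weak_gradient_diff_test[OF open_Om wg f(1)]]])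
  have lt: "luxemburg_norm Om p (\<lambda>x. u x - f n x) < inverse (real (Suc n))" "luxemburg_norm Om p (\<lambda>x. g x - grad (f n) x) < inverse (real (Suc n))" for n
    using f(2)[of n] luxemburg_nonneg[OF c(1)[of n]] luxemburg_nonneg[OF c(2)[of n]] unfolding W1_norm_def eq by linarith+
  have le: "(LINT x|\<Omega>. norm (u x - f n x) powr p x) \<le> inverse (real (Suc n))" "(LINT x|\<Omega>. norm (g x - grad (f n) x) powr p x) \<le> inverse (real (Suc n))" for n
    by (intro luxemburg_less_imp c lt; simp add: inverse_le_1_iff)+
  have "(\<lambda>n. LINT x|\<Omega>. norm (u x - f n x) powr p x) \<longlonglongrightarrow> 0" "(\<lambda>n. LINT x|\<Omega>. norm (g x - grad (f n) x) powr p x) \<longlonglongrightarrow> 0"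
    by (rule tendsto_sandwich[OF _ _ tendsto_const LIMSEQ_inverse_real_of_nat]; use le in simp)+
  then have "mconv f u" "mconv (\<lambda>n. grad (f n)) g" using c by (auto simp: mconv_def norm_minus_commute abs_minus_commute)
  then have "H10 u g" by (intro H10I[OF m f(1)])
  with that H10_imp_W10 show thesis by blast
qed

end

section \<open>Limits of the functionals\<close>

lemma pairing_bound:
  fixes a b :: "'b::real_inner"
  assumes "1 < r"
  shows "\<bar>norm a powr (r - 2) * (a \<bullet> b)\<bar> \<le> norm a powr (r - 1) * norm b"
proof -
  have "\<bar>norm a powr (r - 2) * (a \<bullet> b)\<bar> \<le> norm a powr (r - 2) * (norm a * norm b)"
    unfolding abs_mult by (intro mult_mono Cauchy_Schwarz_ineq2) auto
  also have "\<dots> = norm a powr (r - 1) * norm b"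
  proof (cases "a = 0")
    case False
    then have "norm a powr (r - 2) * norm a powr 1 = norm a powr (r - 1)" by (simp only: powr_add[symmetric]) simp
    then show ?thesis using False by simp
  qed simp
  finally show ?thesis .
qed

context
  fixes M :: "'a measure" and W e :: "'a \<Rightarrow> real" and E :: real
  assumes W [measurable]: "W \<in> borel_measurable M" and e [measurable]: "e \<in> borel_measurable M"
    and W0: "AE x in M. 0 \<le> W x" and e1: "AE x in M. 1 < e x \<and> e x \<le> E"
begin

text \<open>The context is used twice: with weight 1 and exponent \<open>p\<close> for gradients,
  and with weight \<open>V\<close> and exponent \<open>q\<close> for the functions themselves, where
  the inner product is multiplication of reals.\<close>

lemma pairing_integrable:
  fixes g w :: "'a \<Rightarrow> 'b::euclidean_space"
  assumes [measurable]: "g \<in> borel_measurable M" "w \<in> borel_measurable M"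
    and i: "integrable M (\<lambda>x. W x * norm (g x) powr e x)" "integrable M (\<lambda>x. W x * norm (w x) powr e x)"
  shows "integrable M (\<lambda>x. W x * (norm (g x) powr (e x - 2) * (g x \<bullet> w x)))"
proof (rule Bochner_Integration.integrable_bound)
  show "integrable M (\<lambda>x. W x * norm (g x) powr e x + W x * norm (w x) powr e x)" using i by simp
  show "AE x in M. norm (W x * (norm (g x) powr (e x - 2) * (g x \<bullet> w x))) \<le> norm (W x * norm (g x) powr e x + W x * norm (w x) powr e x)"
    using W0 e1
  proof eventually_elim
    case (elim x)
    have "\<bar>norm (g x) powr (e x - 2) * (g x \<bullet> w x)\<bar> \<le> norm (g x) powr (e x - 1) * norm (w x)"
      using elim by (intro pairing_bound) auto
    also have "\<dots> \<le> norm (g x) powr e x + norm (w x) powr e x"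
      using powr_mult_young[of "norm (g x)" "norm (w x)" "e x" E 1] elim by simp
    finally show ?case using elim mult_left_mono[of _ "norm (g x) powr e x + norm (w x) powr e x" "W x"]
      by (simp add: abs_mult distrib_left)
  qed
qed measurable

text \<open>Young's inequality splits the integrand into the fixed power of \<open>g\<close>, which
  serves as majorant, and the power of \<open>v n - w\<close>, whose integral tends to 0; Vitali's
  theorem does the rest.\<close>

lemma pairing_tendsto:
  fixes g w :: "'a \<Rightarrow> 'b::euclidean_space" and v :: "nat \<Rightarrow> 'a \<Rightarrow> 'b"
  assumes m [measurable]: "g \<in> borel_measurable M" "w \<in> borel_measurable M" "\<And>n. v n \<in> borel_measurable M"
    and i: "integrable M (\<lambda>x. W x * norm (g x) powr e x)" "integrable M (\<lambda>x. W x * norm (w x) powr e x)"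
      "\<And>n. integrable M (\<lambda>x. W x * norm (v n x - w x) powr e x)"
    and lim: "(\<lambda>n. LINT x|M. W x * norm (v n x - w x) powr e x) \<longlonglongrightarrow> 0"
    and ae: "AE x in M. (\<lambda>n. v n x) \<longlonglongrightarrow> w x"
  shows "(\<lambda>n. LINT x|M. W x * (norm (g x) powr (e x - 2) * (g x \<bullet> v n x)))
    \<longlonglongrightarrow> (LINT x|M. W x * (norm (g x) powr (e x - 2) * (g x \<bullet> w x)))"
proof -
  define X where "X n x = W x * (norm (g x) powr (e x - 1) * norm (v n x - w x))" for n x
  have Xm [measurable]: "X n \<in> borel_measurable M" for n unfolding X_def by measurable
  have nn: "AE x in M. 0 \<le> X n x" for n using W0 by eventually_elim (auto simp: X_def)
  have l: "AE x in M. (\<lambda>n. X n x) \<longlonglongrightarrow> 0" using ae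
  proof eventually_elim
    case (elim x)
    have "(\<lambda>n. W x * (norm (g x) powr (e x - 1) * norm (v n x - w x))) \<longlonglongrightarrow> W x * (norm (g x) powr (e x - 1) * norm (w x - w x))"
      by (intro tendsto_intros elim)
    then show ?case by (simp add: X_def)
  qed
  have dom: "\<exists>W' Y. integrable M W' \<and> (\<forall>n. integrable M (Y n)) \<and>
     (\<forall>n. AE x in M. X n x \<le> W' x + Y n x \<and> 0 \<le> Y n x) \<and> (\<forall>\<^sub>F n in sequentially. (LINT x|M. Y n x) \<le> d)" if d: "0 < d" for d
  proof (intro exI conjI allI)
    show "integrable M (\<lambda>x. W x * norm (g x) powr e x)" by (rule i)
    show "integrable M (\<lambda>x. W x * norm (v n x - w x) powr e x)" for n by (rule i)
    show "\<forall>\<^sub>F n in sequentially. (LINT x|M. W x * norm (v n x - w x) powr e x) \<le> d"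
      using order_tendstoD(2)[OF lim d] by eventually_elim simp
    show "AE x in M. X n x \<le> W x * norm (g x) powr e x + W x * norm (v n x - w x) powr e x \<and> 0 \<le> W x * norm (v n x - w x) powr e x" for n
      using W0 e1
    proof eventually_elim
      case (elim x)
      have "norm (g x) powr (e x - 1) * norm (v n x - w x) \<le> norm (g x) powr e x + norm (v n x - w x) powr e x"
        using powr_mult_young[of "norm (g x)" "norm (v n x - w x)" "e x" E 1] elim by simp
      then have "W x * (norm (g x) powr (e x - 1) * norm (v n x - w x)) \<le> W x * (norm (g x) powr e x + norm (v n x - w x) powr e x)"
        using elim by (intro mult_left_mono) auto
      then show ?case using elim by (simp add: X_def distrib_left)
    qed
  qed
  note X = vitali_convergence[OF Xm nn l dom]
  let ?B = "\<lambda>w x. W x * (norm (g x) powr (e x - 2) * (g x \<bullet> w x))"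
  have iw: "integrable M (?B w)" by (intro pairing_integrable i) measurable
  have id: "integrable M (?B (\<lambda>x. v n x - w x))" for n by (intro pairing_integrable i) measurable
  have le: "norm ((LINT x|M. ?B (v n) x) - (LINT x|M. ?B w x)) \<le> (LINT x|M. X n x)" for n
  proof -
    have "integrable M (\<lambda>x. ?B (\<lambda>x. v n x - w x) x + ?B w x)" using id iw by (rule Bochner_Integration.integrable_add)
    then have iv: "integrable M (?B (v n))" by (simp add: inner_diff_right algebra_simps)
    have idiff: "integrable M (\<lambda>x. ?B (v n) x - ?B w x)"
      using iv iw by (rule Bochner_Integration.integrable_diff)
    have Bdiff: "?B (v n) x - ?B w x = W x * (norm (g x) powr (e x - 2) * (g x \<bullet> (v n x - w x)))" for x
      by (simp add: inner_diff_right right_diff_distrib)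
    have AEle: "AE x in M. norm (?B (v n) x - ?B w x) \<le> X n x" using W0 e1
    proof eventually_elim
      case (elim x)
      have "norm (?B (v n) x - ?B w x) = W x * \<bar>norm (g x) powr (e x - 2) * (g x \<bullet> (v n x - w x))\<bar>"
        unfolding Bdiff using elim by (simp add: abs_mult)
      also have "\<dots> \<le> X n x" unfolding X_def using elim by (intro mult_left_mono pairing_bound) auto
      finally show ?case .
    qed
    have eq: "(LINT x|M. ?B (v n) x) - (LINT x|M. ?B w x) = (LINT x|M. ?B (v n) x - ?B w x)"
      using iv iw by simp
    show ?thesis unfolding eq
      by (rule order_trans[OF integral_norm_bound integral_mono_AE[OF integrable_norm[OF idiff] X(1) AEle]])
  qed
  have "(\<lambda>n. (LINT x|M. ?B (v n) x) - (LINT x|M. ?B w x)) \<longlonglongrightarrow> 0"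
    by (rule Lim_null_comparison[OF _ X(2)]) (intro always_eventually allI le)
  then show ?thesis by (simp add: LIM_zero_iff)
qed

text \<open>Directional derivative by dominated convergence: for steps in (0, 1] the quotients are
  bounded by a multiple of \<open>(norm g + norm w) powr e\<close>, independently of the
  step.\<close>

lemma powr_functional_derivative:
  fixes g w :: "'a \<Rightarrow> 'b::euclidean_space" and t :: "nat \<Rightarrow> real"
  assumes m [measurable]: "g \<in> borel_measurable M" "w \<in> borel_measurable M"
    and i: "integrable M (\<lambda>x. W x * norm (g x) powr e x)" "integrable M (\<lambda>x. W x * norm (w x) powr e x)"
    and t: "\<And>n. 0 < t n \<and> t n \<le> 1" "t \<longlonglongrightarrow> 0"
  shows "(\<lambda>n. ((LINT x|M. W x * (1 / e x * norm (g x + t n *\<^sub>R w x) powr e x)) - (LINT x|M. W x * (1 / e x * norm (g x) powr e x))) / t n)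
     \<longlonglongrightarrow> (LINT x|M. W x * (norm (g x) powr (e x - 2) * (g x \<bullet> w x)))"
    "\<And>n. integrable M (\<lambda>x. W x * norm (g x + t n *\<^sub>R w x) powr e x)"
proof -
  have bnd: "AE x in M. W x * (norm (g x) + norm (w x)) powr e x \<le> 2 powr E * (W x * norm (g x) powr e x + W x * norm (w x) powr e x)"
    using W0 e1
  proof eventually_elim
    case (elim x)
    have "(norm (g x) + norm (w x)) powr e x \<le> 2 powr E * (norm (g x) powr e x + norm (w x) powr e x)"
      using norm_add_powr_le[of "e x" E "norm (g x)" "norm (w x)"] elim by simp
    then show ?case using elim mult_left_mono[of _ _ "W x"] by (fastforce simp: algebra_simps)
  qed
  have ib: "integrable M (\<lambda>x. 2 powr E * (W x * norm (g x) powr e x + W x * norm (w x) powr e x))" using i by simp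
  show it: "integrable M (\<lambda>x. W x * norm (g x + t n *\<^sub>R w x) powr e x)" for n
  proof (rule Bochner_Integration.integrable_bound[OF ib])
    show "AE x in M. norm (W x * norm (g x + t n *\<^sub>R w x) powr e x) \<le> norm (2 powr E * (W x * norm (g x) powr e x + W x * norm (w x) powr e x))"
      using W0 e1 bnd
    proof eventually_elim
      case (elim x)
      have "norm (g x + t n *\<^sub>R w x) \<le> norm (g x) + norm (w x)"
        using norm_triangle_ineq[of "g x" "t n *\<^sub>R w x"] t(1)[of n] mult_left_le_one_le[of "norm (w x)" "t n"] by simp
      then have "W x * norm (g x + t n *\<^sub>R w x) powr e x \<le> W x * (norm (g x) + norm (w x)) powr e x"
        using elim by (intro mult_left_mono powr_mono2) auto
      then show ?case using elim by simp
    qed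
  qed measurable
  have ie: "integrable M (\<lambda>x. W x * (1 / e x * norm (h x) powr e x))"
    if [measurable]: "h \<in> borel_measurable M" and h: "integrable M (\<lambda>x. W x * norm (h x) powr e x)" for h :: "'a \<Rightarrow> 'b"
  proof (rule Bochner_Integration.integrable_bound[OF h])
    show "AE x in M. norm (W x * (1 / e x * norm (h x) powr e x)) \<le> norm (W x * norm (h x) powr e x)"
      using W0 e1
    proof eventually_elim
      case (elim x)
      have "W x * (1 / e x * norm (h x) powr e x) \<le> W x * (1 * norm (h x) powr e x)"
        using elim by (intro mult_left_mono mult_right_mono) auto
      moreover have "0 \<le> W x * (1 / e x * norm (h x) powr e x)" using elim by simp
      ultimately show ?case by simp
    qed
  qed measurable
  define Q where "Q n x = W x * (1 / e x * ((norm (g x + t n *\<^sub>R w x) powr e x - norm (g x) powr e x) / t n))" for n x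
  have eq: "((LINT x|M. W x * (1 / e x * norm (g x + t n *\<^sub>R w x) powr e x)) - (LINT x|M. W x * (1 / e x * norm (g x) powr e x))) / t n
     = (LINT x|M. Q n x)" for n
  proof -
    have "(LINT x|M. Q n x) = (LINT x|M. (W x * (1 / e x * norm (g x + t n *\<^sub>R w x) powr e x) - W x * (1 / e x * norm (g x) powr e x)) / t n)"
      by (intro Bochner_Integration.integral_cong) (auto simp: Q_def algebra_simps diff_divide_distrib)
    also have "\<dots> = ((LINT x|M. W x * (1 / e x * norm (g x + t n *\<^sub>R w x) powr e x)) - (LINT x|M. W x * (1 / e x * norm (g x) powr e x))) / t n"
      using ie[OF _ it] ie[OF _ i(1)] by simp
    finally show ?thesis by simp
  qed
  have "(\<lambda>n. LINT x|M. Q n x) \<longlonglongrightarrow> (LINT x|M. W x * (norm (g x) powr (e x - 2) * (g x \<bullet> w x)))"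
  proof (rule integral_dominated_convergence[OF _ _ ib])
    show "Q n \<in> borel_measurable M" for n unfolding Q_def by measurable
    have ft: "filterlim t (at 0) sequentially"
      unfolding filterlim_at using t(1,2) by (simp add: less_imp_neq[symmetric])
    show "AE x in M. (\<lambda>n. Q n x) \<longlonglongrightarrow> W x * (norm (g x) powr (e x - 2) * (g x \<bullet> w x))"
      using e1
    proof eventually_elim
      case (elim x)
      have "((\<lambda>s. (norm (g x + s *\<^sub>R w x) powr e x - norm (g x) powr e x) / s) \<longlongrightarrow> e x * (norm (g x) powr (e x - 2) * (g x \<bullet> w x))) (at 0)"
        using norm_powr_directional_derivative[of "e x" "g x" "w x"] elim by (simp add: has_field_derivative_iff)
      from filterlim_compose[OF this ft]
      have "(\<lambda>n. Q n x) \<longlonglongrightarrow> W x * (1 / e x * (e x * (norm (g x) powr (e x - 2) * (g x \<bullet> w x))))"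
        unfolding Q_def by (intro tendsto_intros)
      then show ?case using elim by simp
    qed
    show "AE x in M. norm (Q n x) \<le> 2 powr E * (W x * norm (g x) powr e x + W x * norm (w x) powr e x)" for n
      using W0 e1 bnd
    proof eventually_elim
      case (elim x)
      have "\<bar>(norm (g x + t n *\<^sub>R w x) powr e x - norm (g x) powr e x) / t n\<bar> \<le> e x * (norm (g x) + norm (w x)) powr (e x - 1) * norm (w x)"
        using elim t(1)[of n] by (intro norm_powr_quotient_bound) auto
      also have "\<dots> \<le> e x * ((norm (g x) + norm (w x)) powr (e x - 1) * (norm (g x) + norm (w x)))"
        using elim by (simp add: mult.assoc mult_left_mono)
      also have "(norm (g x) + norm (w x)) powr (e x - 1) * (norm (g x) + norm (w x)) = (norm (g x) + norm (w x)) powr e x"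
        by (cases "norm (g x) + norm (w x) = 0") (auto simp: powr_diff add_nonneg_eq_0_iff)
      finally have "W x * (1 / e x * \<bar>(norm (g x + t n *\<^sub>R w x) powr e x - norm (g x) powr e x) / t n\<bar>)
          \<le> W x * (1 / e x * (e x * (norm (g x) + norm (w x)) powr e x))"
        using elim by (intro mult_left_mono) auto
      moreover have "norm (Q n x) = W x * (1 / e x * \<bar>(norm (g x + t n *\<^sub>R w x) powr e x - norm (g x) powr e x) / t n\<bar>)"
        unfolding Q_def real_norm_def abs_mult using elim by simp
      ultimately show ?case using elim by simp
    qed
    show "(\<lambda>x. W x * (norm (g x) powr (e x - 2) * (g x \<bullet> w x))) \<in> borel_measurable M" by measurable
  qed
  then show "(\<lambda>n. ((LINT x|M. W x * (1 / e x * norm (g x + t n *\<^sub>R w x) powr e x)) - (LINT x|M. W x * (1 / e x * norm (g x) powr e x))) / t n)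
     \<longlonglongrightarrow> (LINT x|M. W x * (norm (g x) powr (e x - 2) * (g x \<bullet> w x)))"
    unfolding eq .
qed

end

context exponent_domain
begin

lemma sobolev_H10:
  fixes r :: "'a \<Rightarrow> real"
  assumes r: "continuous_on (closure Om) r" "\<And>x. x \<in> closure Om \<Longrightarrow> 1 \<le> r x \<and> r x < p_star p x"
    and A: "0 \<le> A"
  obtains C where "0 \<le> C" "\<And>u g. H10 u g \<Longrightarrow> (LINT x|\<Omega>. norm (g x) powr p x) \<le> A \<Longrightarrow>
     integrable \<Omega> (\<lambda>x. \<bar>u x\<bar> powr r x) \<and> (LINT x|\<Omega>. \<bar>u x\<bar> powr r x) \<le> C"
proof -
  \<comment> \<open>The enlarged bound holds for the gradients of all late approximants, so that the
    inequality for test functions applies to them before Fatou's lemma is used.\<close>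
  define A' where "A' = 2 powr p_bound * (1 + A)"
  have "0 \<le> A'" using A by (simp add: A'_def)
  from sobolev_modular[OF r this] obtain C where C: "0 \<le> C" "\<And>f. test_fun Om f \<Longrightarrow>
     (\<integral>\<^sup>+ x. ennreal (norm (grad f x) powr p x) \<partial>\<Omega>) \<le> ennreal A' \<Longrightarrow>
     (\<integral>\<^sup>+ x. ennreal (\<bar>f x\<bar> powr r x) \<partial>\<Omega>) \<le> ennreal C" by blast
  obtain R where R: "\<And>x. x \<in> closure Om \<Longrightarrow> r x \<le> R" using exponent_max[OF r(1)] by metis
  have rR: "0 \<le> r x \<and> r x \<le> R" if "x \<in> Om" for x
    using r(2)[OF mem_closure_Om[OF that]] R[OF mem_closure_Om[OF that]] by simp
  note rm [measurable] = exponent_measurable[OF r(1)]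
  have "integrable \<Omega> (\<lambda>x. \<bar>u x\<bar> powr r x) \<and> (LINT x|\<Omega>. \<bar>u x\<bar> powr r x) \<le> C"
    if H: "H10 u g" and gA: "(LINT x|\<Omega>. norm (g x) powr p x) \<le> A" for u g
  proof -
    obtain f where f: "\<And>n. test_fun Om (f n)" "mconv (\<lambda>n. grad (f n)) g" "AE x in \<Omega>. (\<lambda>n. f n x) \<longlonglongrightarrow> u x"
      and m [measurable]: "u \<in> borel_measurable \<Omega>" "g \<in> borel_measurable \<Omega>"
      using H by (auto simp: H10_def approximates_def)
    note fm [measurable] = test_fun_measurable[OF f(1)]
    have lim: "(\<lambda>n. LINT x|\<Omega>. norm (grad (f n) x - g x) powr p x) \<longlonglongrightarrow> 0"
      and id: "\<And>n. integrable \<Omega> (\<lambda>x. norm (grad (f n) x - g x) powr p x)" using f(2) by (auto simp: mconv_def)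
    have le: "\<forall>\<^sub>F n in sequentially. (LINT x|\<Omega>. \<bar>f n x\<bar> powr r x) \<le> C"
      using order_tendstoD(2)[OF lim zero_less_one]
    proof eventually_elim
      case (elim n)
      have "(LINT x|\<Omega>. norm ((grad (f n) x - g x) + g x) powr p x) \<le> 2 powr p_bound * ((LINT x|\<Omega>. norm (grad (f n) x - g x) powr p x) + (LINT x|\<Omega>. norm (g x) powr p x))"
        by (rule integrable_powr_add(2)[OF p_measurable p_range]) (use H10_integrable[OF H] id in simp_all)
      also have "\<dots> \<le> A'" unfolding A'_def using elim gA by (intro mult_left_mono) auto
      finally have "(\<integral>\<^sup>+ x. ennreal (norm (grad (f n) x) powr p x) \<partial>\<Omega>) \<le> ennreal A'"
        using integrable_test_powr(2)[OF f(1) p_measurable p_range] by (simp add: nn_integral_eq_integral ennreal_leI)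
      from C(2)[OF f(1) this] show ?case
        using integrable_test_powr(1)[OF f(1) rm rR] C(1) by (simp add: nn_integral_eq_integral)
    qed
    have "AE x in \<Omega>. (\<lambda>n. \<bar>f n x\<bar> powr r x) \<longlonglongrightarrow> \<bar>u x\<bar> powr r x"
      using f(3) AE_space
    proof eventually_elim
      case (elim x)
      then have "0 < r x" using r(2)[OF mem_closure_Om[of x]] by simp
      with elim show ?case by (intro tendsto_powr' tendsto_rabs tendsto_const) auto
    qed
    from integrable_fatou[OF integrable_test_powr(1)[OF f(1) rm rR] _ this _ le] show ?thesis by simp
  qed
  with C(1) that show thesis by blast
qed

text \<open>Vitali's theorem with a multiple of the power of \<open>w\<close> as majorant and the
  power of \<open>v n - w\<close> as remainder. The bounded coefficient \<open>c\<close> admits the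
  factor \<open>1 / p\<close>.\<close>

lemma modular_functional_tendsto:
  fixes v :: "nat \<Rightarrow> 'a \<Rightarrow> 'b::euclidean_space"
  assumes m [measurable]: "\<And>n. v n \<in> borel_measurable \<Omega>" "w \<in> borel_measurable \<Omega>"
    and c [measurable]: "c \<in> borel_measurable \<Omega>" and c1: "AE x in \<Omega>. \<bar>c x\<bar> \<le> 1"
    and v: "mconv v w" "AE x in \<Omega>. (\<lambda>n. v n x) \<longlonglongrightarrow> w x"
    and iw: "integrable \<Omega> (\<lambda>x. norm (w x) powr p x)"
  shows "(\<lambda>n. LINT x|\<Omega>. c x * norm (v n x) powr p x) \<longlonglongrightarrow> (LINT x|\<Omega>. c x * norm (w x) powr p x)"
proof -
  define X where "X n x = \<bar>norm (v n x) powr p x - norm (w x) powr p x\<bar>" for n x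
  have Xm [measurable]: "X n \<in> borel_measurable \<Omega>" for n unfolding X_def by measurable
  have id: "\<And>n. integrable \<Omega> (\<lambda>x. norm (v n x - w x) powr p x)"
    and lim: "(\<lambda>n. LINT x|\<Omega>. norm (v n x - w x) powr p x) \<longlonglongrightarrow> 0" using v(1) by (auto simp: mconv_def)
  have iv: "integrable \<Omega> (\<lambda>x. norm (v n x) powr p x)" for n
  proof -
    have "integrable \<Omega> (\<lambda>x. norm ((v n x - w x) + w x) powr p x)"
      by (rule integrable_powr_add(1)[OF p_measurable p_range]) (use iw id in simp_all)
    then show ?thesis by simp
  qed
  have nn: "AE x in \<Omega>. 0 \<le> X n x" for n by (simp add: X_def)
  have l: "AE x in \<Omega>. (\<lambda>n. X n x) \<longlonglongrightarrow> 0" using v(2) AE_p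
  proof eventually_elim
    case (elim x)
    have "(\<lambda>n. norm (v n x) powr p x) \<longlonglongrightarrow> norm (w x) powr p x"
      using elim by (intro tendsto_powr' tendsto_norm tendsto_const) auto
    then show ?case unfolding X_def by (intro tendsto_rabs_zero LIM_zero)
  qed
  have dom: "\<exists>W' Y. integrable \<Omega> W' \<and> (\<forall>n. integrable \<Omega> (Y n)) \<and>
     (\<forall>n. AE x in \<Omega>. X n x \<le> W' x + Y n x \<and> 0 \<le> Y n x) \<and> (\<forall>\<^sub>F n in sequentially. (LINT x|\<Omega>. Y n x) \<le> d)" if d: "0 < d" for d
  proof (intro exI conjI allI)
    show "integrable \<Omega> (\<lambda>x. (2 powr p_bound + 1) * norm (w x) powr p x)" using iw by simp
    show "integrable \<Omega> (\<lambda>x. 2 powr p_bound * norm (v n x - w x) powr p x)" for n using id by simp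
    have "(\<lambda>n. LINT x|\<Omega>. 2 powr p_bound * norm (v n x - w x) powr p x) \<longlonglongrightarrow> 0"
      using tendsto_mult_right_zero[OF lim] by simp
    from order_tendstoD(2)[OF this d] show "\<forall>\<^sub>F n in sequentially. (LINT x|\<Omega>. 2 powr p_bound * norm (v n x - w x) powr p x) \<le> d"
      by eventually_elim simp
    show "AE x in \<Omega>. X n x \<le> (2 powr p_bound + 1) * norm (w x) powr p x + 2 powr p_bound * norm (v n x - w x) powr p x \<and> 0 \<le> 2 powr p_bound * norm (v n x - w x) powr p x" for n
      using AE_p
    proof eventually_elim
      case (elim x)
      have "X n x \<le> norm (v n x) powr p x + norm (w x) powr p x" by (simp add: X_def abs_le_iff)
      also have "norm (v n x) powr p x \<le> 2 powr p_bound * (norm (v n x - w x) powr p x + norm (w x) powr p x)"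
        using norm_add_powr_le[of "p x" p_bound "v n x - w x" "w x"] elim by simp
      finally show ?case by (simp add: algebra_simps)
    qed
  qed
  note X = vitali_convergence[OF Xm nn l dom]
  have ic: "integrable \<Omega> (\<lambda>x. c x * z x)" if "integrable \<Omega> z" for z
  proof (rule Bochner_Integration.integrable_bound[OF that])
    have [measurable]: "z \<in> borel_measurable \<Omega>" using that by auto
    show "(\<lambda>x. c x * z x) \<in> borel_measurable \<Omega>" by measurable
    show "AE x in \<Omega>. norm (c x * z x) \<le> norm (z x)"
      using c1 by eventually_elim (simp add: abs_mult mult_left_le_one_le)
  qed
  have "norm ((LINT x|\<Omega>. c x * norm (v n x) powr p x) - (LINT x|\<Omega>. c x * norm (w x) powr p x)) \<le> (LINT x|\<Omega>. X n x)" for n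
  proof -
    have "(LINT x|\<Omega>. c x * norm (v n x) powr p x) - (LINT x|\<Omega>. c x * norm (w x) powr p x)
        = (LINT x|\<Omega>. c x * norm (v n x) powr p x - c x * norm (w x) powr p x)"
      using ic[OF iv] ic[OF iw] by simp
    also have "norm \<dots> \<le> (LINT x|\<Omega>. norm (c x * norm (v n x) powr p x - c x * norm (w x) powr p x))"
      by (rule integral_norm_bound)
    also have "\<dots> \<le> (LINT x|\<Omega>. X n x)"
    proof (rule integral_mono_AE)
      show "integrable \<Omega> (\<lambda>x. norm (c x * norm (v n x) powr p x - c x * norm (w x) powr p x))"
        using ic[OF iv] ic[OF iw] by auto
      show "AE x in \<Omega>. norm (c x * norm (v n x) powr p x - c x * norm (w x) powr p x) \<le> X n x"
        using c1 by eventually_elim (simp add: X_def right_diff_distrib[symmetric] abs_mult mult_left_le_one_le)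
    qed (rule X(1))
    finally show ?thesis .
  qed
  then have "(\<lambda>n. (LINT x|\<Omega>. c x * norm (v n x) powr p x) - (LINT x|\<Omega>. c x * norm (w x) powr p x)) \<longlonglongrightarrow> 0"
    by (intro Lim_null_comparison[OF always_eventually X(2)]) simp
  then show ?thesis by (simp add: LIM_zero_iff)
qed

end

context exponent_domain
begin

text \<open>Needed for \<open>wgrad\<close>, which is compared with a measurable function only
  almost everywhere; completeness transfers the measurability.\<close>

lemma complete_measure_Om: "complete_measure \<Omega>"
proof
  fix A B assume "B \<subseteq> A" "A \<in> null_sets \<Omega>"
  then have "A \<subseteq> Om" "A \<in> null_sets lebesgue" using open_Om by (auto simp: null_sets_restrict_space)
  then have "B \<in> sets lebesgue" "B \<subseteq> Om" using \<open>B \<subseteq> A\<close> completion.complete by blast+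
  then show "B \<in> sets \<Omega>" using open_Om by (subst sets_restrict_space_iff) auto
qed

lemma measurable_AE_cong:
  fixes f g :: "'a \<Rightarrow> 'b::euclidean_space"
  assumes ae: "AE x in \<Omega>. f x = g x" and g: "g \<in> borel_measurable \<Omega>"
  shows "f \<in> borel_measurable \<Omega>"
proof (rule measurableI)
  interpret complete_measure \<Omega> by (rule complete_measure_Om)
  fix S :: "'b set" assume S: "S \<in> sets borel"
  show "f -` S \<inter> space \<Omega> \<in> sets \<Omega>"
  proof (rule in_sets_AE)
    show "g -` S \<inter> space \<Omega> \<in> sets \<Omega>" using g S by (rule measurable_sets)
    show "AE x in \<Omega>. x \<in> g -` S \<inter> space \<Omega> \<longleftrightarrow> x \<in> f -` S \<inter> space \<Omega>" using ae by eventually_elim auto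
  qed auto
qed simp

lemma approximates_bound:
  assumes a: "approximates f u g" and m [measurable]: "g \<in> borel_measurable \<Omega>"
    and ig: "integrable \<Omega> (\<lambda>x. norm (g x) powr p x)"
  obtains A where "0 \<le> A" "\<And>n. (LINT x|\<Omega>. norm (grad (f n) x) powr p x) \<le> A" "(LINT x|\<Omega>. norm (g x) powr p x) \<le> A"
proof -
  have f: "\<And>n. test_fun Om (f n)" and id: "\<And>n. integrable \<Omega> (\<lambda>x. norm (grad (f n) x - g x) powr p x)"
    and lim: "(\<lambda>n. LINT x|\<Omega>. norm (grad (f n) x - g x) powr p x) \<longlonglongrightarrow> 0"
    using a by (auto simp: approximates_def mconv_def)
  note fm [measurable] = test_fun_measurable[OF f]
  obtain B where B: "\<And>n. norm (LINT x|\<Omega>. norm (grad (f n) x - g x) powr p x) \<le> B"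
    using convergent_imp_Bseq[OF convergentI[OF lim]] by (auto simp: Bseq_def)
  define G where "G = (LINT x|\<Omega>. norm (g x) powr p x)"
  have G: "0 \<le> G" by (simp add: G_def)
  have B0: "0 \<le> B" using order_trans[OF norm_ge_zero B[of 0]] .
  have one: "1 \<le> 2 powr p_bound" using p_bound by (intro ge_one_powr_ge_zero) auto
  show thesis
  proof (rule that[of "2 powr p_bound * (B + G)"])
    show "(LINT x|\<Omega>. norm (grad (f n) x) powr p x) \<le> 2 powr p_bound * (B + G)" for n
    proof -
      have "(LINT x|\<Omega>. norm ((grad (f n) x - g x) + g x) powr p x) \<le> 2 powr p_bound * ((LINT x|\<Omega>. norm (grad (f n) x - g x) powr p x) + (LINT x|\<Omega>. norm (g x) powr p x))"
        by (rule integrable_powr_add(2)[OF p_measurable p_range]) (use ig id in simp_all)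
      also have "\<dots> \<le> 2 powr p_bound * (B + G)"
        using B[of n] by (intro mult_left_mono add_mono) (auto simp: G_def)
      finally show ?thesis by simp
    qed
    have "G \<le> 1 * (B + G)" using B0 by simp
    also have "\<dots> \<le> 2 powr p_bound * (B + G)" using one B0 G by (intro mult_right_mono) auto
    finally show "(LINT x|\<Omega>. norm (g x) powr p x) \<le> 2 powr p_bound * (B + G)" by (simp add: G_def)
  qed (use B0 G in simp)
qed

lemma approximates_H10:
  "approximates f u g \<Longrightarrow> u \<in> borel_measurable \<Omega> \<Longrightarrow> g \<in> borel_measurable \<Omega> \<Longrightarrow> H10 u g"
  by (auto simp: H10_def)

lemma approximates_add_test:
  assumes a: "approximates f u g" and v: "test_fun Om v"
  shows "approximates (\<lambda>n x. f n x + t * v x) (\<lambda>x. u x + t * v x) (\<lambda>x. g x + t *\<^sub>R grad v x)"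
proof -
  have f: "\<And>n. test_fun Om (f n)" using a by (auto simp: approximates_def)
  have tv: "test_fun Om (\<lambda>x. t * v x)" using v by (rule test_fun_scale)
  have gr: "grad (\<lambda>x. f n x + t * v x) = (\<lambda>x. grad (f n) x + t *\<^sub>R grad v x)" for n
    using grad_add[OF test_fun_smooth[OF f] test_fun_smooth[OF tv]] grad_scale[OF test_fun_smooth[OF v]] by (simp add: fun_eq_iff)
  show ?thesis unfolding approximates_def gr
  proof (intro conjI allI)
    show "test_fun Om (\<lambda>x. f n x + t * v x)" for n using f tv by (rule test_fun_add)
    show "mconv (\<lambda>n x. f n x + t * v x) (\<lambda>x. u x + t * v x)"
      "mconv (\<lambda>n x. grad (f n) x + t *\<^sub>R grad v x) (\<lambda>x. g x + t *\<^sub>R grad v x)"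
      using a by (auto simp: approximates_def mconv_def)
    have "AE x in \<Omega>. (\<lambda>n. f n x) \<longlonglongrightarrow> u x" using a by (simp add: approximates_def)
    then show "AE x in \<Omega>. (\<lambda>n. f n x + t * v x) \<longlonglongrightarrow> u x + t * v x"
      by eventually_elim (intro tendsto_intros)
    have "AE x in \<Omega>. (\<lambda>n. grad (f n) x) \<longlonglongrightarrow> g x" using a by (simp add: approximates_def)
    then show "AE x in \<Omega>. (\<lambda>n. grad (f n) x + t *\<^sub>R grad v x) \<longlonglongrightarrow> g x + t *\<^sub>R grad v x"
      by eventually_elim (intro tendsto_intros)
  qed
qed

section \<open>The gradient functional and its convexity\<close>

text \<open>\<open>G_fun\<close> as a function of the gradient instead of the function, in keeping
  with the pairs of \<open>H10\<close>.\<close>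

definition G :: "('a \<Rightarrow> 'a) \<Rightarrow> real" where
  "G g = (LINT x|\<Omega>. 1 / p x * norm (g x) powr p x)"

lemma G_integrable:
  assumes "integrable \<Omega> (\<lambda>x. norm (g x) powr p x)"
  shows "integrable \<Omega> (\<lambda>x. 1 / p x * norm (g x) powr p x)"
proof (rule Bochner_Integration.integrable_bound[OF assms])
  have [measurable]: "(\<lambda>x. norm (g x) powr p x) \<in> borel_measurable \<Omega>" using assms by auto
  show "(\<lambda>x. 1 / p x * norm (g x) powr p x) \<in> borel_measurable \<Omega>" by measurable
  show "AE x in \<Omega>. norm (1 / p x * norm (g x) powr p x) \<le> norm (norm (g x) powr p x)"
    using AE_p
  proof eventually_elim
    case (elim x)
    then show ?case using mult_left_mono[of 1 "p x" "norm (g x) powr p x"]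
      by (simp add: abs_mult divide_le_eq)
  qed
qed

lemma G_nonneg: "0 \<le> G g"
  unfolding G_def using AE_p by (intro integral_nonneg_AE) (auto elim!: eventually_mono)

lemma modular_le_G:
  assumes "integrable \<Omega> (\<lambda>x. norm (g x) powr p x)"
  shows "(LINT x|\<Omega>. norm (g x) powr p x) \<le> p_bound * G g"
proof -
  have "(LINT x|\<Omega>. norm (g x) powr p x) \<le> (LINT x|\<Omega>. p_bound * (1 / p x * norm (g x) powr p x))"
  proof (rule integral_mono_AE)
    show "AE x in \<Omega>. norm (g x) powr p x \<le> p_bound * (1 / p x * norm (g x) powr p x)" using AE_p
    proof eventually_elim
      case (elim x)
      have "1 * norm (g x) powr p x \<le> (p_bound / p x) * norm (g x) powr p x" using elim by (intro mult_right_mono) auto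
      then show ?case by simp
    qed
  qed (rule assms integrable_mult_right[OF G_integrable[OF assms]])+
  also have "\<dots> = p_bound * G g" unfolding G_def by (rule Bochner_Integration.integral_mult_right_zero)
  finally show ?thesis .
qed

lemma G_test_integrable: "test_fun Om f \<Longrightarrow> integrable \<Omega> (\<lambda>x. norm (grad f x) powr p x)"
  by (rule integrable_test_powr(2)[OF _ p_measurable p_range])

lemma approximates_G:
  assumes a: "approximates f u g" and m: "g \<in> borel_measurable \<Omega>" and ig: "integrable \<Omega> (\<lambda>x. norm (g x) powr p x)"
  shows "(\<lambda>n. G (grad (f n))) \<longlonglongrightarrow> G g"
  unfolding G_def
proof (rule modular_functional_tendsto)
  show "grad (f n) \<in> borel_measurable \<Omega>" for n using a test_fun_measurable(2) by (auto simp: approximates_def)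
  show "AE x in \<Omega>. \<bar>1 / p x\<bar> \<le> 1" using AE_p by eventually_elim auto
qed (use a m ig in \<open>auto simp: approximates_def\<close>)

text \<open>The pointwise convexity estimate is integrated; \<open>p_bound\<close> turns the deficit
  without weight into the one with weight \<open>1 / p\<close> that occurs in
  \<open>G\<close>.\<close>

lemma G_midpoint_deficit:
  assumes f: "test_fun Om f" "test_fun Om h" and A: "(LINT x|\<Omega>. norm (grad f x) powr p x) \<le> A" "(LINT x|\<Omega>. norm (grad h x) powr p x) \<le> A"
    and K: "0 \<le> K" "\<And>a (b::'a) r. l \<le> r \<Longrightarrow> r \<le> p_bound \<Longrightarrow> norm (a - b) powr r \<le> \<eta> * (norm a powr r + norm b powr r)
      + K * ((norm a powr r + norm b powr r) / 2 - norm ((1/2) *\<^sub>R (a + b)) powr r)"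
    and l: "\<And>x. x \<in> closure Om \<Longrightarrow> l \<le> p x" and \<eta>: "0 \<le> \<eta>"
  shows "(LINT x|\<Omega>. norm (grad f x - grad h x) powr p x) \<le> 2 * \<eta> * A
     + K * p_bound * ((G (grad f) + G (grad h)) / 2 - G (grad (\<lambda>x. 1/2 * (f x + h x))))"
proof -
  let ?m = "\<lambda>x. (1/2) *\<^sub>R (grad f x + grad h x)"
  have gm: "grad (\<lambda>x. 1/2 * (f x + h x)) = ?m"
    using grad_scale[OF test_fun_smooth[OF test_fun_add[OF f]], of "1/2"] grad_add[OF test_fun_smooth[OF f(1)] test_fun_smooth[OF f(2)]]
    by (simp add: fun_eq_iff)
  have im: "integrable \<Omega> (\<lambda>x. norm (?m x) powr p x)"
    using G_test_integrable[OF test_fun_scale[OF test_fun_add[OF f], of "1/2"]] unfolding gm .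
  note i = G_test_integrable[OF f(1)] G_test_integrable[OF f(2)]
  note iG = G_integrable[OF i(1)] G_integrable[OF i(2)] G_integrable[OF im]
  define D where "D x = 1 / p x * ((norm (grad f x) powr p x + norm (grad h x) powr p x) / 2 - norm (?m x) powr p x)" for x
  have Deq: "D = (\<lambda>x. (1 / p x * norm (grad f x) powr p x + 1 / p x * norm (grad h x) powr p x) / 2 - 1 / p x * norm (?m x) powr p x)"
    by (auto simp: D_def fun_eq_iff algebra_simps add_divide_distrib)
  have iD: "integrable \<Omega> D" unfolding Deq using iG by simp
  have "(LINT x|\<Omega>. D x) = (G (grad f) + G (grad h)) / 2 - G ?m"
    unfolding Deq G_def using iG by simp
  note iDeq = this
  have "(LINT x|\<Omega>. norm (grad f x - grad h x) powr p x)
     \<le> (LINT x|\<Omega>. \<eta> * (norm (grad f x) powr p x + norm (grad h x) powr p x) + K * p_bound * D x)"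
  proof (rule integral_mono_AE)
    show "integrable \<Omega> (\<lambda>x. norm (grad f x - grad h x) powr p x)"
      by (rule integrable_powr_diff(1)[OF p_measurable p_range]) (use i test_fun_measurable[OF f(1)] test_fun_measurable[OF f(2)] in auto)
    show "integrable \<Omega> (\<lambda>x. \<eta> * (norm (grad f x) powr p x + norm (grad h x) powr p x) + K * p_bound * D x)" using i iD by simp
    show "AE x in \<Omega>. norm (grad f x - grad h x) powr p x \<le> \<eta> * (norm (grad f x) powr p x + norm (grad h x) powr p x) + K * p_bound * D x"
      using AE_p AE_space
    proof eventually_elim
      case (elim x)
      define d where "d = (norm (grad f x) powr p x + norm (grad h x) powr p x) / 2 - norm (?m x) powr p x"
      have d0: "0 \<le> d" using norm_midpoint_powr_le[of "p x" "grad f x" "grad h x"] elim by (simp add: d_def)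
      have "norm (grad f x - grad h x) powr p x \<le> \<eta> * (norm (grad f x) powr p x + norm (grad h x) powr p x) + K * d"
        unfolding d_def using elim l[OF mem_closure_Om] by (intro K) auto
      also have "K * d \<le> K * p_bound * D x"
      proof -
        have "1 * d \<le> (p_bound / p x) * d" using elim d0 by (intro mult_right_mono) auto
        then have "d \<le> p_bound * D x" by (simp add: D_def d_def)
        then show ?thesis using K(1) by (simp add: mult.assoc mult_left_mono)
      qed
      finally show ?case by simp
    qed
  qed
  also have "\<dots> = \<eta> * ((LINT x|\<Omega>. norm (grad f x) powr p x) + (LINT x|\<Omega>. norm (grad h x) powr p x)) + K * p_bound * (LINT x|\<Omega>. D x)"
    using i iD by simp
  also have "\<dots> \<le> \<eta> * (A + A) + K * p_bound * (LINT x|\<Omega>. D x)"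
    using A \<eta> by (intro add_right_mono mult_left_mono add_mono) auto
  finally show ?thesis unfolding iDeq gm by simp
qed

lemma G_midpoint_le:
  assumes f: "test_fun Om f" "test_fun Om h"
  shows "G (grad (\<lambda>x. 1/2 * (f x + h x))) \<le> (G (grad f) + G (grad h)) / 2"
proof -
  let ?m = "\<lambda>x. (1/2) *\<^sub>R (grad f x + grad h x)"
  have gm: "grad (\<lambda>x. 1/2 * (f x + h x)) = ?m"
    using grad_scale[OF test_fun_smooth[OF test_fun_add[OF f]], of "1/2"] grad_add[OF test_fun_smooth[OF f(1)] test_fun_smooth[OF f(2)]]
    by (simp add: fun_eq_iff)
  have im: "integrable \<Omega> (\<lambda>x. norm (?m x) powr p x)"
    using G_test_integrable[OF test_fun_scale[OF test_fun_add[OF f], of "1/2"]] unfolding gm .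
  note iG = G_integrable[OF G_test_integrable[OF f(1)]] G_integrable[OF G_test_integrable[OF f(2)]] G_integrable[OF im]
  have "G ?m \<le> (LINT x|\<Omega>. (1 / p x * norm (grad f x) powr p x + 1 / p x * norm (grad h x) powr p x) / 2)"
    unfolding G_def
  proof (rule integral_mono_AE)
    show "AE x in \<Omega>. 1 / p x * norm (?m x) powr p x \<le> (1 / p x * norm (grad f x) powr p x + 1 / p x * norm (grad h x) powr p x) / 2"
      using AE_p
    proof eventually_elim
      case (elim x)
      then have "1 / p x * norm (?m x) powr p x \<le> 1 / p x * ((norm (grad f x) powr p x + norm (grad h x) powr p x) / 2)"
        by (intro mult_left_mono norm_midpoint_powr_le) auto
      then show ?case by (simp add: algebra_simps add_divide_distrib)
    qed
  qed (use iG in simp_all)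
  also have "\<dots> = (G (grad f) + G (grad h)) / 2" unfolding G_def using iG by simp
  finally show ?thesis unfolding gm .
qed

section \<open>Compactness for bounded gradients\<close>

text \<open>The Sobolev inequality with the slightly larger exponent \<open>p + \<kappa>\<close>
  makes the powers with exponent \<open>p\<close> equi-integrable, so almost everywhere convergence
  improves to modular convergence.\<close>

lemma mconv_of_AE_bounded:
  assumes f: "\<And>n. test_fun Om (f n)" and m [measurable]: "u \<in> borel_measurable \<Omega>"
    and ae: "AE x in \<Omega>. (\<lambda>n. f n x) \<longlonglongrightarrow> u x"
    and A: "0 \<le> A" "\<And>n. (LINT x|\<Omega>. norm (grad (f n) x) powr p x) \<le> A"
  shows "mconv f u"
proof -
  interpret finite_measure \<Omega> by (rule finite_measure_Om)
  note fm [measurable] = test_fun_measurable[OF f]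
  have cps: "continuous_on (closure Om) (\<lambda>x. p_star p x - p x)"
    unfolding p_star_def by (intro continuous_intros cont_p) (use p_bounds in force)
  have "0 < p_star p x - p x" if "x \<in> closure Om" for x
  proof -
    have "p x * (real DIM('a) - p x) < real DIM('a) * p x" using p_bounds[OF that] by (simp add: algebra_simps)
    then show ?thesis using p_bounds[OF that] by (simp add: p_star_def pos_less_divide_eq)
  qed
  from exponent_lower[OF cps this] obtain d where d: "0 < d" "\<And>x. x \<in> closure Om \<Longrightarrow> 0 + d \<le> p_star p x - p x" by blast
  \<comment> \<open>Half of the gap between \<open>p\<close> and \<open>p_star p\<close> keeps
    \<open>p + \<kappa>\<close> strictly subcritical.\<close>
  define \<kappa> where "\<kappa> = d / 2"
  have \<kappa>: "0 < \<kappa>" using d by (simp add: \<kappa>_def)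
  define r where "r x = p x + \<kappa>" for x
  have cr: "continuous_on (closure Om) r" unfolding r_def by (intro continuous_intros cont_p)
  have rb: "1 \<le> r x \<and> r x < p_star p x" if "x \<in> closure Om" for x
    using p_bounds[OF that] d(2)[OF that] d(1) by (auto simp: r_def \<kappa>_def)
  have rR: "0 \<le> r x \<and> r x \<le> p_bound + \<kappa>" if "x \<in> Om" for x using p_Om[OF that] \<kappa> by (simp add: r_def)
  note rm [measurable] = exponent_measurable[OF cr]
  obtain C where C: "0 \<le> C" "\<And>u g. H10 u g \<Longrightarrow> (LINT x|\<Omega>. norm (g x) powr p x) \<le> A \<Longrightarrow>
     integrable \<Omega> (\<lambda>x. \<bar>u x\<bar> powr r x) \<and> (LINT x|\<Omega>. \<bar>u x\<bar> powr r x) \<le> C"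
    using sobolev_H10[OF cr rb A(1)] by metis
  have fr: "integrable \<Omega> (\<lambda>x. \<bar>f n x\<bar> powr r x)" "(LINT x|\<Omega>. \<bar>f n x\<bar> powr r x) \<le> C" for n
    using C(2)[OF H10_test[OF f] A(2)] by auto
  have lr: "AE x in \<Omega>. (\<lambda>n. \<bar>f n x\<bar> powr r x) \<longlonglongrightarrow> \<bar>u x\<bar> powr r x"
    using ae AE_p
  proof eventually_elim
    case (elim x)
    then show ?case using \<kappa> by (intro tendsto_powr' tendsto_rabs tendsto_const) (auto simp: r_def)
  qed
  have ur: "integrable \<Omega> (\<lambda>x. \<bar>u x\<bar> powr r x)" "(LINT x|\<Omega>. \<bar>u x\<bar> powr r x) \<le> C"
    using integrable_fatou[OF fr(1) _ lr _ always_eventually, of C] fr(2) by auto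
  define C' where "C' = 2 powr (p_bound + \<kappa>) * (C + C) + 1"
  have dr: "integrable \<Omega> (\<lambda>x. norm (f n x - u x) powr r x)" "(LINT x|\<Omega>. norm (f n x - u x) powr r x) \<le> C'" for n
  proof -
    show "integrable \<Omega> (\<lambda>x. norm (f n x - u x) powr r x)"
      by (rule integrable_powr_diff(1)[OF rm rR]) (use fr ur in simp_all)
    have "(LINT x|\<Omega>. norm (f n x - u x) powr r x) \<le> 2 powr (p_bound + \<kappa>) * ((LINT x|\<Omega>. norm (f n x) powr r x) + (LINT x|\<Omega>. norm (u x) powr r x))"
      by (rule integrable_powr_diff(2)[OF rm rR]) (use fr ur in simp_all)
    also have "\<dots> \<le> 2 powr (p_bound + \<kappa>) * (C + C)" using fr(2)[of n] ur(2) by (intro mult_left_mono add_mono) auto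
    finally show "(LINT x|\<Omega>. norm (f n x - u x) powr r x) \<le> C'" by (simp add: C'_def)
  qed
  have C': "0 < C'" using C(1) by (simp add: C'_def add_nonneg_pos)
  define X where "X n x = norm (f n x - u x) powr p x" for n x
  have Xm: "X n \<in> borel_measurable \<Omega>" for n unfolding X_def by measurable
  have nn: "AE x in \<Omega>. 0 \<le> X n x" for n by (simp add: X_def)
  have lX: "AE x in \<Omega>. (\<lambda>n. X n x) \<longlonglongrightarrow> 0" using ae AE_p
  proof eventually_elim
    case (elim x)
    have "(\<lambda>n. norm (f n x - u x) powr p x) \<longlonglongrightarrow> norm (u x - u x) powr p x"
      using elim by (intro tendsto_powr' tendsto_norm tendsto_diff tendsto_const) auto
    then show ?case using elim by (simp add: X_def)
  qed
  have dom: "\<exists>W' Y. integrable \<Omega> W' \<and> (\<forall>n. integrable \<Omega> (Y n)) \<and>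
     (\<forall>n. AE x in \<Omega>. X n x \<le> W' x + Y n x \<and> 0 \<le> Y n x) \<and> (\<forall>\<^sub>F n in sequentially. (LINT x|\<Omega>. Y n x) \<le> e)" if e: "0 < e" for e
  proof -
    define \<delta> where "\<delta> = e / C'"
    have \<delta>: "0 < \<delta>" using e C' by (simp add: \<delta>_def)
    \<comment> \<open>Beyond this level \<open>\<delta> * t powr \<kappa> \<ge> 1\<close>, so the
      higher power takes over.\<close>
    define L where "L = max 1 ((1 / \<delta>) powr (1 / \<kappa>))"
    have pw: "t powr a \<le> L powr p_bound + \<delta> * t powr (a + \<kappa>)" if "0 \<le> t" "1 < a" "a \<le> p_bound" for t a :: real
    proof (cases "t \<le> L")
      case True
      have "t powr a \<le> L powr a" using True that by (intro powr_mono2) auto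
      also have "\<dots> \<le> L powr p_bound" using that by (intro powr_mono) (auto simp: L_def)
      finally show ?thesis using \<delta> by (simp add: add_increasing2)
    next
      case False
      then have t: "(1 / \<delta>) powr (1 / \<kappa>) \<le> t" "0 < t" by (auto simp: L_def)
      have "((1 / \<delta>) powr (1 / \<kappa>)) powr \<kappa> \<le> t powr \<kappa>" using t \<kappa> by (intro powr_mono2) auto
      then have "1 \<le> \<delta> * t powr \<kappa>" using \<kappa> \<delta> by (simp add: powr_powr field_simps)
      then have "1 * t powr a \<le> (\<delta> * t powr \<kappa>) * t powr a" by (intro mult_right_mono) auto
      then show ?thesis by (simp add: powr_add mult_ac add_increasing)
    qed
    show ?thesis
    proof (intro exI conjI allI)
      show "integrable \<Omega> (\<lambda>x. L powr p_bound)" by simp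
      show "integrable \<Omega> (\<lambda>x. \<delta> * norm (f n x - u x) powr r x)" for n using dr by simp
      show "AE x in \<Omega>. X n x \<le> L powr p_bound + \<delta> * norm (f n x - u x) powr r x \<and> 0 \<le> \<delta> * norm (f n x - u x) powr r x" for n
        using AE_p
      proof eventually_elim
        case (elim x)
        then show ?case using pw[of "norm (f n x - u x)" "p x"] \<delta> by (simp add: X_def r_def)
      qed
      have "(LINT x|\<Omega>. \<delta> * norm (f n x - u x) powr r x) \<le> e" for n
      proof -
        have "(LINT x|\<Omega>. \<delta> * norm (f n x - u x) powr r x) = \<delta> * (LINT x|\<Omega>. norm (f n x - u x) powr r x)" by simp
        also have "\<dots> \<le> \<delta> * C'" using dr(2)[of n] \<delta> by (intro mult_left_mono) auto
        finally show ?thesis using C' by (simp add: \<delta>_def)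
      qed
      then show "\<forall>\<^sub>F n in sequentially. (LINT x|\<Omega>. \<delta> * norm (f n x - u x) powr r x) \<le> e" by simp
    qed
  qed
  from vitali_convergence[OF Xm nn lX dom] show ?thesis unfolding mconv_def by (simp add: X_def)
qed

lemma rellich_AE:
  assumes f: "\<And>n. test_fun Om (f n)" and A: "0 \<le> A" "\<And>n. (LINT x|\<Omega>. norm (grad (f n) x) powr p x) \<le> A"
  obtains k :: "nat \<Rightarrow> nat" and u where "strict_mono k" "u \<in> borel_measurable \<Omega>" "AE x in \<Omega>. (\<lambda>n. f (k n) x) \<longlonglongrightarrow> u x"
proof -
  interpret finite_measure \<Omega> by (rule finite_measure_Om)
  note fm [measurable] = test_fun_measurable[OF f]
  define B where "B = measure \<Omega> (space \<Omega>) + A"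
  have B: "0 \<le> B" using A by (simp add: B_def)
  have fB: "(\<integral>\<^sup>+ x. ennreal (norm (grad (f n) x)) \<partial>lborel) \<le> ennreal B" for n
  proof -
    note i = G_test_integrable[OF f[of n]]
    note ig = integrable_of_powr[OF fm(2) i]
    have "(\<integral>\<^sup>+ x. ennreal (norm (grad (f n) x)) \<partial>lborel) = (\<integral>\<^sup>+ x. ennreal (norm (grad (f n) x)) \<partial>\<Omega>)"
      using test_fun_borel[OF f] test_fun_outside(2)[OF f] open_Om by (intro nn_integral_lebesgue_on_eq_lborel[symmetric]) auto
    also have "\<dots> = ennreal (LINT x|\<Omega>. norm (grad (f n) x))"
      using ig by (intro nn_integral_eq_integral) auto
    also have "\<dots> \<le> ennreal B"
    proof (rule ennreal_leI)
      have "(LINT x|\<Omega>. norm (grad (f n) x)) \<le> (LINT x|\<Omega>. 1 + norm (grad (f n) x) powr p x)"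
      proof (rule integral_mono_AE)
        show "AE x in \<Omega>. norm (grad (f n) x) \<le> 1 + norm (grad (f n) x) powr p x" using AE_p
        proof eventually_elim
          case (elim x)
          then show ?case using powr_mono[of 1 "p x" "norm (grad (f n) x)"]
            by (cases "norm (grad (f n) x) \<le> 1") (auto simp: add_increasing add_increasing2)
        qed
      qed (use ig i in auto)
      also have "\<dots> = measure \<Omega> (space \<Omega>) + (LINT x|\<Omega>. norm (grad (f n) x) powr p x)" using i by simp
      also have "\<dots> \<le> B" using A(2)[of n] by (simp add: B_def)
      finally show "(LINT x|\<Omega>. norm (grad (f n) x)) \<le> B" .
    qed
    finally show ?thesis .
  qed
  obtain k :: "nat \<Rightarrow> nat" where k: "strict_mono k"
    "\<And>e. 0 < e \<Longrightarrow> \<exists>N. \<forall>i\<ge>N. \<forall>j\<ge>N. (LINT x|\<Omega>. norm (f (k i) x - f (k j) x)) < e"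
    by (rule rellich_L1[of f B, OF f B fB]) (rule that)
  obtain l where l: "strict_mono l" "AE x in \<Omega>. Cauchy (\<lambda>i. f (k (l i)) x)"
    using cauchy_L1_AE_cauchy_subseq[of \<Omega> "\<lambda>n. f (k n)", OF integrable_test_fun[OF f] k(2)] .
  show thesis
  proof (rule that)
    show "strict_mono (\<lambda>n. k (l n))" using k(1) l(1) by (auto simp: strict_mono_def)
    show "(\<lambda>x. lim (\<lambda>n. f (k (l n)) x)) \<in> borel_measurable \<Omega>" by measurable
    show "AE x in \<Omega>. (\<lambda>n. f (k (l n)) x) \<longlonglongrightarrow> lim (\<lambda>n. f (k (l n)) x)"
      using l(2) by eventually_elim (simp add: Cauchy_convergent_iff convergent_LIMSEQ_iff)
  qed
qed

end

section \<open>The minimisation problem\<close>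

locale weighted_domain = exponent_domain Om p for Om :: "'a::euclidean_space set" and p +
  fixes q s V :: "'a \<Rightarrow> real"
  assumes cont_q: "continuous_on (closure Om) q" and cont_s: "continuous_on (closure Om) s"
    and q_gt: "\<And>x. x \<in> closure Om \<Longrightarrow> 1 < q x" and s_gt: "\<And>x. x \<in> closure Om \<Longrightarrow> 1 < s x"
    and subcritical: "\<And>x. x \<in> closure Om \<Longrightarrow> s x * q x / (s x - 1) < p_star p x"
    and V_Lvar: "V \<in> Lvar Om s" and V_pos: "AE x in lebesgue_on Om. 0 < V x"
begin

lemma q_measurable [measurable]: "q \<in> borel_measurable \<Omega>" and s_measurable [measurable]: "s \<in> borel_measurable \<Omega>"
  by (rule exponent_measurable[OF cont_q], rule exponent_measurable[OF cont_s])

lemma V_measurable [measurable]: "V \<in> borel_measurable \<Omega>"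
  and V_integrable: "integrable \<Omega> (\<lambda>x. \<bar>V x\<bar> powr s x)"
  using V_Lvar by (auto simp: Lvar_iff[OF s_measurable])

text \<open>This is s'q with s' conjugate to s: integrability of \<open>u\<close> in this exponent
  makes \<open>V * \<bar>u\<bar> powr q\<close> integrable for \<open>V\<close> in the space with
  exponent \<open>s\<close>.\<close>

definition dual_exponent :: "'a \<Rightarrow> real" where "dual_exponent x = s x * q x / (s x - 1)"

lemma cont_dual_exponent: "continuous_on (closure Om) dual_exponent"
  unfolding dual_exponent_def by (intro continuous_intros cont_q cont_s) (use s_gt in force)

lemma dual_exponent_bounds: "x \<in> closure Om \<Longrightarrow> 1 \<le> dual_exponent x \<and> dual_exponent x < p_star p x"
proof -
  assume x: "x \<in> closure Om"
  have "1 * (s x - 1) \<le> q x * s x" using q_gt[OF x] s_gt[OF x] by (intro mult_mono) auto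
  then show ?thesis using s_gt[OF x] subcritical[OF x] by (simp add: dual_exponent_def le_divide_eq mult.commute)
qed

lemma dual_exponent_measurable [measurable]: "dual_exponent \<in> borel_measurable \<Omega>"
  by (rule exponent_measurable[OF cont_dual_exponent])

definition qs_bound where "qs_bound = (SOME c. 1 \<le> c \<and> (\<forall>x\<in>closure Om. s x \<le> c \<and> q x \<le> c \<and> dual_exponent x \<le> c))"

lemma qs_bound: "1 \<le> qs_bound" "\<And>x. x \<in> Om \<Longrightarrow> s x \<le> qs_bound" "\<And>x. x \<in> Om \<Longrightarrow> q x \<le> qs_bound" "\<And>x. x \<in> Om \<Longrightarrow> dual_exponent x \<le> qs_bound"
proof -
  obtain c1 where "1 \<le> c1" "\<And>x. x \<in> closure Om \<Longrightarrow> s x \<le> c1" using exponent_max[OF cont_s] by blast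
  moreover obtain c2 where "\<And>x. x \<in> closure Om \<Longrightarrow> q x \<le> c2" using exponent_max[OF cont_q] by blast
  moreover obtain c3 where "\<And>x. x \<in> closure Om \<Longrightarrow> dual_exponent x \<le> c3" using exponent_max[OF cont_dual_exponent] by blast
  ultimately have "\<exists>c. 1 \<le> c \<and> (\<forall>x\<in>closure Om. s x \<le> c \<and> q x \<le> c \<and> dual_exponent x \<le> c)"
    by (intro exI[of _ "max c1 (max c2 c3)"]) (simp add: le_max_iff_disj)
  from someI_ex[OF this] show "1 \<le> qs_bound" "\<And>x. x \<in> Om \<Longrightarrow> s x \<le> qs_bound" "\<And>x. x \<in> Om \<Longrightarrow> q x \<le> qs_bound" "\<And>x. x \<in> Om \<Longrightarrow> dual_exponent x \<le> qs_bound"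
    unfolding qs_bound_def using mem_closure_Om by auto
qed

lemma dual_exponent_range: "x \<in> Om \<Longrightarrow> 0 \<le> dual_exponent x \<and> dual_exponent x \<le> qs_bound"
  using dual_exponent_bounds[OF mem_closure_Om] qs_bound(4) by force

lemma AE_q: "AE x in \<Omega>. 1 < q x \<and> q x \<le> qs_bound"
  using q_gt mem_closure_Om qs_bound(3) by (intro AE_I2) auto

lemma AE_V0: "AE x in \<Omega>. 0 \<le> V x"
  using V_pos by eventually_elim simp

text \<open>The quantifiers over \<open>w\<close> and \<delta> stand inside, so one null set serves
  all members of a sequence and all choices of \<delta>.\<close>

lemma AE_young: "AE x in \<Omega>. \<forall>w \<delta>. 0 < \<delta> \<longrightarrow> \<delta> \<le> 1 \<longrightarrow> V x * \<bar>w\<bar> powr q x \<le> \<delta> * \<bar>w\<bar> powr dual_exponent x + (1 / \<delta>) powr qs_bound * \<bar>V x\<bar> powr s x"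
  using AE_V0 AE_space
proof eventually_elim
  case (elim x)
  then have x: "1 < s x" "s x \<le> qs_bound" "1 < q x" using s_gt q_gt qs_bound(2) mem_closure_Om by auto
  show ?case
  proof (intro allI impI)
    fix w \<delta> :: real assume "0 < \<delta>" "\<delta> \<le> 1"
    then show "V x * \<bar>w\<bar> powr q x \<le> \<delta> * \<bar>w\<bar> powr dual_exponent x + (1 / \<delta>) powr qs_bound * \<bar>V x\<bar> powr s x"
      using weight_powr_young[of "V x" "\<bar>w\<bar>" "s x" qs_bound "q x" \<delta>] elim x by (simp add: dual_exponent_def)
  qed
qed

lemma weighted_integrable:
  assumes [measurable]: "u \<in> borel_measurable \<Omega>" and u: "integrable \<Omega> (\<lambda>x. \<bar>u x\<bar> powr dual_exponent x)"
  shows "integrable \<Omega> (\<lambda>x. V x * \<bar>u x\<bar> powr q x)"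
    "(LINT x|\<Omega>. V x * \<bar>u x\<bar> powr q x) \<le> (LINT x|\<Omega>. \<bar>u x\<bar> powr dual_exponent x) + (LINT x|\<Omega>. \<bar>V x\<bar> powr s x)"
proof -
  have le: "AE x in \<Omega>. V x * \<bar>u x\<bar> powr q x \<le> \<bar>u x\<bar> powr dual_exponent x + \<bar>V x\<bar> powr s x"
    using AE_young
  proof eventually_elim
    case (elim x)
    from elim[rule_format, of 1 "u x"] show ?case by simp
  qed
  show int: "integrable \<Omega> (\<lambda>x. V x * \<bar>u x\<bar> powr q x)"
  proof (rule Bochner_Integration.integrable_bound)
    show "integrable \<Omega> (\<lambda>x. \<bar>u x\<bar> powr dual_exponent x + \<bar>V x\<bar> powr s x)" using u V_integrable by simp
    show "AE x in \<Omega>. norm (V x * \<bar>u x\<bar> powr q x) \<le> norm (\<bar>u x\<bar> powr dual_exponent x + \<bar>V x\<bar> powr s x)"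
      using le AE_V0 by eventually_elim (simp add: abs_mult)
  qed measurable
  have "(LINT x|\<Omega>. V x * \<bar>u x\<bar> powr q x) \<le> (LINT x|\<Omega>. \<bar>u x\<bar> powr dual_exponent x + \<bar>V x\<bar> powr s x)"
    using u V_integrable by (intro integral_mono_AE int le) simp
  then show "(LINT x|\<Omega>. V x * \<bar>u x\<bar> powr q x) \<le> (LINT x|\<Omega>. \<bar>u x\<bar> powr dual_exponent x) + (LINT x|\<Omega>. \<bar>V x\<bar> powr s x)"
    using u V_integrable by simp
qed

text \<open>Vitali's theorem: the bound in the dual exponent is multiplied by a small \<delta>, and
  the price, a large multiple of \<open>\<bar>V\<bar> powr s\<close>, does not depend on
  \<open>n\<close>.\<close>

lemma weighted_diff_tendsto:
  assumes m [measurable]: "\<And>n. f n \<in> borel_measurable \<Omega>" "u \<in> borel_measurable \<Omega>"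
    and ae: "AE x in \<Omega>. (\<lambda>n. f n x) \<longlonglongrightarrow> u x"
    and f: "\<And>n. integrable \<Omega> (\<lambda>x. \<bar>f n x\<bar> powr dual_exponent x)" "\<And>n. (LINT x|\<Omega>. \<bar>f n x\<bar> powr dual_exponent x) \<le> C"
    and u: "integrable \<Omega> (\<lambda>x. \<bar>u x\<bar> powr dual_exponent x)"
  shows "(\<lambda>n. LINT x|\<Omega>. V x * \<bar>\<bar>f n x\<bar> powr q x - \<bar>u x\<bar> powr q x\<bar>) \<longlonglongrightarrow> 0"
    "\<And>n. integrable \<Omega> (\<lambda>x. V x * \<bar>\<bar>f n x\<bar> powr q x - \<bar>u x\<bar> powr q x\<bar>)"
proof -
  have C: "0 \<le> C" using f(2)[of 0] by (meson Bochner_Integration.integral_nonneg order_trans powr_ge_zero)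
  define X where "X n x = V x * \<bar>\<bar>f n x\<bar> powr q x - \<bar>u x\<bar> powr q x\<bar>" for n x
  have Xm: "X n \<in> borel_measurable \<Omega>" for n unfolding X_def by measurable
  have nn: "AE x in \<Omega>. 0 \<le> X n x" for n using AE_V0 by eventually_elim (simp add: X_def)
  have lX: "AE x in \<Omega>. (\<lambda>n. X n x) \<longlonglongrightarrow> 0" using ae AE_q
  proof eventually_elim
    case (elim x)
    have "(\<lambda>n. V x * \<bar>\<bar>f n x\<bar> powr q x - \<bar>u x\<bar> powr q x\<bar>) \<longlonglongrightarrow> V x * \<bar>\<bar>u x\<bar> powr q x - \<bar>u x\<bar> powr q x\<bar>"
      using elim by (intro tendsto_intros tendsto_powr') auto
    then show ?case by (simp add: X_def)
  qed
  have dom: "\<exists>W' Y. integrable \<Omega> W' \<and> (\<forall>n. integrable \<Omega> (Y n)) \<and>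
     (\<forall>n. AE x in \<Omega>. X n x \<le> W' x + Y n x \<and> 0 \<le> Y n x) \<and> (\<forall>\<^sub>F n in sequentially. (LINT x|\<Omega>. Y n x) \<le> e)" if e: "0 < e" for e
  proof -
    define \<delta> where "\<delta> = min 1 (e / (C + 1))"
    have \<delta>: "0 < \<delta>" "\<delta> \<le> 1" "\<delta> \<le> e / (C + 1)" using e C by (auto simp: \<delta>_def)
    show ?thesis
    proof (intro exI conjI allI)
      show "integrable \<Omega> (\<lambda>x. (1 / \<delta>) powr qs_bound * \<bar>V x\<bar> powr s x + V x * \<bar>u x\<bar> powr q x)"
        using V_integrable weighted_integrable(1)[OF m(2) u] by simp
      show "integrable \<Omega> (\<lambda>x. \<delta> * \<bar>f n x\<bar> powr dual_exponent x)" for n using f by simp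
      show "AE x in \<Omega>. X n x \<le> ((1 / \<delta>) powr qs_bound * \<bar>V x\<bar> powr s x + V x * \<bar>u x\<bar> powr q x) + \<delta> * \<bar>f n x\<bar> powr dual_exponent x \<and> 0 \<le> \<delta> * \<bar>f n x\<bar> powr dual_exponent x" for n
        using AE_young AE_V0
      proof eventually_elim
        case (elim x)
        have "X n x \<le> V x * (\<bar>f n x\<bar> powr q x + \<bar>u x\<bar> powr q x)"
          unfolding X_def using elim(2) by (intro mult_left_mono) (auto simp: abs_le_iff)
        also have "\<dots> = V x * \<bar>f n x\<bar> powr q x + V x * \<bar>u x\<bar> powr q x" by (simp add: distrib_left)
        finally show ?case using elim(1)[rule_format, OF \<delta>(1,2), of "f n x"] \<delta>(1) by simp
      qed
      have "(LINT x|\<Omega>. \<delta> * \<bar>f n x\<bar> powr dual_exponent x) \<le> e" for n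
      proof -
        have "(LINT x|\<Omega>. \<delta> * \<bar>f n x\<bar> powr dual_exponent x) = \<delta> * (LINT x|\<Omega>. \<bar>f n x\<bar> powr dual_exponent x)" by simp
        also have "\<dots> \<le> \<delta> * (C + 1)" using f(2)[of n] \<delta> by (intro mult_left_mono) auto
        also have "\<dots> \<le> e / (C + 1) * (C + 1)" using \<delta>(3) C by (intro mult_right_mono) auto
        also have "\<dots> = e" using C by simp
        finally show ?thesis .
      qed
      then show "\<forall>\<^sub>F n in sequentially. (LINT x|\<Omega>. \<delta> * \<bar>f n x\<bar> powr dual_exponent x) \<le> e" by simp
    qed
  qed
  note X = vitali_convergence[OF Xm nn lX dom]
  from X show "(\<lambda>n. LINT x|\<Omega>. V x * \<bar>\<bar>f n x\<bar> powr q x - \<bar>u x\<bar> powr q x\<bar>) \<longlonglongrightarrow> 0"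
    "\<And>n. integrable \<Omega> (\<lambda>x. V x * \<bar>\<bar>f n x\<bar> powr q x - \<bar>u x\<bar> powr q x\<bar>)"
    unfolding X_def by auto
qed

section \<open>The weighted functional\<close>

definition F :: "('a \<Rightarrow> real) \<Rightarrow> real" where
  "F u = (LINT x|\<Omega>. V x * (1 / q x * \<bar>u x\<bar> powr q x))"

lemma F_integrable:
  assumes i: "integrable \<Omega> (\<lambda>x. V x * \<bar>u x\<bar> powr q x)"
  shows "integrable \<Omega> (\<lambda>x. V x * (1 / q x * \<bar>u x\<bar> powr q x))"
proof (rule Bochner_Integration.integrable_bound[OF i])
  have [measurable]: "(\<lambda>x. V x * \<bar>u x\<bar> powr q x) \<in> borel_measurable \<Omega>" using i by auto
  have "(\<lambda>x. 1 / q x * (V x * \<bar>u x\<bar> powr q x)) \<in> borel_measurable \<Omega>" by measurable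
  then show "(\<lambda>x. V x * (1 / q x * \<bar>u x\<bar> powr q x)) \<in> borel_measurable \<Omega>" by (simp add: mult_ac)
  show "AE x in \<Omega>. norm (V x * (1 / q x * \<bar>u x\<bar> powr q x)) \<le> norm (V x * \<bar>u x\<bar> powr q x)"
    using AE_q AE_V0
  proof eventually_elim
    case (elim x)
    have "V x * (1 / q x * \<bar>u x\<bar> powr q x) \<le> V x * (1 * \<bar>u x\<bar> powr q x)"
      using elim by (intro mult_left_mono mult_right_mono) auto
    moreover have "0 \<le> V x * (1 / q x * \<bar>u x\<bar> powr q x)" using elim by simp
    ultimately show ?case by simp
  qed
qed

lemma F_le: "integrable \<Omega> (\<lambda>x. V x * \<bar>u x\<bar> powr q x) \<Longrightarrow> F u \<le> (LINT x|\<Omega>. V x * \<bar>u x\<bar> powr q x)"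
  unfolding F_def
proof (rule integral_mono_AE[OF F_integrable])
  show "AE x in \<Omega>. V x * (1 / q x * \<bar>u x\<bar> powr q x) \<le> V x * \<bar>u x\<bar> powr q x"
    using AE_q AE_V0
  proof eventually_elim
    case (elim x)
    have "V x * (1 / q x * \<bar>u x\<bar> powr q x) \<le> V x * (1 * \<bar>u x\<bar> powr q x)"
      using elim by (intro mult_left_mono mult_right_mono) auto
    then show ?case by simp
  qed
qed

text \<open>Only pointwise convergence and a common bound are assumed, so the lemma also applies to
  sequences of midpoints, whose gradients are not yet known to converge.\<close>

lemma F_tendsto:
  assumes m [measurable]: "\<And>n. f n \<in> borel_measurable \<Omega>" "u \<in> borel_measurable \<Omega>"
    and ae: "AE x in \<Omega>. (\<lambda>n. f n x) \<longlonglongrightarrow> u x"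
    and f: "\<And>n. integrable \<Omega> (\<lambda>x. \<bar>f n x\<bar> powr dual_exponent x)" "\<And>n. (LINT x|\<Omega>. \<bar>f n x\<bar> powr dual_exponent x) \<le> C"
    and u: "integrable \<Omega> (\<lambda>x. \<bar>u x\<bar> powr dual_exponent x)"
  shows "(\<lambda>n. F (f n)) \<longlonglongrightarrow> F u"
proof -
  note X = weighted_diff_tendsto[OF m ae f u]
  note iF = F_integrable[OF weighted_integrable(1)[OF m(1) f(1)]] F_integrable[OF weighted_integrable(1)[OF m(2) u]]
  have le: "norm (F (f n) - F u) \<le> (LINT x|\<Omega>. V x * \<bar>\<bar>f n x\<bar> powr q x - \<bar>u x\<bar> powr q x\<bar>)" for n
  proof -
    have eq: "F (f n) - F u = (LINT x|\<Omega>. V x * (1 / q x * \<bar>f n x\<bar> powr q x) - V x * (1 / q x * \<bar>u x\<bar> powr q x))"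
      unfolding F_def using iF by (intro Bochner_Integration.integral_diff[symmetric])
    have id: "integrable \<Omega> (\<lambda>x. V x * (1 / q x * \<bar>f n x\<bar> powr q x) - V x * (1 / q x * \<bar>u x\<bar> powr q x))"
      using iF by (rule Bochner_Integration.integrable_diff)
    have "AE x in \<Omega>. norm (V x * (1 / q x * \<bar>f n x\<bar> powr q x) - V x * (1 / q x * \<bar>u x\<bar> powr q x)) \<le> V x * \<bar>\<bar>f n x\<bar> powr q x - \<bar>u x\<bar> powr q x\<bar>"
      using AE_q AE_V0
    proof eventually_elim
      case (elim x)
      have "norm (V x * (1 / q x * \<bar>f n x\<bar> powr q x) - V x * (1 / q x * \<bar>u x\<bar> powr q x)) = V x * (1 / q x * \<bar>\<bar>f n x\<bar> powr q x - \<bar>u x\<bar> powr q x\<bar>)"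
        using elim by (simp add: right_diff_distrib[symmetric] diff_divide_distrib[symmetric] abs_mult)
      also have "\<dots> \<le> V x * (1 * \<bar>\<bar>f n x\<bar> powr q x - \<bar>u x\<bar> powr q x\<bar>)"
        using elim by (intro mult_left_mono mult_right_mono) auto
      finally show ?case by simp
    qed
    then show ?thesis unfolding eq
      by (rule order_trans[OF integral_norm_bound integral_mono_AE[OF integrable_norm[OF id] X(2)]])
  qed
  have "(\<lambda>n. F (f n) - F u) \<longlonglongrightarrow> 0"
    by (rule Lim_null_comparison[OF _ X(1)]) (intro always_eventually allI le)
  then show ?thesis by (simp add: LIM_zero_iff)
qed

lemma sobolev_dual_exponent:
  assumes "0 \<le> A"
  obtains C where "0 \<le> C" "\<And>u g. H10 u g \<Longrightarrow> (LINT x|\<Omega>. norm (g x) powr p x) \<le> A \<Longrightarrow> integrable \<Omega> (\<lambda>x. \<bar>u x\<bar> powr dual_exponent x)"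
    "\<And>u g. H10 u g \<Longrightarrow> (LINT x|\<Omega>. norm (g x) powr p x) \<le> A \<Longrightarrow> (LINT x|\<Omega>. \<bar>u x\<bar> powr dual_exponent x) \<le> C"
proof (rule sobolev_H10[OF cont_dual_exponent dual_exponent_bounds assms])
  fix C assume "0 \<le> C" "\<And>u g. H10 u g \<Longrightarrow> (LINT x|\<Omega>. norm (g x) powr p x) \<le> A \<Longrightarrow>
     integrable \<Omega> (\<lambda>x. \<bar>u x\<bar> powr dual_exponent x) \<and> (LINT x|\<Omega>. \<bar>u x\<bar> powr dual_exponent x) \<le> C"
  then show thesis by (intro that[of C]) simp_all
qed

lemma H10_dual_exponent_integrable:
  assumes H: "H10 u g"
  shows "integrable \<Omega> (\<lambda>x. \<bar>u x\<bar> powr dual_exponent x)"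
proof -
  define A where "A = (LINT x|\<Omega>. norm (g x) powr p x)"
  have "0 \<le> A" by (simp add: A_def)
  then show ?thesis
  proof (rule sobolev_dual_exponent)
    fix C assume C: "\<And>u g. H10 u g \<Longrightarrow> (LINT x|\<Omega>. norm (g x) powr p x) \<le> A \<Longrightarrow> integrable \<Omega> (\<lambda>x. \<bar>u x\<bar> powr dual_exponent x)"
    show ?thesis by (rule C[OF H]) (simp add: A_def)
  qed
qed

lemma H10_measurable: "H10 u g \<Longrightarrow> u \<in> borel_measurable \<Omega>" "H10 u g \<Longrightarrow> g \<in> borel_measurable \<Omega>"
  by (auto simp: H10_def)

lemma H10_weighted_integrable: "H10 u g \<Longrightarrow> integrable \<Omega> (\<lambda>x. V x * \<bar>u x\<bar> powr q x)"
  by (intro weighted_integrable(1) H10_measurable(1) H10_dual_exponent_integrable)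

lemma approximates_F:
  assumes a: "approximates f u g" and m: "u \<in> borel_measurable \<Omega>" "g \<in> borel_measurable \<Omega>"
  shows "(\<lambda>n. F (f n)) \<longlonglongrightarrow> F u"
proof -
  have H: "H10 u g" using approximates_H10[OF a m] .
  have f: "\<And>n. test_fun Om (f n)" using a by (auto simp: approximates_def)
  obtain A where A: "0 \<le> A" "\<And>n. (LINT x|\<Omega>. norm (grad (f n) x) powr p x) \<le> A"
    using approximates_bound[OF a m(2) H10_integrable(2)[OF H]] by metis
  obtain C where C: "0 \<le> C" "\<And>u g. H10 u g \<Longrightarrow> (LINT x|\<Omega>. norm (g x) powr p x) \<le> A \<Longrightarrow> integrable \<Omega> (\<lambda>x. \<bar>u x\<bar> powr dual_exponent x)"
    "\<And>u g. H10 u g \<Longrightarrow> (LINT x|\<Omega>. norm (g x) powr p x) \<le> A \<Longrightarrow> (LINT x|\<Omega>. \<bar>u x\<bar> powr dual_exponent x) \<le> C"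
    by (rule sobolev_dual_exponent[OF A(1)]) (rule that)
  show ?thesis
  proof (rule F_tendsto)
    show "AE x in \<Omega>. (\<lambda>n. f n x) \<longlonglongrightarrow> u x" using a by (simp add: approximates_def)
    show "(LINT x|\<Omega>. \<bar>f n x\<bar> powr dual_exponent x) \<le> C" for n by (rule C(3)[OF H10_test[OF f] A(2)])
  qed (use test_fun_measurable[OF f] m H10_dual_exponent_integrable[OF H10_test[OF f]] H10_dual_exponent_integrable[OF H] in auto)
qed

lemma F_nonneg: "0 \<le> F u"
  unfolding F_def using AE_q AE_V0 by (intro integral_nonneg_AE) (auto elim!: eventually_elim2)

lemma F_bounded:
  assumes "0 \<le> \<alpha>"
  obtains C where "0 \<le> C" "\<And>u g. H10 u g \<Longrightarrow> G g \<le> \<alpha> \<Longrightarrow> F u \<le> C"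
proof -
  have A: "0 \<le> p_bound * \<alpha>" using assms p_bound by simp
  obtain C where C: "0 \<le> C" "\<And>u g. H10 u g \<Longrightarrow> (LINT x|\<Omega>. norm (g x) powr p x) \<le> p_bound * \<alpha> \<Longrightarrow> integrable \<Omega> (\<lambda>x. \<bar>u x\<bar> powr dual_exponent x)"
    "\<And>u g. H10 u g \<Longrightarrow> (LINT x|\<Omega>. norm (g x) powr p x) \<le> p_bound * \<alpha> \<Longrightarrow> (LINT x|\<Omega>. \<bar>u x\<bar> powr dual_exponent x) \<le> C"
    by (rule sobolev_dual_exponent[OF A]) (rule that)
  show thesis
  proof (rule that[of "C + (LINT x|\<Omega>. \<bar>V x\<bar> powr s x)"])
    show "0 \<le> C + (LINT x|\<Omega>. \<bar>V x\<bar> powr s x)" using C(1) by simp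
    fix u g assume H: "H10 u g" and g: "G g \<le> \<alpha>"
    have "p_bound * G g \<le> p_bound * \<alpha>" using g p_bound(1) by (intro mult_left_mono) auto
    then have "(LINT x|\<Omega>. norm (g x) powr p x) \<le> p_bound * \<alpha>"
      using modular_le_G[OF H10_integrable(2)[OF H]] by linarith
    from C(3)[OF H this] have "(LINT x|\<Omega>. \<bar>u x\<bar> powr dual_exponent x) \<le> C" .
    then show "F u \<le> C + (LINT x|\<Omega>. \<bar>V x\<bar> powr s x)"
      using F_le[OF H10_weighted_integrable[OF H]] weighted_integrable(2)[OF H10_measurable(1)[OF H] H10_dual_exponent_integrable[OF H]] by linarith
  qed
qed

text \<open>For a minimising sequence the functions converge (Rellich) and so do the values of \<open>F\<close>, also along
  midpoints. Hence the values of \<open>G\<close> at midpoints are asymptotically not smaller than the means, and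
  uniform convexity makes the gradients a Cauchy sequence: no weak compactness is needed.\<close>

lemma exists_minimizer:
  assumes \<alpha>: "0 < \<alpha>" and lam: "0 < lam"
  obtains u g where "H10 u g" "G g \<le> \<alpha>" "\<And>f. test_fun Om f \<Longrightarrow> G (grad f) \<le> \<alpha> \<Longrightarrow> G g - lam * F u \<le> G (grad f) - lam * F f"
proof -
  define J where "J f = G (grad f) - lam * F f" for f
  define T where "T = {f. test_fun Om f \<and> G (grad f) \<le> \<alpha>}"
  have Tt: "test_fun Om f" "G (grad f) \<le> \<alpha>" if "f \<in> T" for f using that by (auto simp: T_def)
  obtain C where C: "0 \<le> C" "\<And>u g. H10 u g \<Longrightarrow> G g \<le> \<alpha> \<Longrightarrow> F u \<le> C"
    by (rule F_bounded[OF less_imp_le[OF \<alpha>]]) (rule that)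
  have "grad (\<lambda>x. 0) = (\<lambda>x::'a. 0)"
    by (auto simp: fun_eq_iff intro!: grad_eqI)
  then have "(\<lambda>x. 0) \<in> T" using \<alpha> AE_p by (simp add: T_def test_fun_zero G_def)
  then have T0: "T \<noteq> {}" by blast
  have bdd: "bdd_below (J ` T)"
  proof (rule bdd_belowI2)
    fix f assume f: "f \<in> T"
    have "lam * F f \<le> lam * C" using C(2)[OF H10_test[OF Tt(1)[OF f]] Tt(2)[OF f]] lam by simp
    then show "- (lam * C) \<le> J f" using G_nonneg[of "grad f"] by (simp add: J_def)
  qed
  define m where "m = (INF f\<in>T. J f)"
  have mle: "m \<le> J f" if "f \<in> T" for f unfolding m_def using bdd that by (rule cINF_lower)
  have "\<exists>f\<in>T. J f < m + inverse (real (Suc n))" for n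
  proof -
    have "Inf (J ` T) < m + inverse (real (Suc n))" by (simp add: m_def)
    then show ?thesis using T0 bdd by (subst (asm) cInf_less_iff) auto
  qed
  then obtain f where f: "\<And>n. f n \<in> T" "\<And>n. J (f n) < m + inverse (real (Suc n))" by metis
  define A where "A = p_bound * \<alpha>"
  have A: "0 \<le> A" using \<alpha> p_bound by (simp add: A_def)
  have GA: "(LINT x|\<Omega>. norm (grad h x) powr p x) \<le> A" if "h \<in> T" for h
  proof -
    have "p_bound * G (grad h) \<le> A" unfolding A_def using Tt[OF that] p_bound(1) by (intro mult_left_mono) auto
    then show ?thesis using modular_le_G[OF G_test_integrable[OF Tt(1)[OF that]]] by linarith
  qed
  obtain k u where k: "strict_mono (k::nat\<Rightarrow>nat)" and um [measurable]: "u \<in> borel_measurable \<Omega>"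
    and ku: "AE x in \<Omega>. (\<lambda>n. f (k n) x) \<longlonglongrightarrow> u x"
    using rellich_AE[of f A, OF Tt(1)[OF f(1)] A GA[OF f(1)]] .
  define h where "h n = f (k n)" for n
  have hT: "h n \<in> T" for n using f by (simp add: h_def)
  have ht: "test_fun Om (h n)" for n by (rule Tt(1)[OF hT])
  note hm [measurable] = test_fun_measurable[OF ht]
  have hu: "AE x in \<Omega>. (\<lambda>n. h n x) \<longlonglongrightarrow> u x" using ku by (simp add: h_def)
  have Jh: "(\<lambda>n. J (h n)) \<longlonglongrightarrow> m"
  proof (rule tendsto_sandwich)
    show "\<forall>\<^sub>F n in sequentially. m \<le> J (h n)" using mle[OF hT] by simp
    have "J (h n) \<le> m + inverse (real (Suc n))" for n
    proof -
      have "inverse (real (Suc (k n))) \<le> inverse (real (Suc n))"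
        using seq_suble[OF k, of n] by (intro le_imp_inverse_le) auto
      then show ?thesis using f(2)[of "k n"] unfolding h_def by linarith
    qed
    then show "\<forall>\<^sub>F n in sequentially. J (h n) \<le> m + inverse (real (Suc n))" by simp
    show "(\<lambda>n. m + inverse (real (Suc n))) \<longlonglongrightarrow> m"
      using tendsto_add[OF tendsto_const LIMSEQ_inverse_real_of_nat, of m] by simp
  qed simp
  obtain C1 where C1: "0 \<le> C1" "\<And>u g. H10 u g \<Longrightarrow> (LINT x|\<Omega>. norm (g x) powr p x) \<le> A \<Longrightarrow> integrable \<Omega> (\<lambda>x. \<bar>u x\<bar> powr dual_exponent x)"
    "\<And>u g. H10 u g \<Longrightarrow> (LINT x|\<Omega>. norm (g x) powr p x) \<le> A \<Longrightarrow> (LINT x|\<Omega>. \<bar>u x\<bar> powr dual_exponent x) \<le> C1"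
    by (rule sobolev_dual_exponent[OF A]) (rule that)
  have Trr: "integrable \<Omega> (\<lambda>x. \<bar>v x\<bar> powr dual_exponent x)" "(LINT x|\<Omega>. \<bar>v x\<bar> powr dual_exponent x) \<le> C1" if "v \<in> T" for v
    using C1(2,3)[OF H10_test[OF Tt(1)[OF that]] GA[OF that]] .
  have lrr: "AE x in \<Omega>. (\<lambda>n. \<bar>h n x\<bar> powr dual_exponent x) \<longlonglongrightarrow> \<bar>u x\<bar> powr dual_exponent x"
    using hu AE_space
  proof eventually_elim
    case (elim x)
    then have "0 < dual_exponent x" using dual_exponent_bounds[OF mem_closure_Om[of x]] by simp
    with elim show ?case by (intro tendsto_powr' tendsto_rabs tendsto_const) auto
  qed
  have urr: "integrable \<Omega> (\<lambda>x. \<bar>u x\<bar> powr dual_exponent x)"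
    using integrable_fatou(1)[OF Trr(1)[OF hT] _ lrr _ always_eventually, of C1] Trr(2)[OF hT] by auto
  have Fh: "(\<lambda>n. F (h n)) \<longlonglongrightarrow> F u"
    by (rule F_tendsto[OF hm(1) um hu Trr(1)[OF hT] Trr(2)[OF hT] urr])
  \<comment> \<open>Midpoints stay in \<open>T\<close> by convexity of \<open>G\<close>, so they
    compete in the minimisation and \<open>m \<le> J (mid i j)\<close>.\<close>
  define mid where "mid i j = (\<lambda>x. 1/2 * (h i x + h j x))" for i j
  have mean_le: "x \<le> c" if "x \<le> (y + z) / 2" "y \<le> c" "z \<le> c" for x y z c :: real
    using that unfolding add_divide_distrib by linarith
  have midT: "mid i j \<in> T" for i j
  proof -
    have "test_fun Om (mid i j)" unfolding mid_def by (intro test_fun_scale test_fun_add ht)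
    moreover have "G (grad (mid i j)) \<le> \<alpha>"
      unfolding mid_def by (rule mean_le[OF G_midpoint_le[OF ht ht] Tt(2)[OF hT] Tt(2)[OF hT]])
    ultimately show ?thesis by (simp add: T_def)
  qed
  have Fmid: "\<exists>N. \<forall>i\<ge>N. \<forall>j\<ge>N. \<bar>F (mid i j) - F u\<bar> < e" if e: "0 < e" for e
  \<comment> \<open>A double limit reduced to a sequence: bad pairs with indices beyond every
    \<open>N\<close> give midpoints that still converge to \<open>u\<close> almost everywhere,
    against \<open>F_tendsto\<close>.\<close>
  proof (rule ccontr)
    assume "\<not> ?thesis"
    then have "\<forall>N. \<exists>i j. N \<le> i \<and> N \<le> j \<and> e \<le> \<bar>F (mid i j) - F u\<bar>" by (meson not_le)
    then obtain a b where ab: "\<And>N. N \<le> a N" "\<And>N. N \<le> b N" "\<And>N. e \<le> \<bar>F (mid (a N) (b N)) - F u\<bar>" by metis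
    have fa: "filterlim a at_top sequentially" "filterlim b at_top sequentially"
      using ab(1,2) by (auto intro!: filterlim_at_top_mono[OF filterlim_ident])
    have "AE x in \<Omega>. (\<lambda>N. mid (a N) (b N) x) \<longlonglongrightarrow> u x" using hu
    proof eventually_elim
      case (elim x)
      have "(\<lambda>N. 1/2 * (h (a N) x + h (b N) x)) \<longlonglongrightarrow> 1/2 * (u x + u x)"
        by (intro tendsto_intros filterlim_compose[OF elim fa(1)] filterlim_compose[OF elim fa(2)])
      then show ?case by (simp add: mid_def)
    qed
    then have "(\<lambda>N. F (mid (a N) (b N))) \<longlonglongrightarrow> F u"
      by (intro F_tendsto[OF _ um _ Trr(1)[OF midT] Trr(2)[OF midT] urr] test_fun_measurable(1) Tt(1) midT)
    from tendsto_rabs_zero[OF LIM_zero[OF this]] have "\<forall>\<^sub>F N in sequentially. \<bar>F (mid (a N) (b N)) - F u\<bar> < e"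
      using e by (rule order_tendstoD(2))
    then show False using ab(3) by (auto simp: eventually_sequentially not_less[symmetric])
  qed
  have deficit: "\<exists>N. \<forall>i\<ge>N. \<forall>j\<ge>N. (G (grad (h i)) + G (grad (h j))) / 2 - G (grad (mid i j)) \<le> e" if e: "0 < e" for e
  proof -
    \<comment> \<open>The estimate below ends with \<open>d + lam * (2 * d)\<close>, which is at
      most \<open>e\<close> for this choice.\<close>
    define d where "d = e / (2 + 2 * lam)"
    have d: "0 < d" "d * (2 + 2 * lam) = e" using e lam by (auto simp: d_def)
    obtain N1 where N1: "\<And>i j. i \<ge> N1 \<Longrightarrow> j \<ge> N1 \<Longrightarrow> \<bar>F (mid i j) - F u\<bar> < d" using Fmid[OF d(1)] by blast
    obtain N2 where N2: "\<And>n. n \<ge> N2 \<Longrightarrow> \<bar>F (h n) - F u\<bar> < d"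
      using LIMSEQ_D[OF Fh d(1)] by auto
    obtain N3 where N3: "\<And>n. n \<ge> N3 \<Longrightarrow> \<bar>J (h n) - m\<bar> < d"
      using LIMSEQ_D[OF Jh d(1)] by auto
    have "(G (grad (h i)) + G (grad (h j))) / 2 - G (grad (mid i j)) \<le> e"
      if "i \<ge> max N1 (max N2 N3)" "j \<ge> max N1 (max N2 N3)" for i j
    proof -
      have b: "\<bar>F (mid i j) - F u\<bar> < d" "\<bar>F (h i) - F u\<bar> < d" "\<bar>F (h j) - F u\<bar> < d" "\<bar>J (h i) - m\<bar> < d" "\<bar>J (h j) - m\<bar> < d"
        using that N1 N2 N3 by auto
      have "lam * ((F (h i) + F (h j)) / 2 - F (mid i j)) \<le> lam * (2 * d)"
      proof (rule mult_left_mono)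
        show "(F (h i) + F (h j)) / 2 - F (mid i j) \<le> 2 * d"
          using b(1-3) unfolding add_divide_distrib by linarith
      qed (use lam in simp)
      moreover have "m \<le> J (mid i j)" by (rule mle[OF midT])
      \<comment> \<open>The deficit of \<open>G\<close> is that of \<open>J\<close> plus
        \<open>lam\<close> times that of \<open>F\<close>. The former is small because the sequence
        is minimising, the latter because all three values of \<open>F\<close> approach
        \<open>F u\<close>.\<close>
      moreover have "(G (grad (h i)) + G (grad (h j))) / 2 - G (grad (mid i j))
          = (J (h i) + J (h j)) / 2 - J (mid i j) + lam * ((F (h i) + F (h j)) / 2 - F (mid i j))"
        by (simp add: J_def algebra_simps add_divide_distrib diff_divide_distrib)
      ultimately have "(G (grad (h i)) + G (grad (h j))) / 2 - G (grad (mid i j)) \<le> d + lam * (2 * d)"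
        using b(4,5) unfolding add_divide_distrib by linarith
      also have "\<dots> \<le> e" using d by (simp add: algebra_simps)
      finally show ?thesis .
    qed
    then show ?thesis by blast
  qed
  obtain dp where dp: "0 < dp" "\<And>x. x \<in> closure Om \<Longrightarrow> 1 + dp \<le> p x"
    using exponent_lower[OF cont_p, of 1] p_bounds by blast
  have lP: "1 < 1 + dp" "1 + dp \<le> p_bound"
  proof -
    obtain x where "x \<in> Om" using nonempty_Om by blast
    then show "1 + dp \<le> p_bound" using dp(2) p_bound(2) mem_closure_Om by (meson order_trans)
  qed (use dp in simp)
  have cauchy: "\<exists>N. \<forall>i\<ge>N. \<forall>j\<ge>N. (LINT x|\<Omega>. norm (grad (h i) x - grad (h j) x) powr p x) \<le> e" if e: "0 < e" for e
  proof -
    \<comment> \<open>First \<eta> is fixed to make the convexity error at most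
      \<open>e / 2\<close>; only then is \<open>K\<close> known, and the admissible deficit
      \<open>e'\<close> depends on \<open>K\<close>.\<close>
    define \<eta> where "\<eta> = e / (4 * (A + 1))"
    have \<eta>: "0 < \<eta>" using e A by (simp add: \<eta>_def)
    have "2 * \<eta> * A \<le> 2 * \<eta> * (A + 1)" using \<eta> by simp
    also have "\<dots> = e / 2" using A by (simp add: \<eta>_def field_simps)
    finally have \<eta>A: "2 * \<eta> * A \<le> e / 2" .
    obtain K where K: "0 \<le> K" "\<And>a (b::'a) r. 1 + dp \<le> r \<Longrightarrow> r \<le> p_bound \<Longrightarrow> norm (a - b) powr r \<le> \<eta> * (norm a powr r + norm b powr r)
      + K * ((norm a powr r + norm b powr r) / 2 - norm ((1/2) *\<^sub>R (a + b)) powr r)"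
      using uniform_convexity_powr[OF lP \<eta>] by blast
    define e' where "e' = e / (2 * (K * p_bound + 1))"
    have KP: "0 \<le> K * p_bound" using K p_bound by simp
    then have e': "0 < e'" using e by (simp add: e'_def)
    obtain N where N: "\<And>i j. i \<ge> N \<Longrightarrow> j \<ge> N \<Longrightarrow> (G (grad (h i)) + G (grad (h j))) / 2 - G (grad (mid i j)) \<le> e'"
      using deficit[OF e'] by blast
    have "(LINT x|\<Omega>. norm (grad (h i) x - grad (h j) x) powr p x) \<le> e" if "i \<ge> N" "j \<ge> N" for i j
    proof -
      have "(LINT x|\<Omega>. norm (grad (h i) x - grad (h j) x) powr p x) \<le> 2 * \<eta> * A
          + K * p_bound * ((G (grad (h i)) + G (grad (h j))) / 2 - G (grad (mid i j)))"
        unfolding mid_def using \<eta> dp by (intro G_midpoint_deficit[OF ht ht GA[OF hT] GA[OF hT] K]) auto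
      also have "\<dots> \<le> e / 2 + K * p_bound * e'" using \<eta>A N[OF that] KP by (intro add_mono mult_left_mono) auto
      also have "K * p_bound * e' \<le> (K * p_bound + 1) * e'" using e' by (simp add: algebra_simps)
      also have "(K * p_bound + 1) * e' = e / 2" using KP by (simp add: e'_def field_simps)
      finally show ?thesis by simp
    qed
    then show ?thesis by blast
  qed
  have "\<exists>g. g \<in> borel_measurable \<Omega> \<and> (\<exists>k. strict_mono k \<and> (AE x in \<Omega>. (\<lambda>n. grad (h (k n)) x) \<longlonglongrightarrow> g x))
     \<and> (\<forall>n. integrable \<Omega> (\<lambda>x. norm (grad (h n) x - g x) powr p x))
     \<and> (\<lambda>n. LINT x|\<Omega>. norm (grad (h n) x - g x) powr p x) \<longlonglongrightarrow> 0"
  proof (rule L1_cauchy_modular[OF finite_measure_Om hm(2) p_measurable AE_p _ _ cauchy])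
    show "integrable \<Omega> (\<lambda>x. norm (grad (h n) x - grad (h m) x) powr p x)" for n m
      by (rule integrable_powr_diff(1)[OF p_measurable p_range]) (use G_test_integrable[OF ht] hm in auto)
    show "integrable \<Omega> (\<lambda>x. norm (grad (h 0) x) powr p x)" by (rule G_test_integrable[OF ht])
  qed
  then obtain g l where gm [measurable]: "g \<in> borel_measurable \<Omega>" and l: "strict_mono (l::nat\<Rightarrow>nat)" "AE x in \<Omega>. (\<lambda>n. grad (h (l n)) x) \<longlonglongrightarrow> g x"
    and gconv: "mconv (\<lambda>n. grad (h n)) g" unfolding mconv_def by blast
  have uconv: "mconv h u" by (rule mconv_of_AE_bounded[OF ht um hu A GA[OF hT]])
  have hlu: "AE x in \<Omega>. (\<lambda>n. h (l n) x) \<longlonglongrightarrow> u x"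
    using hu by eventually_elim (drule LIMSEQ_subseq_LIMSEQ[OF _ l(1)], simp add: o_def)
  have a: "approximates (\<lambda>n. h (l n)) u g"
    unfolding approximates_def using ht hlu l(2) mconv_subseq[OF uconv l(1)] mconv_subseq[OF gconv l(1)] by auto
  have H: "H10 u g" by (rule approximates_H10[OF a um gm])
  have Gl: "(\<lambda>n. G (grad (h (l n)))) \<longlonglongrightarrow> G g" by (rule approximates_G[OF a gm H10_integrable(2)[OF H]])
  have "(\<lambda>n. J (h (l n))) \<longlonglongrightarrow> G g - lam * F u"
    unfolding J_def by (intro tendsto_intros Gl approximates_F[OF a um gm])
  moreover have "(\<lambda>n. J (h (l n))) \<longlonglongrightarrow> m" using LIMSEQ_subseq_LIMSEQ[OF Jh l(1)] by (simp add: o_def)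
  ultimately have Jm: "G g - lam * F u = m" by (rule LIMSEQ_unique)
  show thesis
  proof (rule that[OF H])
    show "G g \<le> \<alpha>" by (rule tendsto_upperbound[OF Gl]) (use Tt(2)[OF hT] in auto)
    show "G g - lam * F u \<le> G (grad f) - lam * F f" if "test_fun Om f" "G (grad f) \<le> \<alpha>" for f
      using mle[of f] that unfolding Jm J_def T_def by simp
  qed
qed

end

section \<open>Eigenpairs\<close>

context weighted_domain
begin

text \<open>The strict inequality \<open>G g < \<alpha>\<close> leaves room for small perturbations
  in every direction. Difference quotients with positive steps give an inequality, and the direction
  \<open>- v\<close> gives the reverse one.\<close>

lemma euler_lagrange_test:
  assumes H: "H10 u g" and lam: "0 < lam" and G: "G g < \<alpha>"
    and min: "\<And>f. test_fun Om f \<Longrightarrow> G (grad f) \<le> \<alpha> \<Longrightarrow> G g - lam * F u \<le> G (grad f) - lam * F f"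
    and v: "test_fun Om v"
  shows "(LINT x|\<Omega>. norm (g x) powr (p x - 2) * (g x \<bullet> grad v x)) = lam * (LINT x|\<Omega>. V x * (\<bar>u x\<bar> powr (q x - 2) * (u x * v x)))"
proof -
  note um [measurable] = H10_measurable(1)[OF H] and gm [measurable] = H10_measurable(2)[OF H]
  define t where "t n = inverse (real (Suc n))" for n
  have t: "0 < t n \<and> t n \<le> 1" for n by (simp add: t_def inverse_le_1_iff)
  have tl: "t \<longlonglongrightarrow> 0" unfolding t_def by (rule LIMSEQ_inverse_real_of_nat)
  obtain f where a: "approximates f u g" using H by (auto simp: H10_def)
  have ge: "0 \<le> (LINT x|\<Omega>. norm (g x) powr (p x - 2) * (g x \<bullet> grad w x)) - lam * (LINT x|\<Omega>. V x * (\<bar>u x\<bar> powr (q x - 2) * (u x * w x)))"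
    if w: "test_fun Om w" for w
  proof -
    note wm [measurable] = test_fun_measurable[OF w]
    define gt where "gt n = (\<lambda>x. g x + t n *\<^sub>R grad w x)" for n
    define ut where "ut n = (\<lambda>x. u x + t n * w x)" for n
    have [measurable]: "gt n \<in> borel_measurable \<Omega>" "ut n \<in> borel_measurable \<Omega>" for n
      unfolding gt_def ut_def by measurable
    have an: "approximates (\<lambda>k x. f k x + t n * w x) (ut n) (gt n)" for n
      unfolding gt_def ut_def by (rule approximates_add_test[OF a w])
    have Hn: "H10 (ut n) (gt n)" for n by (rule approximates_H10[OF an]) measurable
    have "(\<lambda>n. ((LINT x|\<Omega>. 1 * (1 / p x * norm (g x + t n *\<^sub>R grad w x) powr p x)) - (LINT x|\<Omega>. 1 * (1 / p x * norm (g x) powr p x))) / t n)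
       \<longlonglongrightarrow> (LINT x|\<Omega>. 1 * (norm (g x) powr (p x - 2) * (g x \<bullet> grad w x)))"
      by (rule powr_functional_derivative(1)[OF _ p_measurable _ AE_p gm wm(2) _ _ t tl])
        (use H10_integrable(2)[OF H] G_test_integrable[OF w] in auto)
    then have dG: "(\<lambda>n. (G (gt n) - G g) / t n) \<longlonglongrightarrow> (LINT x|\<Omega>. norm (g x) powr (p x - 2) * (g x \<bullet> grad w x))"
      by (simp add: G_def gt_def)
    have "(\<lambda>n. ((LINT x|\<Omega>. V x * (1 / q x * norm (u x + t n *\<^sub>R w x) powr q x)) - (LINT x|\<Omega>. V x * (1 / q x * norm (u x) powr q x))) / t n)
       \<longlonglongrightarrow> (LINT x|\<Omega>. V x * (norm (u x) powr (q x - 2) * (u x \<bullet> w x)))"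
      by (rule powr_functional_derivative(1)[OF V_measurable q_measurable AE_V0 AE_q um wm(1) _ _ t tl])
        (use H10_weighted_integrable[OF H] H10_weighted_integrable[OF H10_test[OF w]] in auto)
    then have dF: "(\<lambda>n. (F (ut n) - F u) / t n) \<longlonglongrightarrow> (LINT x|\<Omega>. V x * (\<bar>u x\<bar> powr (q x - 2) * (u x * w x)))"
      by (simp add: F_def ut_def)
    have "(\<lambda>n. (G (gt n) - G g) / t n * t n) \<longlonglongrightarrow> (LINT x|\<Omega>. norm (g x) powr (p x - 2) * (g x \<bullet> grad w x)) * 0"
      by (intro tendsto_intros dG tl)
    moreover have "(G (gt n) - G g) / t n * t n = G (gt n) - G g" for n using t[of n] by simp
    ultimately have "(\<lambda>n. G (gt n)) \<longlonglongrightarrow> G g" by (simp add: LIM_zero_iff)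
    then have ev: "\<forall>\<^sub>F n in sequentially. G (gt n) < \<alpha>" using G by (rule order_tendstoD(2))
    have "\<forall>\<^sub>F n in sequentially. 0 \<le> (G (gt n) - G g) / t n - lam * ((F (ut n) - F u) / t n)"
      using ev
    proof eventually_elim
      case (elim n)
      \<comment> \<open>Minimality is known against test functions only, so the perturbed minimiser
        is itself approximated by perturbed approximants, and the inequality passes to the
        limit.\<close>
      define h where "h k = (\<lambda>x. f k x + t n * w x)" for k
      have ah: "approximates h (ut n) (gt n)" using an[of n] by (simp add: h_def[abs_def])
      have Gh: "(\<lambda>k. G (grad (h k))) \<longlonglongrightarrow> G (gt n)"
        by (rule approximates_G[OF ah _ H10_integrable(2)[OF Hn]]) measurable
      have Fh: "(\<lambda>k. F (h k)) \<longlonglongrightarrow> F (ut n)" by (rule approximates_F[OF ah]) measurable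
      have "\<forall>\<^sub>F k in sequentially. G g - lam * F u \<le> G (grad (h k)) - lam * F (h k)"
        using order_tendstoD(2)[OF Gh elim]
      proof eventually_elim
        case (elim k)
        have "test_fun Om (h k)" using ah by (simp add: approximates_def)
        then show ?case using elim by (intro min) auto
      qed
      then have "G g - lam * F u \<le> G (gt n) - lam * F (ut n)"
        by (intro tendsto_lowerbound[OF tendsto_diff[OF Gh tendsto_mult[OF tendsto_const Fh]]]) auto
      then have "0 \<le> (G (gt n) - G g - lam * (F (ut n) - F u)) / t n"
        using t[of n] by (intro divide_nonneg_pos) (auto simp: algebra_simps)
      then show ?case by (simp add: diff_divide_distrib right_diff_distrib)
    qed
    then show ?thesis
      by (intro tendsto_lowerbound[OF tendsto_diff[OF dG tendsto_mult[OF tendsto_const dF]]]) auto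
  qed
  have vm: "test_fun Om (\<lambda>x. (-1) * v x)" using v by (rule test_fun_scale)
  have gv: "grad (\<lambda>x. (-1) * v x) x = - grad v x" for x
    using grad_scale[OF test_fun_smooth[OF v], of "-1"] by simp
  from ge[OF vm] have "(LINT x|\<Omega>. norm (g x) powr (p x - 2) * (g x \<bullet> grad v x)) - lam * (LINT x|\<Omega>. V x * (\<bar>u x\<bar> powr (q x - 2) * (u x * v x))) \<le> 0"
    unfolding gv by simp
  with ge[OF v] show ?thesis by linarith
qed

text \<open>Density of the test functions: both sides are continuous along an approximating
  sequence, the left one by modular convergence of the gradients, the right one by the bound in the
  dual exponent.\<close>

lemma euler_lagrange_H10:
  assumes H: "H10 u g"
    and EL: "\<And>v. test_fun Om v \<Longrightarrow> (LINT x|\<Omega>. norm (g x) powr (p x - 2) * (g x \<bullet> grad v x)) = lam * (LINT x|\<Omega>. V x * (\<bar>u x\<bar> powr (q x - 2) * (u x * v x)))"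
    and Hv: "H10 v h"
  shows "(LINT x|\<Omega>. norm (g x) powr (p x - 2) * (g x \<bullet> h x)) = lam * (LINT x|\<Omega>. V x * (\<bar>u x\<bar> powr (q x - 2) * (u x * v x)))"
proof -
  note um [measurable] = H10_measurable(1)[OF H] and gm [measurable] = H10_measurable(2)[OF H]
  note vm [measurable] = H10_measurable(1)[OF Hv] and hm [measurable] = H10_measurable(2)[OF Hv]
  obtain f where a: "approximates f v h" using Hv by (auto simp: H10_def)
  have f: "test_fun Om (f n)" for n using a by (auto simp: approximates_def)
  note fm [measurable] = test_fun_measurable[OF f]
  have c: "\<And>n. integrable \<Omega> (\<lambda>x. norm (grad (f n) x - h x) powr p x)"
    "(\<lambda>n. LINT x|\<Omega>. norm (grad (f n) x - h x) powr p x) \<longlonglongrightarrow> 0"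
    using a by (auto simp: approximates_def mconv_def)
  have ae: "AE x in \<Omega>. (\<lambda>n. grad (f n) x) \<longlonglongrightarrow> h x" "AE x in \<Omega>. (\<lambda>n. f n x) \<longlonglongrightarrow> v x"
    using a by (auto simp: approximates_def)
  have "(\<lambda>n. LINT x|\<Omega>. 1 * (norm (g x) powr (p x - 2) * (g x \<bullet> grad (f n) x)))
     \<longlonglongrightarrow> (LINT x|\<Omega>. 1 * (norm (g x) powr (p x - 2) * (g x \<bullet> h x)))"
    by (rule pairing_tendsto[OF _ p_measurable _ AE_p gm hm fm(2) _ _ _ _ ae(1)])
      (use H10_integrable(2)[OF H] H10_integrable(2)[OF Hv] c in auto)
  then have l1: "(\<lambda>n. LINT x|\<Omega>. norm (g x) powr (p x - 2) * (g x \<bullet> grad (f n) x))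
     \<longlonglongrightarrow> (LINT x|\<Omega>. norm (g x) powr (p x - 2) * (g x \<bullet> h x))" by simp
  obtain A where A: "0 \<le> A" "\<And>n. (LINT x|\<Omega>. norm (grad (f n) x) powr p x) \<le> A" "(LINT x|\<Omega>. norm (h x) powr p x) \<le> A"
    by (rule approximates_bound[OF a hm H10_integrable(2)[OF Hv]]) (rule that)
  obtain C where C: "0 \<le> C" "\<And>u g. H10 u g \<Longrightarrow> (LINT x|\<Omega>. norm (g x) powr p x) \<le> A \<Longrightarrow> integrable \<Omega> (\<lambda>x. \<bar>u x\<bar> powr dual_exponent x)"
    "\<And>u g. H10 u g \<Longrightarrow> (LINT x|\<Omega>. norm (g x) powr p x) \<le> A \<Longrightarrow> (LINT x|\<Omega>. \<bar>u x\<bar> powr dual_exponent x) \<le> C"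
    by (rule sobolev_dual_exponent[OF A(1)]) (rule that)
  note fr = C(2,3)[OF H10_test[OF f] A(2)] and vr = C(2,3)[OF Hv A(3)]
  have dr: "integrable \<Omega> (\<lambda>x. norm (f n x - v x) powr dual_exponent x)" "(LINT x|\<Omega>. norm (f n x - v x) powr dual_exponent x) \<le> 2 powr qs_bound * (C + C)" for n
  proof -
    show "integrable \<Omega> (\<lambda>x. norm (f n x - v x) powr dual_exponent x)"
      by (rule integrable_powr_diff(1)[OF dual_exponent_measurable dual_exponent_range]) (use fr vr in simp_all)
    have "(LINT x|\<Omega>. norm (f n x - v x) powr dual_exponent x) \<le> 2 powr qs_bound * ((LINT x|\<Omega>. norm (f n x) powr dual_exponent x) + (LINT x|\<Omega>. norm (v x) powr dual_exponent x))"
      by (rule integrable_powr_diff(2)[OF dual_exponent_measurable dual_exponent_range]) (use fr vr in simp_all)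
    also have "\<dots> \<le> 2 powr qs_bound * (C + C)" using fr(2)[of n] vr(2) by (intro mult_left_mono add_mono) auto
    finally show "(LINT x|\<Omega>. norm (f n x - v x) powr dual_exponent x) \<le> 2 powr qs_bound * (C + C)" .
  qed
  have ae0: "AE x in \<Omega>. (\<lambda>n. f n x - v x) \<longlonglongrightarrow> 0"
    using ae(2) by eventually_elim (rule LIM_zero)
  \<comment> \<open>The differences tend to 0 almost everywhere and are bounded in the dual
    exponent, so the limit function here is 0; its vanishing power is written out to match the
    lemma.\<close>
  have w: "(\<lambda>n. LINT x|\<Omega>. V x * \<bar>\<bar>f n x - v x\<bar> powr q x - \<bar>0\<bar> powr q x\<bar>) \<longlonglongrightarrow> 0"
    "\<And>n. integrable \<Omega> (\<lambda>x. V x * \<bar>\<bar>f n x - v x\<bar> powr q x - \<bar>0\<bar> powr q x\<bar>)"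
    by (rule weighted_diff_tendsto[where f="\<lambda>n x. f n x - v x" and u="\<lambda>x. 0" and C="2 powr qs_bound * (C + C)"]; use ae0 dr in simp)+
  have "(\<lambda>n. LINT x|\<Omega>. V x * (norm (u x) powr (q x - 2) * (u x \<bullet> f n x)))
     \<longlonglongrightarrow> (LINT x|\<Omega>. V x * (norm (u x) powr (q x - 2) * (u x \<bullet> v x)))"
    by (rule pairing_tendsto[OF V_measurable q_measurable AE_V0 AE_q um vm fm(1) _ _ _ _ ae(2)])
      (use H10_weighted_integrable[OF H] H10_weighted_integrable[OF Hv] w in auto)
  then have l2: "(\<lambda>n. LINT x|\<Omega>. V x * (\<bar>u x\<bar> powr (q x - 2) * (u x * f n x)))
     \<longlonglongrightarrow> (LINT x|\<Omega>. V x * (\<bar>u x\<bar> powr (q x - 2) * (u x * v x)))" by simp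
  have "(\<lambda>n. LINT x|\<Omega>. norm (g x) powr (p x - 2) * (g x \<bullet> grad (f n) x))
     \<longlonglongrightarrow> lam * (LINT x|\<Omega>. V x * (\<bar>u x\<bar> powr (q x - 2) * (u x * v x)))"
    unfolding EL[OF f] by (intro tendsto_intros l2)
  from LIMSEQ_unique[OF l1 this] show ?thesis .
qed

section \<open>Passage to the functionals and eigenpairs of the definitions\<close>

lemma G_fun_eq: "AE x in \<Omega>. wgrad Om u x = g x \<Longrightarrow> g \<in> borel_measurable \<Omega> \<Longrightarrow> G_fun Om p u = G g"
  unfolding G_fun_def G_def
proof (rule integral_cong_AE)
  assume ae: "AE x in \<Omega>. wgrad Om u x = g x" and [measurable]: "g \<in> borel_measurable \<Omega>"
  have [measurable]: "wgrad Om u \<in> borel_measurable \<Omega>" by (rule measurable_AE_cong[OF ae]) measurable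
  show "(\<lambda>x. 1 / p x * norm (wgrad Om u x) powr p x) \<in> borel_measurable \<Omega>" "(\<lambda>x. 1 / p x * norm (g x) powr p x) \<in> borel_measurable \<Omega>"
    by measurable
  show "AE x in \<Omega>. 1 / p x * norm (wgrad Om u x) powr p x = 1 / p x * norm (g x) powr p x"
    using ae by eventually_elim simp
qed

lemma psi_fun_eq: "AE x in \<Omega>. wgrad Om u x = g x \<Longrightarrow> g \<in> borel_measurable \<Omega> \<Longrightarrow> psi_fun Om p u = (LINT x|\<Omega>. norm (g x) powr p x)"
  unfolding psi_fun_def
proof (rule integral_cong_AE)
  assume ae: "AE x in \<Omega>. wgrad Om u x = g x" and [measurable]: "g \<in> borel_measurable \<Omega>"
  have [measurable]: "wgrad Om u \<in> borel_measurable \<Omega>" by (rule measurable_AE_cong[OF ae]) measurable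
  show "(\<lambda>x. norm (wgrad Om u x) powr p x) \<in> borel_measurable \<Omega>" "(\<lambda>x. norm (g x) powr p x) \<in> borel_measurable \<Omega>"
    by measurable
  show "AE x in \<Omega>. norm (wgrad Om u x) powr p x = norm (g x) powr p x"
    using ae by eventually_elim simp
qed

lemma eigenpairI:
  assumes H: "H10 u g" and nz: "\<not> ae_zero Om u"
    and EL: "\<And>v h. H10 v h \<Longrightarrow> (LINT x|\<Omega>. norm (g x) powr (p x - 2) * (g x \<bullet> h x)) = lam * (LINT x|\<Omega>. V x * (\<bar>u x\<bar> powr (q x - 2) * (u x * v x)))"
  shows "eigenpair Om p q V lam u"
  unfolding eigenpair_def
proof (intro conjI ballI nz)
  show "u \<in> W10 Om p" by (rule H10_imp_W10(1)[OF H])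
  note aeu = H10_imp_W10(2)[OF H]
  note [measurable] = H10_measurable[OF H]
  have [measurable]: "wgrad Om u \<in> borel_measurable \<Omega>" by (rule measurable_AE_cong[OF aeu]) measurable
  fix v assume "v \<in> W10 Om p"
  then obtain h where Hv: "H10 v h" and aev: "AE x in \<Omega>. wgrad Om v x = h x" by (rule W10_imp_H10)
  note [measurable] = H10_measurable[OF Hv]
  have [measurable]: "wgrad Om v \<in> borel_measurable \<Omega>" by (rule measurable_AE_cong[OF aev]) measurable
  have "(LINT x|\<Omega>. norm (wgrad Om u x) powr (p x - 2) * (wgrad Om u x \<bullet> wgrad Om v x)) = (LINT x|\<Omega>. norm (g x) powr (p x - 2) * (g x \<bullet> h x))"
  proof (rule integral_cong_AE)
    show "AE x in \<Omega>. norm (wgrad Om u x) powr (p x - 2) * (wgrad Om u x \<bullet> wgrad Om v x) = norm (g x) powr (p x - 2) * (g x \<bullet> h x)"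
      using aeu aev by eventually_elim simp
  qed measurable
  then show "(LINT x|\<Omega>. norm (wgrad Om u x) powr (p x - 2) * (wgrad Om u x \<bullet> wgrad Om v x)) = lam * (LINT x|\<Omega>. V x * \<bar>u x\<bar> powr (q x - 2) * u x * v x)"
    using EL[OF Hv] by (simp add: mult.assoc)
qed

lemma phi_nonneg: "0 \<le> phi_fun Om q V u"
  unfolding phi_fun_def using AE_V0 by (intro integral_nonneg_AE) (auto elim!: eventually_mono)

lemma psi_nonneg: "0 \<le> psi_fun Om p u"
  unfolding psi_fun_def by simp

lemma lambda_star_bdd: "bdd_below ((\<lambda>u. psi_fun Om p u / phi_fun Om q V u) ` A)"
  by (rule bdd_belowI2[of _ 0]) (simp add: phi_nonneg psi_nonneg)

lemma lambda_star_le: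
  assumes "u \<in> M_set Om p \<alpha>" "\<not> ae_zero Om u"
  shows "lambda_star Om p q V \<alpha> \<le> psi_fun Om p u / phi_fun Om q V u"
  unfolding lambda_star_def using assms by (intro cINF_lower lambda_star_bdd) auto

text \<open>If \<open>phi_fun\<close> vanished, then the quotient would be \<open>0\<close> because of the convention \<open>x / 0 = 0\<close>;
  in that case the infimum is not positive either.\<close>

lemma small_not_eigenvalue:
  assumes "0 < lam" "lam < lambda_star Om p q V \<alpha>"
  shows "lam \<notin> Lambda_set Om p q V \<alpha>"
proof
  assume "lam \<in> Lambda_set Om p q V \<alpha>"
  then obtain u where u: "u \<in> M_set Om p \<alpha>" "eigenpair Om p q V lam u" by (auto simp: Lambda_set_def)
  then have uW: "u \<in> W10 Om p" and nz: "\<not> ae_zero Om u"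
    and eq: "(LINT x|\<Omega>. norm (wgrad Om u x) powr (p x - 2) * (wgrad Om u x \<bullet> wgrad Om u x)) = lam * (LINT x|\<Omega>. V x * \<bar>u x\<bar> powr (q x - 2) * u x * u x)"
    by (auto simp: eigenpair_def)
  have 1: "norm w powr (a - 2) * (w \<bullet> w) = norm w powr a" for w :: 'a and a
    by (cases "w = 0") (auto simp: power2_norm_eq_inner[symmetric] powr_diff powr_numeral)
  have 2: "\<bar>y\<bar> powr (b - 2) * y * y = \<bar>y\<bar> powr b" for y b :: real
    by (cases "y = 0") (auto simp: powr_diff powr_numeral power2_eq_square mult.assoc)
  have "psi_fun Om p u = lam * phi_fun Om q V u"
    using eq unfolding psi_fun_def phi_fun_def by (simp add: 1 2[unfolded mult.assoc] mult.assoc)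
  then have "psi_fun Om p u / phi_fun Om q V u \<le> lam" using assms by (cases "phi_fun Om q V u = 0") auto
  then show False using lambda_star_le[OF u(1) nz] assms by linarith
qed

section \<open>Small multiples of a bump\<close>

text \<open>Continuity of \<open>q\<close> keeps it below \<open>c\<close> near a point where it is
  less than the minimum of \<open>p\<close>. A bump there has \<open>F\<close> positive, since
  \<open>V\<close> is positive almost everywhere and a nonempty open box is not negligible.\<close>

lemma low_exponent_bump:
  assumes "h_minus Om q < h_minus Om p"
  obtains \<phi> c b where "test_fun Om \<phi>" "1 < c" "c < b" "\<And>x. x \<in> Om \<Longrightarrow> b \<le> p x"
    "\<And>x. \<phi> x \<noteq> 0 \<Longrightarrow> q x \<le> c" "0 < F \<phi>"
proof -
  have ne: "closure Om \<noteq> {}" using nonempty_Om by simp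
  have bp: "bdd_below (p ` closure Om)" by (rule bdd_belowI2[of _ 1]) (use p_bounds in force)
  define b where "b = h_minus Om p"
  have b: "b \<le> p x" if "x \<in> closure Om" for x
    unfolding b_def h_minus_def using bp that by (rule cINF_lower)
  obtain x0 where x0: "x0 \<in> closure Om" "q x0 < b"
    using cInf_lessD[of "q ` closure Om" b] assms ne unfolding b_def h_minus_def by auto
  define c where "c = (q x0 + b) / 2"
  have c: "q x0 < c" "c < b" "1 < c" using x0 q_gt[OF x0(1)] by (auto simp: c_def field_simps)
  obtain d where d: "0 < d" "\<And>x. x \<in> closure Om \<Longrightarrow> dist x x0 < d \<Longrightarrow> dist (q x) (q x0) < c - q x0"
    using cont_q[unfolded continuous_on_iff, rule_format, OF x0(1), of "c - q x0"] c by auto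
  \<comment> \<open>The point \<open>x0\<close> may lie on the boundary, so the box is placed around
    a nearby point of \<open>Om\<close>.\<close>
  obtain y where y: "y \<in> Om" "dist y x0 < d" using x0(1) d(1) by (meson closure_approachable)
  have "open (Om \<inter> ball x0 d)" using open_Om by auto
  moreover have "y \<in> Om \<inter> ball x0 d" using y by (simp add: dist_commute)
  ultimately obtain l r where lr: "cbox l r \<subseteq> Om \<inter> ball x0 d" "y \<in> box l r"
    using open_contains_cbox[of "Om \<inter> ball x0 d" y] by metis
  define \<phi> where "\<phi> = box_bump 0 l r"
  have t: "test_fun Om \<phi>" unfolding \<phi>_def using lr(1) by (intro test_fun_box_bump) auto
  note [measurable] = test_fun_measurable[OF t]
  have H: "H10 \<phi> (grad \<phi>)" by (rule H10_test[OF t])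
  have qc: "q x \<le> c" if "\<phi> x \<noteq> 0" for x
  proof -
    have "x \<in> cbox l r" using that box_bump_zero[of x l r 0] box_subset_cbox[of l r] by (auto simp: \<phi>_def)
    then have "x \<in> Om" "dist x x0 < d" using lr(1) by (auto simp: dist_commute)
    then show ?thesis using d(2)[OF mem_closure_Om, of x] by (auto simp: dist_real_def)
  qed
  have "F \<phi> \<noteq> 0"
  proof
    assume "F \<phi> = 0"
    moreover have "AE x in \<Omega>. 0 \<le> V x * (1 / q x * \<bar>\<phi> x\<bar> powr q x)"
      using AE_V0 AE_q by eventually_elim auto
    ultimately have "AE x in \<Omega>. V x * (1 / q x * \<bar>\<phi> x\<bar> powr q x) = 0"
      using integral_nonneg_eq_0_iff_AE[OF F_integrable[OF H10_weighted_integrable[OF H]]] by (simp add: F_def)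
    then have "AE x in \<Omega>. x \<notin> box l r" using V_pos AE_q
    proof eventually_elim
      case (elim x)
      then have "\<phi> x = 0" by auto
      then show ?case using box_bump_pos[of x l r 0] by (auto simp: \<phi>_def)
    qed
    then have "AE x in lebesgue. x \<in> Om \<longrightarrow> x \<notin> box l r"
      using open_Om by (subst (asm) AE_restrict_space_iff) auto
    then have "AE x in lebesgue. x \<notin> box l r"
      by eventually_elim (use lr(1) box_subset_cbox[of l r] in auto)
    then have "box l r \<in> null_sets lebesgue" by (subst (asm) AE_iff_null_sets[symmetric]) auto
    then have "negligible (box l r)" by (simp add: negligible_iff_null_sets)
    then show False using lr(2) open_not_negligible[of "box l r"] open_box by auto
  qed
  then have "0 < F \<phi>" using F_nonneg[of \<phi>] by simp
  with that t c b qc mem_closure_Om show thesis by blast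
qed

text \<open>Powers of \<open>t \<le> 1\<close> decrease in the exponent: the gradient terms shrink
  at least like \<open>t powr b\<close> and \<open>F\<close> at most like \<open>t powr c\<close>.
  As \<open>c < b\<close>, \<open>F\<close> dominates for small \<open>t\<close>.\<close>

lemma scaled_bump:
  assumes "test_fun Om \<phi>" "1 < c" "c < b" "\<And>x. x \<in> Om \<Longrightarrow> b \<le> p x" "\<And>x. \<phi> x \<noteq> 0 \<Longrightarrow> q x \<le> c" and t: "0 < t" "t \<le> 1"
  shows "G (grad (\<lambda>x. t * \<phi> x)) \<le> t powr b * G (grad \<phi>)"
    "(LINT x|\<Omega>. norm (grad (\<lambda>x. t * \<phi> x) x) powr p x) \<le> t powr b * (LINT x|\<Omega>. norm (grad \<phi> x) powr p x)"
    "t powr c * F \<phi> \<le> F (\<lambda>x. t * \<phi> x)"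
proof -
  have tt: "test_fun Om (\<lambda>x. t * \<phi> x)" using assms(1) by (rule test_fun_scale)
  have gr: "grad (\<lambda>x. t * \<phi> x) x = t *\<^sub>R grad \<phi> x" for x by (rule grad_scale[OF test_fun_smooth[OF assms(1)]])
  note i = G_test_integrable[OF tt] G_test_integrable[OF assms(1)]
  have le: "norm (grad (\<lambda>x. t * \<phi> x) x) powr p x \<le> t powr b * norm (grad \<phi> x) powr p x" if "x \<in> Om" for x
  proof -
    have "norm (grad (\<lambda>x. t * \<phi> x) x) powr p x = t powr p x * norm (grad \<phi> x) powr p x"
      using t by (simp add: gr powr_mult)
    also have "\<dots> \<le> t powr b * norm (grad \<phi> x) powr p x"
      using t assms(4)[OF that] by (intro mult_right_mono powr_mono') auto
    finally show ?thesis .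
  qed
  have "(LINT x|\<Omega>. norm (grad (\<lambda>x. t * \<phi> x) x) powr p x) \<le> (LINT x|\<Omega>. t powr b * norm (grad \<phi> x) powr p x)"
    using i le by (intro integral_mono) auto
  then show "(LINT x|\<Omega>. norm (grad (\<lambda>x. t * \<phi> x) x) powr p x) \<le> t powr b * (LINT x|\<Omega>. norm (grad \<phi> x) powr p x)" by simp
  have "G (grad (\<lambda>x. t * \<phi> x)) \<le> (LINT x|\<Omega>. t powr b * (1 / p x * norm (grad \<phi> x) powr p x))"
    unfolding G_def
  proof (rule integral_mono)
    show "integrable \<Omega> (\<lambda>x. t powr b * (1 / p x * norm (grad \<phi> x) powr p x))"
      using G_integrable[OF i(2)] by (rule integrable_mult_right)
    show "1 / p x * norm (grad (\<lambda>x. t * \<phi> x) x) powr p x \<le> t powr b * (1 / p x * norm (grad \<phi> x) powr p x)" if "x \<in> space \<Omega>" for x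
    proof -
      have "1 / p x * norm (grad (\<lambda>x. t * \<phi> x) x) powr p x \<le> 1 / p x * (t powr b * norm (grad \<phi> x) powr p x)"
        using that p_Om(1)[of x] by (intro mult_left_mono le) auto
      then show ?thesis by (simp only: mult_ac)
    qed
  qed (rule G_integrable[OF i(1)])
  also have "\<dots> = t powr b * G (grad \<phi>)" unfolding G_def by (rule Bochner_Integration.integral_mult_right_zero)
  finally show "G (grad (\<lambda>x. t * \<phi> x)) \<le> t powr b * G (grad \<phi>)" .
  note iF = F_integrable[OF H10_weighted_integrable[OF H10_test[OF tt]]] F_integrable[OF H10_weighted_integrable[OF H10_test[OF assms(1)]]]
  have "t powr c * F \<phi> = (LINT x|\<Omega>. t powr c * (V x * (1 / q x * \<bar>\<phi> x\<bar> powr q x)))"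
    unfolding F_def by (rule Bochner_Integration.integral_mult_right_zero[symmetric])
  also have "\<dots> \<le> F (\<lambda>x. t * \<phi> x)" unfolding F_def
  proof (rule integral_mono_AE)
    show "integrable \<Omega> (\<lambda>x. t powr c * (V x * (1 / q x * \<bar>\<phi> x\<bar> powr q x)))" using iF(2) by (rule integrable_mult_right)
    show "AE x in \<Omega>. t powr c * (V x * (1 / q x * \<bar>\<phi> x\<bar> powr q x)) \<le> V x * (1 / q x * \<bar>t * \<phi> x\<bar> powr q x)"
      using AE_V0 AE_q
    proof eventually_elim
      case (elim x)
      have "t powr c * \<bar>\<phi> x\<bar> powr q x \<le> \<bar>t * \<phi> x\<bar> powr q x"
      proof (cases "\<phi> x = 0")
        case False
        have "t powr c * \<bar>\<phi> x\<bar> powr q x \<le> t powr q x * \<bar>\<phi> x\<bar> powr q x"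
          using t assms(5)[OF False] by (intro mult_right_mono powr_mono') auto
        then show ?thesis using t by (simp add: abs_mult powr_mult)
      qed simp
      then have "V x * (1 / q x * (t powr c * \<bar>\<phi> x\<bar> powr q x)) \<le> V x * (1 / q x * \<bar>t * \<phi> x\<bar> powr q x)"
        using elim by (intro mult_left_mono) auto
      then show ?case by (simp only: mult_ac)
    qed
  qed (rule iF(1))
  finally show "t powr c * F \<phi> \<le> F (\<lambda>x. t * \<phi> x)" .
qed

text \<open>The value \<open>Y / (X + Y)\<close> for the power works also when \<open>X = 0\<close>,
  which avoids a case distinction.\<close>

lemma small_power:
  fixes X Y k :: real
  assumes "0 \<le> X" "0 < Y" "0 < k"
  obtains t where "0 < t" "t \<le> 1" "t powr k * X < Y"
proof -
  define y where "y = Y / (X + Y)"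
  have y: "0 < y" "y \<le> 1" "y * X < Y"
  proof -
    show "0 < y" "y \<le> 1" using assms by (auto simp: y_def)
    have "Y * X < Y * (X + Y)" using assms by (intro mult_strict_left_mono) auto
    then show "y * X < Y" using assms by (simp add: y_def pos_divide_less_eq)
  qed
  show thesis
  proof (rule that[of "y powr (1 / k)"])
    show "y powr (1 / k) \<le> 1" using y assms by (intro powr_le1) auto
    show "(y powr (1 / k)) powr k * X < Y" using y assms by (simp add: powr_powr)
  qed (use y in simp)
qed

lemma test_fun_M_set: "test_fun Om f \<Longrightarrow> G (grad f) \<le> \<alpha> \<Longrightarrow> f \<in> M_set Om p \<alpha>"
  using H10_imp_W10[OF H10_test] G_fun_eq[OF H10_imp_W10(2)[OF H10_test] H10_measurable(2)[OF H10_test]]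
  by (simp add: M_set_def)

lemma F_zero: "ae_zero Om u \<Longrightarrow> u \<in> borel_measurable \<Omega> \<Longrightarrow> F u = 0"
proof -
  assume z: "ae_zero Om u" and [measurable]: "u \<in> borel_measurable \<Omega>"
  have "F u = (LINT x|\<Omega>. 0)" unfolding F_def
  proof (rule integral_cong_AE)
    show "AE x in \<Omega>. V x * (1 / q x * \<bar>u x\<bar> powr q x) = 0"
      using z[unfolded ae_zero_def] by eventually_elim simp
  qed measurable
  then show ?thesis by simp
qed

lemma lambda_star_zero:
  assumes hq: "h_minus Om q < h_minus Om p" and \<alpha>: "0 < \<alpha>"
  shows "lambda_star Om p q V \<alpha> = 0"
proof (rule antisym)
  obtain \<phi> c b where \<phi>: "test_fun Om \<phi>" "1 < c" "c < b" "\<And>x. x \<in> Om \<Longrightarrow> b \<le> p x"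
    "\<And>x. \<phi> x \<noteq> 0 \<Longrightarrow> q x \<le> c" "0 < F \<phi>" by (rule low_exponent_bump[OF hq]) (rule that)
  define D where "D = (LINT x|\<Omega>. norm (grad \<phi> x) powr p x)"
  have D: "0 \<le> D" by (simp add: D_def)
  have small: "\<exists>u\<in>{u \<in> M_set Om p \<alpha>. \<not> ae_zero Om u}. psi_fun Om p u / phi_fun Om q V u < e" if e: "0 < e" for e
  proof -
    \<comment> \<open>One choice of \<open>t\<close> meets two demands: the maximum and the minimum
      combine the bound for the quotient with the constraint
      \<open>G \<le> \<alpha>\<close>.\<close>
    define X where "X = max D (G (grad \<phi>))"
    define Y where "Y = min (e * F \<phi>) \<alpha>"
    obtain t where t: "0 < t" "t \<le> 1" "t powr (b - c) * X < Y"
      by (rule small_power[of X Y "b - c"]) (use D e \<alpha> \<phi> in \<open>auto simp: X_def Y_def le_max_iff_disj\<close>)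
    have tb: "t powr b = t powr c * t powr (b - c)" by (simp add: powr_add[symmetric])
    have tc: "0 < t powr c" "t powr c \<le> 1" using t \<phi>(2) by (auto intro: powr_le1)
    note sc = scaled_bump[OF \<phi>(1-5) t(1,2)]
    define u where "u = (\<lambda>x. t * \<phi> x)"
    have u: "test_fun Om u" unfolding u_def using \<phi>(1) by (rule test_fun_scale)
    note H = H10_test[OF u]
    have "t powr (b - c) * G (grad \<phi>) \<le> t powr (b - c) * X" by (intro mult_left_mono) (auto simp: X_def)
    then have 1: "t powr (b - c) * G (grad \<phi>) \<le> \<alpha>" using t(3) by (simp add: Y_def)
    have "t powr c * (t powr (b - c) * G (grad \<phi>)) \<le> 1 * (t powr (b - c) * G (grad \<phi>))"
      using tc G_nonneg by (intro mult_right_mono mult_nonneg_nonneg) auto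
    then have "G (grad u) \<le> \<alpha>" using sc(1) 1 unfolding tb u_def by (simp add: mult.assoc)
    then have uM: "u \<in> M_set Om p \<alpha>" by (rule test_fun_M_set[OF u])
    have Fu: "t powr c * F \<phi> \<le> F u" unfolding u_def by (rule sc(3))
    then have Fpos: "0 < F u" using tc \<phi>(6) by (meson mult_pos_pos order_less_le_trans)
    then have nz: "\<not> ae_zero Om u" using F_zero[OF _ test_fun_measurable(1)[OF u]] by auto
    have phi: "F u \<le> phi_fun Om q V u" unfolding phi_fun_def by (rule F_le[OF H10_weighted_integrable[OF H]])
    have psi: "psi_fun Om p u = (LINT x|\<Omega>. norm (grad u x) powr p x)"
      by (rule psi_fun_eq[OF H10_imp_W10(2)[OF H] H10_measurable(2)[OF H]])
    have "psi_fun Om p u \<le> t powr b * D" unfolding psi using sc(2) by (simp add: u_def D_def)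
    also have "\<dots> \<le> t powr c * (t powr (b - c) * X)"
      unfolding tb mult.assoc by (intro mult_left_mono) (auto simp: X_def)
    also have "\<dots> < t powr c * (e * F \<phi>)"
      using t(3) tc by (intro mult_strict_left_mono) (auto simp: Y_def)
    also have "\<dots> = e * (t powr c * F \<phi>)" by simp
    also have "\<dots> \<le> e * phi_fun Om q V u" using e Fu phi by (intro mult_left_mono) auto
    finally have "psi_fun Om p u / phi_fun Om q V u < e"
      using Fpos phi by (subst pos_divide_less_eq) auto
    with uM nz show ?thesis by blast
  qed
  show "lambda_star Om p q V \<alpha> \<le> 0"
  proof (rule field_le_epsilon)
    fix e :: real assume "0 < e"
    from small[OF this] obtain u where "u \<in> M_set Om p \<alpha>" "\<not> ae_zero Om u" "psi_fun Om p u / phi_fun Om q V u < e" by auto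
    then show "lambda_star Om p q V \<alpha> \<le> 0 + e" using lambda_star_le[of u \<alpha>] by linarith
  qed
  show "0 \<le> lambda_star Om p q V \<alpha>" unfolding lambda_star_def
  proof (rule cINF_greatest)
    show "{u \<in> M_set Om p \<alpha>. \<not> ae_zero Om u} \<noteq> {}" using small[of 1] by auto
  qed (simp add: phi_nonneg psi_nonneg)
qed

lemma eigenvalues_near_zero:
  assumes hq: "h_minus Om q < h_minus Om p" and \<alpha>: "0 < \<alpha>"
  shows "\<exists>l>0. \<forall>lam. 0 < lam \<and> lam < l \<longrightarrow> (\<exists>u \<in> M_set Om p \<alpha>. eigenpair Om p q V lam u)"
proof -
  obtain C where C: "0 \<le> C" "\<And>u g. H10 u g \<Longrightarrow> G g \<le> \<alpha> \<Longrightarrow> F u \<le> C"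
    by (rule F_bounded[OF less_imp_le[OF \<alpha>]]) (rule that)
  obtain \<phi> c b where \<phi>: "test_fun Om \<phi>" "1 < c" "c < b" "\<And>x. x \<in> Om \<Longrightarrow> b \<le> p x"
    "\<And>x. \<phi> x \<noteq> 0 \<Longrightarrow> q x \<le> c" "0 < F \<phi>" by (rule low_exponent_bump[OF hq]) (rule that)
  \<comment> \<open>The threshold gives \<open>lam * C < \<alpha>\<close>, so
    \<open>G - lam * F\<close> is positive wherever \<open>G = \<alpha>\<close>; the summand 1
    allows \<open>C = 0\<close>.\<close>
  have "\<exists>u \<in> M_set Om p \<alpha>. eigenpair Om p q V lam u" if lam: "0 < lam" "lam < \<alpha> / (C + 1)" for lam
  proof -
    have "lam * C \<le> lam * (C + 1)" using lam by simp
    also have "\<dots> < \<alpha>" using lam C(1) by (simp add: field_simps)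
    finally have lC: "lam * C < \<alpha>" .
    obtain u g where H: "H10 u g" and G\<alpha>: "G g \<le> \<alpha>"
      and min: "\<And>f. test_fun Om f \<Longrightarrow> G (grad f) \<le> \<alpha> \<Longrightarrow> G g - lam * F u \<le> G (grad f) - lam * F f"
      by (rule exists_minimizer[OF \<alpha> lam(1)]) (rule that)
    have neg: "G g - lam * F u < 0"
    proof -
      define Y where "Y = min (lam * F \<phi>) \<alpha>"
      obtain t where t: "0 < t" "t \<le> 1" "t powr (b - c) * G (grad \<phi>) < Y"
        by (rule small_power[of "G (grad \<phi>)" Y "b - c"]) (use G_nonneg lam \<alpha> \<phi> in \<open>auto simp: Y_def\<close>)
      have tb: "t powr b = t powr c * t powr (b - c)" by (simp add: powr_add[symmetric])
      have tc: "0 < t powr c" "t powr c \<le> 1" using t \<phi>(2) by (auto intro: powr_le1)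
      note sc = scaled_bump[OF \<phi>(1-5) t(1,2)]
      define w where "w = (\<lambda>x. t * \<phi> x)"
      have w: "test_fun Om w" unfolding w_def using \<phi>(1) by (rule test_fun_scale)
      have "t powr c * (t powr (b - c) * G (grad \<phi>)) \<le> 1 * (t powr (b - c) * G (grad \<phi>))"
        using tc G_nonneg by (intro mult_right_mono mult_nonneg_nonneg) auto
      then have Gw: "G (grad w) \<le> \<alpha>" using sc(1) t(3) unfolding tb w_def by (simp add: mult.assoc Y_def)
      have "G (grad w) \<le> t powr c * (t powr (b - c) * G (grad \<phi>))" using sc(1) unfolding tb w_def by (simp add: mult.assoc)
      also have "\<dots> < t powr c * (lam * F \<phi>)"
        using t(3) tc by (intro mult_strict_left_mono) (auto simp: Y_def)
      also have "\<dots> = lam * (t powr c * F \<phi>)" by simp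
      also have "\<dots> \<le> lam * F w" unfolding w_def using lam sc(3) by (intro mult_left_mono) auto
      finally show ?thesis using min[OF w Gw] by linarith
    qed
    have "G g \<noteq> \<alpha>"
    proof
      assume "G g = \<alpha>"
      moreover have "lam * F u \<le> lam * C" using C(2)[OF H G\<alpha>] lam by simp
      ultimately show False using neg lC by linarith
    qed
    then have G: "G g < \<alpha>" using G\<alpha> by simp
    \<comment> \<open>A negative minimum forces \<open>F u\<close> to be nonzero, which is how the
      zero function is ruled out as an eigenfunction.\<close>
    have "F u \<noteq> 0" using neg G_nonneg[of g] by auto
    then have nz: "\<not> ae_zero Om u" using F_zero[OF _ H10_measurable(1)[OF H]] by auto
    have "eigenpair Om p q V lam u"
      by (rule eigenpairI[OF H nz euler_lagrange_H10[OF H euler_lagrange_test[OF H lam(1) G min]]])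
    moreover have "u \<in> M_set Om p \<alpha>"
      using H10_imp_W10[OF H] G_fun_eq[OF H10_imp_W10(2)[OF H] H10_measurable(2)[OF H]] G\<alpha> by (simp add: M_set_def)
    ultimately show ?thesis by blast
  qed
  moreover have "0 < \<alpha> / (C + 1)" using \<alpha> C(1) by simp
  ultimately show ?thesis by blast
qed

end

theorem theorem3p1:
  fixes Om :: "(real ^ 'n) set"
    and p q s V :: "real ^ 'n \<Rightarrow> real"
    and \<alpha> :: real
  assumes "CARD('n) \<ge> 2"
    and "bounded_smooth_domain Om"
    and "continuous_on (closure Om) p"
    and "continuous_on (closure Om) q"
    and "continuous_on (closure Om) s"
    and "\<And>x. x \<in> closure Om \<Longrightarrow> 1 < p x \<and> p x < real CARD('n)"
    and "\<And>x. x \<in> closure Om \<Longrightarrow> 1 < q x \<and> q x < real CARD('n)"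
    and "\<And>x. x \<in> closure Om \<Longrightarrow> real CARD('n) < s x"
    and "\<And>x. x \<in> closure Om \<Longrightarrow> s x * q x / (s x - 1) < p_star p x"
    and "V \<in> Lvar Om s"
    and "AE x in lebesgue_on Om. V x > 0"
    and "\<alpha> > 0"
  shows "(\<forall>lam. 0 < lam \<and> lam < lambda_star Om p q V \<alpha> \<longrightarrow> lam \<notin> Lambda_set Om p q V \<alpha>) \<and>
    (h_minus Om q < h_minus Om p \<longrightarrow>
       (\<exists>lam\<^sub>\<alpha>>0. \<forall>lam. 0 < lam \<and> lam < lam\<^sub>\<alpha> \<longrightarrow>
          (\<exists>u \<in> M_set Om p \<alpha>. eigenpair Om p q V lam u)) \<and>
       lambda_star Om p q V \<alpha> = 0)"
proof -
  interpret weighted_domain Om p q s V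
  proof
    show "1 < s x" if "x \<in> closure Om" for x using assms(1) assms(8)[OF that] by linarith
  qed (use assms in \<open>auto simp: bounded_smooth_domain_def\<close>)
  show ?thesis
    using small_not_eigenvalue eigenvalues_near_zero[OF _ assms(12)] lambda_star_zero[OF _ assms(12)] by blast
qed

end
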